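(* Let $s\ge1$ be a fixed integer (not depending on $p$) and $A=\sqrt{2\log p/n}$. Assume either $\mathbf X\in\mathrm{SubG}(\sigma^2)$ with $n/(p(\log p)^2)\to\infty$, or $\mathbf X\in\mathcal O_n(p)$ with $n\ge p$. Then $\mathrm{Risk}(s,A)\to(1/2)^s$ as $p\to\infty$.
   Context: Setting: for each $p$ one observes $(\mathbf y,\mathbf X)$ with $\mathbf y=\mathbf X\boldsymbol\beta+\boldsymbol\varepsilon$, where $\boldsymbol\varepsilon\sim\mathcal N(0,I_n)$, $\mathbf X$ is an $n\times p$ real matrix independent of $\boldsymbol\varepsilon$, $\boldsymbol\beta\in\mathbb R^p$ is unknown, and $n=n(p)\to\infty$ as $p\to\infty$. Design classes: $\mathbf X\in\mathrm{SubG}(\sigma^2)$ means the rows of $\mathbf X$ are i.i.d. centered isotropic ($\mathbb E[xx^T]=I_p$) sub-Gaussian random vectors with sub-Gaussian parameter $\sigma^2$ (for every unit $u$ and $t\in\mathbb R$, $\log\mathbb E e^{t\langle u,x\rangle}\le\sigma^2t^2/2$), and $\mathbf X^T\mathbf X$ is almost surely positive definite; $\mathbf X\in\mathcal O_n(p)$ means $\mathbf X^T\mathbf X=nI_p$. For an integer $s$ and $A>0$, $\Xi(s,A)=\{\boldsymbol\beta\in\mathbb R^p:|\mathrm{supp}(\boldsymbol\beta)|=s,\ |\beta_i|\ge A\text{ for }i\in\mathrm{supp}(\boldsymbol\beta)\}$. A test $T$ is a measurable $[0,1]$-valued function of $(\mathbf y,\mathbf X)$; $\mathbb P_{\boldsymbol\beta},\mathbb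 E_{\boldsymbol\beta}$ denote the law/expectation of $(\mathbf y,\mathbf X)$ (including the randomness of $\mathbf X$) under parameter $\boldsymbol\beta$, and $\mathbb P_0,\mathbb E_0$ those under $\boldsymbol\beta=0$. $\mathrm{Risk}(T,s,A)=\mathbb E_0[T]+\sup_{\boldsymbol\beta\in\Xi(s,A)}\mathbb E_{\boldsymbol\beta}[1-T]$ and $\mathrm{Risk}(s,A)=\inf_T\mathrm{Risk}(T,s,A)$. *)

theory Defs
  imports "HOL-Probability.Probability"
begin

definition vecM :: "nat \<Rightarrow> (nat \<Rightarrow> real) measure" where
  "vecM k = PiM {..<k} (\<lambda>_. borel)"

definition matM :: "nat \<Rightarrow> nat \<Rightarrow> (nat \<Rightarrow> nat \<Rightarrow> real) measure" where
  "matM n p = PiM {..<n} (\<lambda>_. vecM p)"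

definition obsM :: "nat \<Rightarrow> nat \<Rightarrow> ((nat \<Rightarrow> real) \<times> (nat \<Rightarrow> nat \<Rightarrow> real)) measure" where
  "obsM n p = vecM n \<Otimes>\<^sub>M matM n p"

definition noise :: "nat \<Rightarrow> (nat \<Rightarrow> real) measure" where
  "noise n = PiM {..<n} (\<lambda>_. density lborel (\<lambda>x. ennreal (std_normal_density x)))"

definition gram :: "nat \<Rightarrow> (nat \<Rightarrow> nat \<Rightarrow> real) \<Rightarrow> nat \<Rightarrow> nat \<Rightarrow> real" where
  "gram n X j k = (\<Sum>i<n. X i j * X i k)"

definition pos_def :: "nat \<Rightarrow> (nat \<Rightarrow> nat \<Rightarrow> real) \<Rightarrow> bool" where
  "pos_def p M \<longleftrightarrow> (\<forall>v. (\<exists>j<p. v j \<noteq> 0) \<longrightarrow> (\<Sum>j<p. \<Sum>k<p. v j * M j k * v k) > 0)"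

definition subG_design :: "real \<Rightarrow> nat \<Rightarrow> nat \<Rightarrow> (nat \<Rightarrow> nat \<Rightarrow> real) measure \<Rightarrow> bool" where
  "subG_design sigma2 n p \<mu> \<longleftrightarrow>
     (\<exists>\<nu>. prob_space \<nu> \<and> sets \<nu> = sets (vecM p) \<and>
        \<mu> = PiM {..<n} (\<lambda>_. \<nu>) \<and>
        (\<forall>j<p. integrable \<nu> (\<lambda>x. x j) \<and> (\<integral>x. x j \<partial>\<nu>) = 0) \<and>
        (\<forall>j<p. \<forall>k<p. integrable \<nu> (\<lambda>x. x j * x k) \<and>
                (\<integral>x. x j * x k \<partial>\<nu>) = (if j = k then 1 else 0)) \<and>
        (\<forall>u. (\<Sum>j<p. (u j)\<^sup>2) = 1 \<longrightarrow>
            (\<forall>t::real. integrable \<nu> (\<lambda>x. exp (t * (\<Sum>j<p. u j * x j))) \<and>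
               ln (\<integral>x. exp (t * (\<Sum>j<p. u j * x j)) \<partial>\<nu>) \<le> sigma2 * t\<^sup>2 / 2))) \<and>
     (AE X in \<mu>. pos_def p (gram n X))"

definition orth_design :: "nat \<Rightarrow> nat \<Rightarrow> (nat \<Rightarrow> nat \<Rightarrow> real) measure \<Rightarrow> bool" where
  "orth_design n p \<mu> \<longleftrightarrow> prob_space \<mu> \<and> sets \<mu> = sets (matM n p) \<and>
     (AE X in \<mu>. \<forall>j<p. \<forall>k<p. gram n X j k = (if j = k then real n else 0))"

definition law :: "nat \<Rightarrow> nat \<Rightarrow> (nat \<Rightarrow> nat \<Rightarrow> real) measure \<Rightarrow> (nat \<Rightarrow> real)
    \<Rightarrow> ((nat \<Rightarrow> real) \<times> (nat \<Rightarrow> nat \<Rightarrow> real)) measure" where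
  "law n p \<mu> \<beta> = distr (\<mu> \<Otimes>\<^sub>M noise n) (obsM n p)
     (\<lambda>(X, e). ((\<lambda>i\<in>{..<n}. (\<Sum>j<p. X i j * \<beta> j) + e i), X))"

definition Xi :: "nat \<Rightarrow> nat \<Rightarrow> real \<Rightarrow> (nat \<Rightarrow> real) set" where
  "Xi p s A = {\<beta>. (\<forall>j. p \<le> j \<longrightarrow> \<beta> j = 0) \<and> card {j. j < p \<and> \<beta> j \<noteq> 0} = s \<and>
                  (\<forall>j<p. \<beta> j \<noteq> 0 \<longrightarrow> \<bar>\<beta> j\<bar> \<ge> A)}"

definition tests :: "nat \<Rightarrow> nat \<Rightarrow> (((nat \<Rightarrow> real) \<times> (nat \<Rightarrow> nat \<Rightarrow> real)) \<Rightarrow> real) set" where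
  "tests n p = {T. T \<in> borel_measurable (obsM n p) \<and>
                   (\<forall>z\<in>space (obsM n p). 0 \<le> T z \<and> T z \<le> 1)}"

definition risk_test :: "nat \<Rightarrow> nat \<Rightarrow> (nat \<Rightarrow> nat \<Rightarrow> real) measure
    \<Rightarrow> (((nat \<Rightarrow> real) \<times> (nat \<Rightarrow> nat \<Rightarrow> real)) \<Rightarrow> real) \<Rightarrow> nat \<Rightarrow> real \<Rightarrow> real" where
  "risk_test n p \<mu> T s A = (\<integral>z. T z \<partial>law n p \<mu> (\<lambda>_. 0)) +
     (SUP \<beta>\<in>Xi p s A. \<integral>z. 1 - T z \<partial>law n p \<mu> \<beta>)"

definition minimax_risk :: "nat \<Rightarrow> nat \<Rightarrow> (nat \<Rightarrow> nat \<Rightarrow> real) measure \<Rightarrow> nat \<Rightarrow> real \<Rightarrow> real" where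
  "minimax_risk n p \<mu> s A = (INF T\<in>tests n p. risk_test n p \<mu> T s A)"

end

(*
  After rescaling, the columns v_j = X_j / sqrt n of the design are nearly orthonormal: exactly so for
  an orthogonal design, and up to an error o(1 / log p) for a sub-Gaussian one, because fourth moments
  give P(max_{j,k} |<v_j, v_k> - delta_jk| > d) = O(p^2 / (n^2 d^4)) and n >> p (log p)^2.  With
  a = sqrt (2 log p), the problem becomes the detection of s coordinates of size a in Gaussian noise.

  Upper bound: reject if some |<v_j, y>| exceeds a + h with h -> 0 and a h -> infinity.  A Chernoff
  bound makes the type I error vanish, and an active coordinate of size a stays below the threshold
  with probability tending to 1/2, asymptotically independently over the s active coordinates.

  Lower bound: the likelihood ratio averaged over a prior on supports is truncated to the event that
  all active coordinates are at most a - h.  Its mean tends to q = (1/2)^s and, thanks to the truncation,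
  its second moment tends to q^2, so it is close to q in L^2 and no test beats the risk q.

  Because of the margin h, exponential moments suffice where one would otherwise need sharp Gaussian
  tails; the only other ingredient is the probability of Gaussian orthants.  It converges because
  trigonometric polynomials approximate the step function and the joint characteristic function of
  Gaussian linear forms depends continuously on their Gram matrix.
*)
theory Submission
  imports Defs
begin

section \<open>Gaussian noise vectors\<close>

text \<open>The margin is \<open>h = 1 / sqrt a\<close>, so that \<open>a h = sqrt a\<close>. This
  one quantity drives both bounds: the union over \<open>p\<close> columns meets a tail of order at
  most \<open>exp (- sqrt a) / p\<close>, and each coordinate shared by two supports costs at most
  \<open>p * exp (- sqrt a)\<close>, against a sharing probability of order \<open>1 / p\<close>.
  Inner products of mean vectors stand in the exponents of likelihood ratios, which is why the Gram
  error \<open>d\<close> has to satisfy \<open>a^2 d -> 0\<close>. The main obstacle is uniformity.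
  Designs are random and supports vary, while characteristic functions only give limits along
  sequences; \<open>orthant_close\<close> turns the limit into a statement uniform in dimension,
  vectors and index set. All later estimates hold for one fixed good design and are averaged over
  the design at the end. Signals have no upper bound, and cross terms caused by non-orthogonality
  grow with the signal, so large signals need their own argument in the upper bound. In the lower
  bound, \<open>min 1 L\<close> is minorized by a quadratic polynomial in the averaged likelihood
  ratio \<open>L\<close>, so its first two moments suffice.\<close>

definition ip :: "nat \<Rightarrow> (nat \<Rightarrow> real) \<Rightarrow> (nat \<Rightarrow> real) \<Rightarrow> real" where
  "ip n u v = (\<Sum>i<n. u i * v i)"

lemma ip_commute: "ip n u v = ip n v u"
  by (simp add: ip_def mult.commute)

lemma ip_add_left: "ip n (\<lambda>i. u i + v i) w = ip n u w + ip n v w"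
  by (simp add: ip_def distrib_right sum.distrib)

lemma ip_scale_left: "ip n (\<lambda>i. a * u i) w = a * ip n u w"
  by (simp add: ip_def sum_distrib_left mult.assoc)

lemma ip_sum_left: "ip n (\<lambda>i. \<Sum>k\<in>K. u k i) w = (\<Sum>k\<in>K. ip n (u k) w)"
  unfolding ip_def sum_distrib_right by (rule sum.swap)

lemma ip_add_right: "ip n w (\<lambda>i. u i + v i) = ip n w u + ip n w v"
  by (metis ip_add_left ip_commute)

lemma ip_scale_right: "ip n w (\<lambda>i. a * u i) = a * ip n w u"
  by (metis ip_scale_left ip_commute)

lemma ip_sum_right: "ip n w (\<lambda>i. \<Sum>k\<in>K. u k i) = (\<Sum>k\<in>K. ip n w (u k))"
  by (simp only: ip_commute[of n w] ip_sum_left)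

lemma ip_nonneg: "0 \<le> ip n u u"
  by (simp add: ip_def sum_nonneg)

lemma ip_restrict [simp]: "ip n c (\<lambda>i\<in>{..<n}. e i) = ip n c e"
  by (simp add: ip_def)

lemma measurable_vecM_component [measurable]: "i < n \<Longrightarrow> (\<lambda>e. e i) \<in> borel_measurable (vecM n)"
  unfolding vecM_def by (rule measurable_component_singleton) simp

lemma measurable_ip [measurable]: "ip n c \<in> borel_measurable (vecM n)"
  unfolding ip_def [abs_def] by measurable

lemma measurable_vecM_shift [measurable]:
  "(\<lambda>e. \<lambda>i\<in>{..<n}. w i + e i) \<in> measurable (vecM n) (vecM n)"
proof -
  have "(\<lambda>e. \<lambda>i\<in>{..<n}. w i + e i) \<in> measurable (vecM n) (PiM {..<n} (\<lambda>_. borel))"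
    by (rule measurable_restrict) (simp add: borel_measurable_add)
  then show ?thesis by (simp add: vecM_def)
qed

lemma prob_space_noise: "prob_space (noise n)"
  unfolding noise_def by (intro prob_space_PiM prob_space_normal_density) simp

lemma sets_noise [measurable_cong, simp]: "sets (noise n) = sets (vecM n)"
  unfolding noise_def vecM_def by (intro sets_PiM_cong) auto

lemma space_noise [simp]: "space (noise n) = space (vecM n)"
  by (rule sets_eq_imp_space_eq) simp

lemma std_normal_shift:
  "distr std_normal_distribution borel (\<lambda>x. w + x) =
   density std_normal_distribution (\<lambda>x. ennreal (exp (w * x - w\<^sup>2 / 2)))"
proof -
  have *: "std_normal_density (- w + x) = std_normal_density x * exp (w * x - w\<^sup>2 / 2)" for x
    by (simp add: std_normal_density_def exp_add [symmetric] power2_eq_square field_simps)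
  have "distr std_normal_distribution borel (\<lambda>x. w + x) =
      density lborel (\<lambda>x. ennreal (std_normal_density (- w + x)))"
  proof (rule measure_eqI)
    fix B assume "B \<in> sets (distr std_normal_distribution borel (\<lambda>x. w + x))"
    then have [measurable]: "B \<in> sets borel" by simp
    have "emeasure (distr std_normal_distribution borel (\<lambda>x. w + x)) B =
        (\<integral>\<^sup>+ x. ennreal (std_normal_density x) * indicator B (w + x) \<partial>lborel)"
      by (simp add: nn_integral_indicator [symmetric] nn_integral_distr nn_integral_density
          del: nn_integral_indicator)
    also have "\<dots> = (\<integral>\<^sup>+ x. ennreal (std_normal_density (- w + x)) * indicator B x \<partial>lborel)"
      by (subst nn_integral_real_affine[of _ 1 "-w"]) auto
    finally show "emeasure (distr std_normal_distribution borel (\<lambda>x. w + x)) B =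
        emeasure (density lborel (\<lambda>x. ennreal (std_normal_density (- w + x)))) B"
      by (simp add: emeasure_density)
  qed simp
  then show ?thesis
    by (simp only: *) (simp add: density_density_eq ennreal_mult')
qed

text \<open>This is the Cameron-Martin formula. Both measures are the product of the shifted
  marginals \<open>M' i\<close>, which is checked on boxes, where the density factorizes and
  \<open>std_normal_shift\<close> applies. The \<open>restrict\<close> keeps shifted vectors inside
  the extensional product space.\<close>

lemma noise_shift_eq:
  "distr (noise n) (vecM n) (\<lambda>e. \<lambda>i\<in>{..<n}. w i + e i) =
   density (noise n) (\<lambda>e. ennreal (exp (ip n w e - ip n w w / 2)))"
proof -
  define M' where "M' i = distr std_normal_distribution borel (\<lambda>x. w i + x)" for i
  have ps: "prob_space std_normal_distribution" by (simp add: prob_space_normal_density)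
  have ps': "prob_space (M' i)" for i
    unfolding M'_def by (rule prob_space.prob_space_distr[OF ps]) simp
  interpret S: product_prob_space "\<lambda>_. std_normal_distribution" "{..<n}"
    by (intro product_prob_spaceI ps)
  interpret P: product_prob_space M' "{..<n}"
    by (intro product_prob_spaceI ps')
  have sets_M': "sets (PiM {..<n} M') = sets (vecM n)"
    unfolding vecM_def by (intro sets_PiM_cong) (auto simp: M'_def)
  have "distr (noise n) (vecM n) (\<lambda>e. \<lambda>i\<in>{..<n}. w i + e i) = PiM {..<n} M'"
  proof (rule P.PiM_eqI)
    fix A assume A: "\<And>i. i \<in> {..<n} \<Longrightarrow> A i \<in> sets (M' i)"
    then have A' [measurable]: "\<And>i. i < n \<Longrightarrow> A i \<in> sets borel" by (auto simp: M'_def)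
    have "(\<lambda>e. \<lambda>i\<in>{..<n}. w i + e i) -` PiE {..<n} A \<inter> space (noise n) =
        PiE {..<n} (\<lambda>i. (\<lambda>x. w i + x) -` A i)"
      by (auto simp: vecM_def space_PiM PiE_iff)
    moreover have "emeasure (noise n) (PiE {..<n} (\<lambda>i. (\<lambda>x. w i + x) -` A i)) =
       (\<Prod>i<n. emeasure std_normal_distribution ((\<lambda>x. w i + x) -` A i))"
      unfolding noise_def using A'
      by (intro S.emeasure_PiM) (auto intro!: measurable_sets_borel[of _ borel])
    moreover have "PiE {..<n} A \<in> sets (vecM n)"
      unfolding vecM_def using A' by (intro sets_PiM_I_finite) auto
    ultimately show "emeasure (distr (noise n) (vecM n) (\<lambda>e. \<lambda>i\<in>{..<n}. w i + e i)) (PiE {..<n} A) =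
        (\<Prod>i<n. emeasure (M' i) (A i))"
      by (simp add: emeasure_distr M'_def)
  qed (auto simp: sets_M')
  moreover have "density (noise n) (\<lambda>e. ennreal (exp (ip n w e - ip n w w / 2))) = PiM {..<n} M'"
  proof (rule P.PiM_eqI)
    fix A assume A: "\<And>i. i \<in> {..<n} \<Longrightarrow> A i \<in> sets (M' i)"
    then have A' [measurable]: "\<And>i. i < n \<Longrightarrow> A i \<in> sets borel" by (auto simp: M'_def)
    have PA [measurable]: "PiE {..<n} A \<in> sets (vecM n)"
      unfolding vecM_def using A' by (intro sets_PiM_I_finite) auto
    have "emeasure (density (noise n) (\<lambda>e. ennreal (exp (ip n w e - ip n w w / 2)))) (PiE {..<n} A) =
        (\<integral>\<^sup>+ e. ennreal (exp (ip n w e - ip n w w / 2)) * indicator (PiE {..<n} A) e \<partial>noise n)"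
      by (subst emeasure_density) simp_all
    also have "\<dots> = (\<integral>\<^sup>+ e. (\<Prod>i<n. ennreal (exp (w i * e i - (w i)\<^sup>2 / 2)) * indicator (A i) (e i)) \<partial>noise n)"
    proof (rule nn_integral_cong)
      fix e assume e: "e \<in> space (noise n)"
      have "ennreal (exp (ip n w e - ip n w w / 2)) = (\<Prod>i<n. ennreal (exp (w i * e i - (w i)\<^sup>2 / 2)))"
        by (simp add: prod_ennreal exp_sum [symmetric] ip_def sum_subtractf sum_divide_distrib power2_eq_square)
      moreover have "indicator (PiE {..<n} A) e = (\<Prod>i<n. indicator (A i) (e i) :: ennreal)"
        using e by (auto simp: indicator_def vecM_def space_PiM PiE_iff prod_zero_iff split: if_splits)
      ultimately show "ennreal (exp (ip n w e - ip n w w / 2)) * indicator (PiE {..<n} A) e =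
        (\<Prod>i<n. ennreal (exp (w i * e i - (w i)\<^sup>2 / 2)) * indicator (A i) (e i))"
        by (simp add: prod.distrib)
    qed
    also have "\<dots> = (\<Prod>i<n. \<integral>\<^sup>+ x. ennreal (exp (w i * x - (w i)\<^sup>2 / 2)) * indicator (A i) x \<partial>std_normal_distribution)"
      unfolding noise_def by (rule S.product_nn_integral_prod) auto
    also have "\<dots> = (\<Prod>i<n. emeasure (M' i) (A i))"
      by (rule prod.cong) (simp_all add: M'_def std_normal_shift emeasure_density)
    finally show "emeasure (density (noise n) (\<lambda>e. ennreal (exp (ip n w e - ip n w w / 2)))) (PiE {..<n} A) =
        (\<Prod>i<n. emeasure (M' i) (A i))" .
  qed (auto simp: sets_M')
  ultimately show ?thesis by simp
qed

lemma nn_integral_noise_shift: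
  assumes [measurable]: "F \<in> borel_measurable (vecM n)"
  shows "(\<integral>\<^sup>+ e. F (\<lambda>i\<in>{..<n}. w i + e i) \<partial>noise n) =
    (\<integral>\<^sup>+ e. ennreal (exp (ip n w e - ip n w w / 2)) * F e \<partial>noise n)"
proof -
  have "(\<integral>\<^sup>+ e. F (\<lambda>i\<in>{..<n}. w i + e i) \<partial>noise n) =
      (\<integral>\<^sup>+ e. F e \<partial>distr (noise n) (vecM n) (\<lambda>e. \<lambda>i\<in>{..<n}. w i + e i))"
    by (subst nn_integral_distr) auto
  also have "\<dots> = (\<integral>\<^sup>+ e. ennreal (exp (ip n w e - ip n w w / 2)) * F e \<partial>noise n)"
    unfolding noise_shift_eq by (subst nn_integral_density) auto
  finally show ?thesis .
qed

text \<open>The shifted law still has mass 1, so the Cameron-Martin density integrates to 1. This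
  yields the moment generating function without computing a Gaussian integral.\<close>

lemma nn_integral_noise_exp:
  "(\<integral>\<^sup>+ e. ennreal (exp (ip n c e)) \<partial>noise n) = ennreal (exp (ip n c c / 2))"
proof -
  interpret prob_space "noise n" by (rule prob_space_noise)
  have "ennreal (exp (ip n c c / 2)) = ennreal (exp (ip n c c / 2)) * (\<integral>\<^sup>+ e. 1 \<partial>noise n)"
    using emeasure_space_1 by simp
  also have "\<dots> = ennreal (exp (ip n c c / 2)) * (\<integral>\<^sup>+ e. ennreal (exp (ip n c e - ip n c c / 2)) * 1 \<partial>noise n)"
    using nn_integral_noise_shift[of "\<lambda>_. 1" n c] by simp
  also have "\<dots> = (\<integral>\<^sup>+ e. ennreal (exp (ip n c c / 2)) * ennreal (exp (ip n c e - ip n c c / 2)) \<partial>noise n)"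
    by (subst nn_integral_cmult) auto
  also have "\<dots> = (\<integral>\<^sup>+ e. ennreal (exp (ip n c e)) \<partial>noise n)"
    by (simp add: ennreal_mult' [symmetric] exp_add [symmetric])
  finally show ?thesis by simp
qed

lemma integrable_noise_exp: "integrable (noise n) (\<lambda>e. exp (ip n c e))"
  by (rule integrableI_nonneg) (auto simp: nn_integral_noise_exp)

lemma integral_noise_exp: "(\<integral>e. exp (ip n c e) \<partial>noise n) = exp (ip n c c / 2)"
  by (simp add: integral_eq_nn_integral nn_integral_noise_exp)

lemma integral_noise_shift:
  fixes F :: "(nat \<Rightarrow> real) \<Rightarrow> real"
  assumes [measurable]: "F \<in> borel_measurable (vecM n)"
  shows "(\<integral>e. F (\<lambda>i\<in>{..<n}. w i + e i) \<partial>noise n) =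
    (\<integral>e. exp (ip n w e - ip n w w / 2) * F e \<partial>noise n)"
proof -
  have "(\<integral>e. F (\<lambda>i\<in>{..<n}. w i + e i) \<partial>noise n) =
      (\<integral>e. F e \<partial>distr (noise n) (vecM n) (\<lambda>e. \<lambda>i\<in>{..<n}. w i + e i))"
    by (subst integral_distr) auto
  also have "\<dots> = (\<integral>e. exp (ip n w e - ip n w w / 2) * F e \<partial>noise n)"
    unfolding noise_shift_eq by (subst integral_density) auto
  finally show ?thesis .
qed

text \<open>Chernoff bound. The parameter \<open>l\<close> stays free: the scan over all columns
  takes \<open>l = t\<close>, while crude tail estimates take \<open>l = 1\<close>.\<close>

lemma noise_tail:
  assumes "0 \<le> l"
  shows "measure (noise n) {e \<in> space (noise n). ip n c e \<ge> t} \<le> exp (l\<^sup>2 * ip n c c / 2 - l * t)"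
proof -
  interpret prob_space "noise n" by (rule prob_space_noise)
  have "measure (noise n) {e \<in> space (noise n). ip n c e \<ge> t} =
      (\<integral>e. indicator {e \<in> space (noise n). ip n c e \<ge> t} e \<partial>noise n)"
    by (simp add: Int_def conj_commute)
  also have "\<dots> \<le> (\<integral>e. exp (ip n (\<lambda>i. l * c i) e) * exp (- l * t) \<partial>noise n)"
  proof (intro integral_mono integrable_mult_left integrable_noise_exp)
    show "integrable (noise n) (indicator {e \<in> space (noise n). ip n c e \<ge> t} :: _ \<Rightarrow> real)"
      by (rule integrable_real_indicator) (auto simp: less_top [symmetric])
  qed (use assms in \<open>auto simp: indicator_def ip_scale_left exp_add [symmetric] mult_left_mono\<close>)
  also have "\<dots> = exp (l\<^sup>2 * ip n c c / 2 - l * t)"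
    unfolding integral_mult_left_zero integral_noise_exp
    by (simp add: ip_scale_left ip_scale_right exp_add [symmetric] power2_eq_square algebra_simps)
  finally show ?thesis .
qed

lemma noise_abs_tail:
  assumes "0 \<le> l"
  shows "measure (noise n) {e \<in> space (noise n). \<bar>ip n c e\<bar> \<ge> t} \<le> 2 * exp (l\<^sup>2 * ip n c c / 2 - l * t)"
proof -
  interpret prob_space "noise n" by (rule prob_space_noise)
  let ?c = "\<lambda>i. -1 * c i"
  have eq: "{e \<in> space (noise n). \<bar>ip n c e\<bar> \<ge> t} =
    {e \<in> space (noise n). ip n c e \<ge> t} \<union> {e \<in> space (noise n). ip n ?c e \<ge> t}"
    unfolding ip_scale_left by auto
  have "measure (noise n) {e \<in> space (noise n). \<bar>ip n c e\<bar> \<ge> t} \<le>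
    measure (noise n) {e \<in> space (noise n). ip n c e \<ge> t} + measure (noise n) {e \<in> space (noise n). ip n ?c e \<ge> t}"
    unfolding eq by (rule measure_Un_le) auto
  also have "\<dots> \<le> exp (l\<^sup>2 * ip n c c / 2 - l * t) + exp (l\<^sup>2 * ip n ?c ?c / 2 - l * t)"
    by (intro add_mono noise_tail assms)
  finally show ?thesis unfolding ip_scale_left ip_scale_right by simp
qed

lemma noise_char:
  "(\<integral>e. iexp (ip n c e) \<partial>noise n) = complex_of_real (exp (- ip n c c / 2))"
proof -
  have ps: "prob_space std_normal_distribution" by (simp add: prob_space_normal_density)
  interpret S: product_prob_space "\<lambda>_. std_normal_distribution" "{..<n}"
    by (intro product_prob_spaceI ps)
  interpret S1: prob_space std_normal_distribution by (rule ps)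
  have "(\<integral>e. iexp (ip n c e) \<partial>noise n) = (\<integral>e. (\<Prod>i<n. iexp (c i * e i)) \<partial>noise n)"
    by (simp add: ip_def sum_distrib_left exp_sum)
  also have "\<dots> = (\<Prod>i<n. \<integral>x. iexp (c i * x) \<partial>std_normal_distribution)"
    unfolding noise_def 
    by (rule S.product_integral_prod)
      (auto intro!: finite_measure.integrable_const_bound[OF prob_space.finite_measure[OF ps], of _ 1])
  also have "\<dots> = (\<Prod>i<n. char std_normal_distribution (c i))"
    by (simp add: char_def)
  also have "\<dots> = complex_of_real (exp (- ip n c c / 2))"
    by (simp add: char_std_normal_distribution of_real_prod [symmetric] exp_sum [symmetric] ip_def
        sum_negf sum_divide_distrib power2_eq_square del: of_real_prod)
  finally show ?thesis .
qed

text \<open>Both laws have the same characteristic function, so Levy uniqueness applies. Its use is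
  to transfer one-dimensional facts, namely anti-concentration and symmetry, to linear forms of the
  noise.\<close>

lemma noise_linear_law:
  "distr (noise n) borel (ip n c) = distr std_normal_distribution borel (\<lambda>x. sqrt (ip n c c) * x)"
proof (rule Levy_uniqueness)
  have ps: "prob_space std_normal_distribution" by (simp add: prob_space_normal_density)
  interpret S1: prob_space std_normal_distribution by (rule ps)
  interpret N: prob_space "noise n" by (rule prob_space_noise)
  show "real_distribution (distr (noise n) borel (ip n c))"
    by (rule N.real_distribution_distr) simp
  show "real_distribution (distr std_normal_distribution borel (\<lambda>x. sqrt (ip n c c) * x))"
    by (rule S1.real_distribution_distr) simp
  show "char (distr (noise n) borel (ip n c)) = char (distr std_normal_distribution borel (\<lambda>x. sqrt (ip n c c) * x))"
  proof
    fix t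
    have "char (distr (noise n) borel (ip n c)) t = (\<integral>e. iexp (ip n (\<lambda>i. t * c i) e) \<partial>noise n)"
      by (simp add: char_def integral_distr ip_scale_left)
    also have "\<dots> = exp (- (t * sqrt (ip n c c))\<^sup>2 / 2)"
      by (simp only: noise_char) (simp add: ip_scale_left ip_scale_right power_mult_distrib ip_nonneg power2_eq_square)
    also have "\<dots> = char std_normal_distribution (t * sqrt (ip n c c))"
      by (simp add: char_std_normal_distribution)
    also have "\<dots> = char (distr std_normal_distribution borel (\<lambda>x. sqrt (ip n c c) * x)) t"
      by (simp add: char_def integral_distr mult.assoc)
    finally show "char (distr (noise n) borel (ip n c)) t =
        char (distr std_normal_distribution borel (\<lambda>x. sqrt (ip n c c) * x)) t" .
  qed
qed

section \<open>Orthant probabilities of nearly orthonormal linear forms\<close>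

text \<open>Exponential sums with arbitrary real frequencies: their Gaussian expectations are
  explicit by \<open>noise_char\<close>. A list may repeat frequencies, so sums and products need no
  collecting of terms.\<close>

definition trig_sum :: "(complex \<times> real) list \<Rightarrow> real \<Rightarrow> complex" where
  "trig_sum l x = (\<Sum>(c, t)\<leftarrow>l. c * iexp (t * x))"

lemma trig_sum_append: "trig_sum (l @ l') x = trig_sum l x + trig_sum l' x"
  by (simp add: trig_sum_def)

lemma trig_sum_mult: "\<exists>l''. \<forall>x. trig_sum l'' x = trig_sum l x * trig_sum l' x"
proof (induction l)
  case Nil
  show ?case by (rule exI[of _ "[]"]) (simp add: trig_sum_def)
next
  case (Cons a l)
  obtain c t where a: "a = (c, t)" by force
  obtain k where k: "\<And>x. trig_sum k x = trig_sum l x * trig_sum l' x" using Cons.IH by blast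
  define h where "h = map (\<lambda>(c', t'). (c * c', t + t')) l'"
  have h: "trig_sum h x = c * iexp (t * x) * trig_sum l' x" for x
    unfolding h_def trig_sum_def
    by (induction l') (auto simp: exp_add [symmetric] algebra_simps)
  have "trig_sum (h @ k) x = trig_sum (a # l) x * trig_sum l' x" for x
    by (simp add: trig_sum_append h k a) (simp add: trig_sum_def algebra_simps)
  then show ?case by blast
qed

text \<open>On the circle a real-linear functional is a combination of cosine and sine, hence of two
  exponentials by Euler's formulas, and exponential sums are closed under sums and products.
  Stone-Weierstrass on the circle thereby delivers trigonometric polynomials.\<close>

lemma real_polynomial_on_circle_trig:
  assumes "real_polynomial_function (g :: complex \<Rightarrow> real)"
  shows "\<exists>l. \<forall>x. complex_of_real (g (cis (w * x))) = trig_sum l x"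
  using assms
proof (induction rule: real_polynomial_function.induct)
  case (linear h)
  have h: "h (cis u) = cos u * h 1 + sin u * h \<i>" for u
  proof -
    have "cis u = cos u *\<^sub>R 1 + sin u *\<^sub>R \<i>"
      by (simp add: complex_eq_iff)
    then show ?thesis
      using linear by (simp add: bounded_linear.linear linear_add linear_scale)
  qed
  have "complex_of_real (h (cis (w * x))) =
      trig_sum [((h 1 - \<i> * h \<i>) / 2, w), ((h 1 + \<i> * h \<i>) / 2, - w)] x" for x
    by (simp add: h trig_sum_def exp_eq_polar complex_eq_iff field_simps
          flip: cis_conv_exp)
  then show ?case by blast
next
  case (const c)
  have "complex_of_real c = trig_sum [(of_real c, 0)] x" for x by (simp add: trig_sum_def)
  then show ?case by blast
next
  case (add f g)
  then obtain l l' where "\<And>x. complex_of_real (f (cis (w * x))) = trig_sum l x"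
    "\<And>x. complex_of_real (g (cis (w * x))) = trig_sum l' x" by blast
  then have "complex_of_real (f (cis (w * x)) + g (cis (w * x))) = trig_sum (l @ l') x" for x
    by (simp add: trig_sum_append)
  then show ?case by blast
next
  case (mult f g)
  then obtain l l' where "\<And>x. complex_of_real (f (cis (w * x))) = trig_sum l x"
    "\<And>x. complex_of_real (g (cis (w * x))) = trig_sum l' x" by blast
  moreover obtain l'' where "\<And>x. trig_sum l'' x = trig_sum l x * trig_sum l' x"
    using trig_sum_mult by blast
  ultimately have "complex_of_real (f (cis (w * x)) * g (cis (w * x))) = trig_sum l'' x" for x
    by simp
  then show ?case by blast
qed

text \<open>On \<open>[-L, L]\<close> the sign of \<open>x\<close> is the sign of \<open>sin (x / L)\<close>, so a truncated
  linear function of the imaginary part on the unit circle is a periodic version of the step.\<close>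

lemma trig_step_approx:
  fixes \<eta> L \<epsilon> :: real
  assumes "0 < \<eta>" "\<eta> \<le> L" "0 < \<epsilon>" "\<epsilon> \<le> 1"
  obtains f :: "real \<Rightarrow> real" and l where
    "\<And>x. complex_of_real (f x) = trig_sum l x" "\<And>x. \<bar>f x\<bar> \<le> 1"
    "\<And>x. 0 \<le> x \<Longrightarrow> x \<le> L \<Longrightarrow> \<bar>f x\<bar> \<le> \<epsilon>"
    "\<And>x. - L \<le> x \<Longrightarrow> x \<le> - \<eta> \<Longrightarrow> \<bar>f x - 1\<bar> \<le> \<epsilon>"
proof -
  have L: "0 < L" using assms by linarith
  \<comment> \<open>For \<open>x\<close> in \<open>[-L, -\<eta>]\<close> the angle
    \<open>x / L\<close> lies in \<open>[-1, 0]\<close>, where sine increases because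
    \<open>1 < pi / 2\<close>; hence the imaginary part is at most \<open>-\<kappa>\<close>
    there.\<close>
  define \<kappa> where "\<kappa> = sin (\<eta> / L)"
  have small: "1 < pi / 2" using pi_gt3 by simp
  have \<kappa>: "0 < \<kappa>" unfolding \<kappa>_def using assms small pi_gt3
    by (intro sin_gt_zero) (auto simp: divide_simps intro: le_less_trans)
  \<comment> \<open>A ramp that vanishes on the upper half circle and is maximal once the imaginary
    part drops to \<open>-\<kappa>\<close>. The height \<open>1 - \<epsilon> / 2\<close> leaves room
    for the approximation error, so that the polynomial stays within \<open>[-1, 1]\<close>.\<close>
  define F where "F z = (1 - \<epsilon> / 2) * max 0 (min 1 (- Im z / \<kappa>))" for z
  have F01: "0 \<le> F z" "F z \<le> 1 - \<epsilon> / 2" for z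
    unfolding F_def using assms by (auto intro!: mult_left_le)
  have "continuous_on (sphere 0 1) F"
    unfolding F_def using \<kappa> by (intro continuous_intros) auto
  then obtain g where g: "real_polynomial_function g"
      and Fg: "\<And>z. z \<in> sphere 0 1 \<Longrightarrow> \<bar>F z - g z\<bar> < \<epsilon> / 2"
    using Stone_Weierstrass_real_polynomial_function[of "sphere 0 1" F "\<epsilon> / 2"] assms by auto
  define f where "f x = g (cis (1 / L * x))" for x
  have close: "\<bar>F (cis (x / L)) - f x\<bar> < \<epsilon> / 2" for x
    unfolding f_def using Fg[of "cis (x / L)"] by simp
  obtain l where l: "\<And>x. complex_of_real (f x) = trig_sum l x"
    using real_polynomial_on_circle_trig[OF g, of "1 / L"] unfolding f_def by blast
  show thesis
  proof (rule that[of f l])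
    show "\<bar>f x\<bar> \<le> 1" for x
      using close[of x] F01[of "cis (x / L)"] assms by linarith
    show "\<bar>f x\<bar> \<le> \<epsilon>" if "0 \<le> x" "x \<le> L" for x
    proof -
      have "0 \<le> sin (x / L)"
        using that L pi_gt3 by (intro sin_ge_zero) (auto simp: divide_simps intro: order_trans)
      then have "F (cis (x / L)) = 0" unfolding F_def using \<kappa> by (simp add: max_def min_def divide_simps)
      then show ?thesis using close[of x] assms by linarith
    qed
    show "\<bar>f x - 1\<bar> \<le> \<epsilon>" if "- L \<le> x" "x \<le> - \<eta>" for x
    proof -
      have 1: "x / L \<le> - (\<eta> / L)" using that L by (simp add: divide_simps)
      have "-1 \<le> x / L" using that L by (simp add: divide_simps)
      then have 2: "- (pi / 2) \<le> x / L" using small by linarith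
      have "\<eta> / L \<le> 1" using assms L by simp
      then have 3: "0 < \<eta> / L" "\<eta> / L \<le> pi / 2" using assms L small by (simp, linarith)
      have "sin (x / L) \<le> sin (- (\<eta> / L))"
        using 1 2 3 by (subst sin_mono_le_eq) linarith+
      then have "1 * \<kappa> \<le> - Im (cis (x / L))" by (simp add: \<kappa>_def)
      then have "1 \<le> - Im (cis (x / L)) / \<kappa>"
        using \<kappa> by (simp only: pos_le_divide_eq)
      then have "F (cis (x / L)) = 1 - \<epsilon> / 2" unfolding F_def by simp
      then show ?thesis using close[of x] assms by linarith
    qed
  qed (rule l)
qed

section \<open>Anti-concentration and symmetry of a single linear form\<close>

lemma std_normal_interval_le:
  assumes "0 \<le> r" shows "measure std_normal_distribution {-r..r} \<le> 2 * r"
proof -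
  have le1: "std_normal_density x \<le> 1" for x
  proof -
    have "1 \<le> sqrt (2 * pi)" using pi_gt3 by simp
    moreover have "exp (- x\<^sup>2 / 2) \<le> 1" by simp
    ultimately have "exp (- x\<^sup>2 / 2) \<le> sqrt (2 * pi)" by linarith
    then show ?thesis by (simp add: std_normal_density_def divide_le_eq)
  qed
  have "emeasure std_normal_distribution {-r..r} =
      (\<integral>\<^sup>+ x. ennreal (std_normal_density x) * indicator {-r..r} x \<partial>lborel)"
    by (simp add: emeasure_density)
  also have "\<dots> \<le> (\<integral>\<^sup>+ x. indicator {-r..r} x \<partial>lborel)"
    by (rule nn_integral_mono) (auto simp: indicator_def le1)
  also have "\<dots> = ennreal (2 * r)" using assms by simp
  finally show ?thesis using assms
    by (simp add: measure_def enn2real_leI)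
qed

text \<open>A variance of at least \<open>1 / 4\<close> means a standard deviation of at least
  \<open>1 / 2\<close>, so the interval at most doubles after standardization, and the normal
  density is bounded by 1.\<close>

lemma noise_interval_le:
  assumes "1 / 4 \<le> ip n c c" "0 \<le> r"
  shows "measure (noise n) {e \<in> space (noise n). \<bar>ip n c e\<bar> \<le> r} \<le> 4 * r"
proof -
  define s where "s = sqrt (ip n c c)"
  have s: "1 / 2 \<le> s"
    unfolding s_def using assms by (intro real_le_rsqrt) (simp add: power2_eq_square)
  interpret prob_space std_normal_distribution by (simp add: prob_space_normal_density)
  have "{e \<in> space (noise n). \<bar>ip n c e\<bar> \<le> r} = ip n c -` {-r..r} \<inter> space (noise n)" by auto
  then have "measure (noise n) {e \<in> space (noise n). \<bar>ip n c e\<bar> \<le> r} =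
      measure (distr (noise n) borel (ip n c)) {-r..r}"
    by (simp add: measure_distr)
  also have "\<dots> = measure std_normal_distribution ((\<lambda>x. s * x) -` {-r..r})"
    unfolding noise_linear_law s_def by (simp add: measure_distr)
  also have "\<dots> \<le> measure std_normal_distribution {- (2 * r)..2 * r}"
  proof (rule finite_measure_mono)
    show "(\<lambda>x. s * x) -` {-r..r} \<subseteq> {- (2 * r)..2 * r}"
    proof
      fix x assume "x \<in> (\<lambda>x. s * x) -` {-r..r}"
      then have "\<bar>s * x\<bar> \<le> r" by auto
      moreover have "1 / 2 * \<bar>x\<bar> \<le> s * \<bar>x\<bar>" using s by (intro mult_right_mono) auto
      ultimately show "x \<in> {- (2 * r)..2 * r}" using s by (auto simp: abs_mult)
    qed
  qed simp
  also have "\<dots> \<le> 4 * r" using std_normal_interval_le[of "2 * r"] assms by simp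
  finally show ?thesis .
qed

text \<open>Outside the window of radius \<open>\<eta>\<close> and the tail beyond \<open>L\<close>,
  the function \<open>f\<close> follows the step up to \<open>\<epsilon>\<close>; the shifted
  threshold \<open>\<tau>\<close> is hidden in the window. On both exceptional sets the difference
  is at most 2. Their probabilities are bounded by anti-concentration and by Chernoff with
  \<open>l = 1\<close>, where variance at most 4 gives the exponent \<open>2 - L\<close>.\<close>

lemma noise_step_approx:
  assumes f [measurable]: "f \<in> borel_measurable borel"
    and f1: "\<And>x. \<bar>f x\<bar> \<le> 1"
    and f0: "\<And>x. 0 \<le> x \<Longrightarrow> x \<le> L \<Longrightarrow> \<bar>f x\<bar> \<le> \<epsilon>"
    and fm: "\<And>x. - L \<le> x \<Longrightarrow> x \<le> - \<eta> \<Longrightarrow> \<bar>f x - 1\<bar> \<le> \<epsilon>"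
    and pos: "0 < \<eta>" "0 < \<epsilon>" and c: "1 / 4 \<le> ip n c c" "ip n c c \<le> 4" and \<tau>: "\<bar>\<tau>\<bar> \<le> \<eta>"
  shows "(\<integral>e. \<bar>of_bool (ip n c e \<le> \<tau>) - f (ip n c e)\<bar> \<partial>noise n) \<le> \<epsilon> + 8 * \<eta> + 4 * exp (2 - L)"
proof -
  interpret prob_space "noise n" by (rule prob_space_noise)
  let ?A = "{e \<in> space (noise n). \<bar>ip n c e\<bar> \<le> \<eta>}" and ?B = "{e \<in> space (noise n). \<bar>ip n c e\<bar> \<ge> L}"
  have [measurable]: "?A \<in> sets (noise n)" "?B \<in> sets (noise n)" by measurable
  have "(\<integral>e. \<bar>of_bool (ip n c e \<le> \<tau>) - f (ip n c e)\<bar> \<partial>noise n) \<le>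
      (\<integral>e. \<epsilon> + 2 * indicator ?A e + 2 * indicator ?B e \<partial>noise n)"
  proof (rule integral_mono)
    show "integrable (noise n) (\<lambda>e. \<bar>of_bool (ip n c e \<le> \<tau>) - f (ip n c e)\<bar>)"
    proof (rule integrable_const_bound[of _ 2])
      show "AE e in noise n. norm \<bar>of_bool (ip n c e \<le> \<tau>) - f (ip n c e)\<bar> \<le> 2"
        by (rule AE_I2) (use f1 in \<open>simp add: of_bool_def abs_le_iff, smt (verit)\<close>)
    qed measurable
    show "integrable (noise n) (\<lambda>e. \<epsilon> + 2 * indicator ?A e + 2 * indicator ?B e)"
      by (auto intro!: integrable_real_indicator simp: less_top [symmetric])
    fix e assume e: "e \<in> space (noise n)"
    show "\<bar>of_bool (ip n c e \<le> \<tau>) - f (ip n c e)\<bar> \<le> \<epsilon> + 2 * indicator ?A e + 2 * indicator ?B e"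
    proof (cases "\<bar>ip n c e\<bar> \<le> \<eta> \<or> \<bar>ip n c e\<bar> \<ge> L")
      case True
      then have "2 \<le> 2 * indicator ?A e + 2 * (indicator ?B e :: real)"
        using e by (auto simp: indicator_def)
      moreover have "\<bar>of_bool (ip n c e \<le> \<tau>) - f (ip n c e)\<bar> \<le> 2"
        using f1[of "ip n c e"] by (auto simp: of_bool_def)
      ultimately show ?thesis using pos by linarith
    next
      case False
      have "\<bar>of_bool (ip n c e \<le> \<tau>) - f (ip n c e)\<bar> \<le> \<epsilon>"
      proof (cases "0 \<le> ip n c e")
        case True
        then have "\<not> ip n c e \<le> \<tau>" using False \<tau> by linarith
        then show ?thesis using f0[of "ip n c e"] True False by simp
      next
        case neg: False
        then have "ip n c e \<le> \<tau>" using False \<tau> by linarith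
        then show ?thesis using fm[of "ip n c e"] neg False by (simp add: abs_minus_commute)
      qed
      then show ?thesis by (auto simp: indicator_def)
    qed
  qed
  also have "\<dots> = \<epsilon> + 2 * measure (noise n) ?A + 2 * measure (noise n) ?B"
  proof -
    have "integrable (noise n) (indicator ?A :: _ \<Rightarrow> real)" "integrable (noise n) (indicator ?B :: _ \<Rightarrow> real)"
      by (auto intro!: integrable_real_indicator simp: less_top [symmetric])
    then show ?thesis by (simp add: prob_space Int_absorb2 del: space_noise)
  qed
  also have "\<dots> \<le> \<epsilon> + 2 * (4 * \<eta>) + 2 * (2 * exp (2 - L))"
  proof -
    have "measure (noise n) ?B \<le> 2 * exp (1\<^sup>2 * ip n c c / 2 - 1 * L)"
      by (rule noise_abs_tail) simp
    also have "\<dots> \<le> 2 * exp (2 - L)" using c by simp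
    finally show ?thesis using noise_interval_le[OF c(1), of \<eta>] pos by simp
  qed
  finally show ?thesis by simp
qed

text \<open>The law of a linear form depends only on its variance, so \<open>c\<close> and
  \<open>-c\<close> give the same law and the two closed half-lines have equal mass. They overlap in
  the point 0, which is null by anti-concentration.\<close>

lemma noise_half:
  assumes "ip n c c = 1"
  shows "measure (noise n) {e \<in> space (noise n). ip n c e \<le> 0} = 1 / 2"
proof -
  interpret prob_space "noise n" by (rule prob_space_noise)
  define c' where "c' = (\<lambda>i. - 1 * c i)"
  have c': "ip n c' e = - ip n c e" for e unfolding c'_def ip_scale_left by simp
  have c'c': "ip n c' c' = ip n c c" unfolding c'_def ip_scale_left ip_scale_right by simp
  have law: "measure (noise n) {e \<in> space (noise n). ip n d e \<le> 0} =
      measure (distr (noise n) borel (ip n d)) {..0}" for d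
    by (simp add: measure_distr vimage_def Int_def conj_commute)
  have "measure (noise n) {e \<in> space (noise n). ip n c e \<ge> 0} = measure (noise n) {e \<in> space (noise n). ip n c' e \<le> 0}"
    by (simp add: c')
  also have "\<dots> = measure (noise n) {e \<in> space (noise n). ip n c e \<le> 0}"
    unfolding law noise_linear_law c'c' ..
  finally have sym: "measure (noise n) {e \<in> space (noise n). ip n c e \<ge> 0} =
    measure (noise n) {e \<in> space (noise n). ip n c e \<le> 0}" .
  have "measure (noise n) {e \<in> space (noise n). ip n c e = 0} \<le> 0 + r" if "0 < r" for r
  proof -
    have "measure (noise n) {e \<in> space (noise n). ip n c e = 0} \<le>
        measure (noise n) {e \<in> space (noise n). \<bar>ip n c e\<bar> \<le> r / 4}"
      using that by (intro finite_measure_mono) auto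
    also have "\<dots> \<le> 4 * (r / 4)" using assms that by (intro noise_interval_le) auto
    finally show ?thesis by simp
  qed
  then have zero: "measure (noise n) {e \<in> space (noise n). ip n c e = 0} = 0"
    using field_le_epsilon[of "measure (noise n) {e \<in> space (noise n). ip n c e = 0}" 0]
    by (simp add: antisym)
  have U: "{e \<in> space (noise n). ip n c e \<ge> 0} \<union> {e \<in> space (noise n). ip n c e \<le> 0} = space (noise n)"
    by auto
  have I: "{e \<in> space (noise n). ip n c e \<ge> 0} \<inter> {e \<in> space (noise n). ip n c e \<le> 0} =
      {e \<in> space (noise n). ip n c e = 0}" by auto
  have "measure (noise n) {e \<in> space (noise n). ip n c e \<ge> 0} + measure (noise n) {e \<in> space (noise n). ip n c e \<le> 0} = 1"
    using measure_Un3[of "{e \<in> space (noise n). ip n c e \<ge> 0}" "noise n" "{e \<in> space (noise n). ip n c e \<le> 0}"]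
    unfolding U I zero prob_space by (simp add: fmeasurable_eq_sets)
  then show ?thesis using sym by simp
qed

section \<open>Expectations of trigonometric sums and the orthant limit\<close>

lemma trig_sum_nth: "trig_sum l x = (\<Sum>k<length l. fst (l ! k) * iexp (snd (l ! k) * x))"
  by (simp add: trig_sum_def sum_list_sum_nth case_prod_beta lessThan_atLeast0)

lemma integrable_noise_iexp: "integrable (noise n) (\<lambda>e. iexp (ip n c e))"
proof -
  interpret prob_space "noise n" by (rule prob_space_noise)
  show ?thesis by (rule integrable_const_bound[of _ 1]) auto
qed

text \<open>Expanding the product, \<open>g\<close> picks one exponential from each factor; the
  picked ones combine to the exponential of the linear form \<open>d g\<close>, whose variance is
  quadratic in the frequencies. So the expectation is a finite sum that depends on the vectors only
  through their Gram matrix, and continuously.\<close>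

lemma noise_prod_trig:
  fixes c :: "nat \<Rightarrow> nat \<Rightarrow> real"
  shows
  "(\<integral>e. (\<Prod>i<m. trig_sum l (ip n (c i) e)) \<partial>noise n) =
    (\<Sum>g\<in>PiE {..<m} (\<lambda>_. {..<length l}). (\<Prod>i<m. fst (l ! g i)) *
      complex_of_real (exp (- (\<Sum>i<m. \<Sum>j<m. snd (l ! g i) * snd (l ! g j) * ip n (c i) (c j)) / 2)))"
proof -
  interpret prob_space "noise n" by (rule prob_space_noise)
  let ?P = "PiE {..<m} (\<lambda>_. {..<length l})"
  define d where "d g i = (\<Sum>k<m. snd (l ! g k) * c k i)" for g :: "nat \<Rightarrow> nat" and i
  have d: "ip n (d g) e = (\<Sum>k<m. snd (l ! g k) * ip n (c k) e)" for g e
    unfolding d_def [abs_def] ip_sum_left ip_scale_left ..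
  have d': "ip n e (d g) = (\<Sum>k<m. snd (l ! g k) * ip n e (c k))" for g e
    unfolding d_def [abs_def] ip_sum_right ip_scale_right ..
  have "(\<integral>e. (\<Prod>i<m. trig_sum l (ip n (c i) e)) \<partial>noise n) =
      (\<integral>e. (\<Sum>g\<in>?P. (\<Prod>i<m. fst (l ! g i)) * iexp (ip n (d g) e)) \<partial>noise n)"
    unfolding trig_sum_nth
    by (subst prod_sum_PiE)
      (simp_all add: prod.distrib exp_sum [symmetric] d sum_distrib_left mult.assoc)
  also have "\<dots> = (\<Sum>g\<in>?P. (\<Prod>i<m. fst (l ! g i)) * (\<integral>e. iexp (ip n (d g) e) \<partial>noise n))"
    by (subst Bochner_Integration.integral_sum)
      (simp_all only: integral_mult_right_zero integrable_mult_right integrable_noise_iexp)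
  also have "\<dots> = (\<Sum>g\<in>?P. (\<Prod>i<m. fst (l ! g i)) *
      complex_of_real (exp (- (\<Sum>i<m. \<Sum>j<m. snd (l ! g i) * snd (l ! g j) * ip n (c i) (c j)) / 2)))"
  proof (rule sum.cong [OF refl])
    fix g
    have "ip n (d g) (d g) = (\<Sum>i<m. \<Sum>j<m. snd (l ! g i) * snd (l ! g j) * ip n (c i) (c j))"
      unfolding d d' by (simp add: sum_distrib_left mult.assoc ip_commute)
    then show "(\<Prod>i<m. fst (l ! g i)) * (\<integral>e. iexp (ip n (d g) e) \<partial>noise n) = (\<Prod>i<m. fst (l ! g i)) *
      complex_of_real (exp (- (\<Sum>i<m. \<Sum>j<m. snd (l ! g i) * snd (l ! g j) * ip n (c i) (c j)) / 2))"
      unfolding noise_char by simp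
  qed
  finally show ?thesis .
qed

lemma noise_trig_1:
  assumes "ip n c c = 1"
  shows "(\<integral>e. trig_sum l (ip n c e) \<partial>noise n) =
    (\<Sum>k<length l. fst (l ! k) * complex_of_real (exp (- (snd (l ! k))\<^sup>2 / 2)))"
proof -
  interpret prob_space "noise n" by (rule prob_space_noise)
  have "(\<integral>e. trig_sum l (ip n c e) \<partial>noise n) =
     (\<Sum>k<length l. fst (l ! k) * (\<integral>e. iexp (ip n (\<lambda>i. snd (l ! k) * c i) e) \<partial>noise n))"
    unfolding trig_sum_nth ip_scale_left [symmetric]
    by (subst Bochner_Integration.integral_sum)
      (simp_all only: integral_mult_right_zero integrable_mult_right integrable_noise_iexp)
  then show ?thesis
    unfolding noise_char by (simp add: ip_scale_left ip_scale_right assms power2_eq_square)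
qed

text \<open>Every indicator is replaced by the same trigonometric polynomial \<open>f\<close>. A
  product of factors bounded by 1 changes by at most the sum of the changes of its factors, so the
  error is at most \<open>m * \<kappa>\<close>. The smooth expectation \<open>E r\<close> converges
  by the explicit formula, and its limit is the \<open>m\<close>-th power of a one-dimensional
  expectation close to \<open>1 / 2\<close>.\<close>

lemma noise_orthant_tendsto:
  fixes n :: "nat \<Rightarrow> nat" and c :: "nat \<Rightarrow> nat \<Rightarrow> nat \<Rightarrow> real" and \<tau> :: "nat \<Rightarrow> nat \<Rightarrow> real"
  assumes gram: "\<And>i j. i < m \<Longrightarrow> j < m \<Longrightarrow> (\<lambda>r. ip (n r) (c r i) (c r j)) \<longlonglongrightarrow> (if i = j then 1 else 0)"
    and \<tau>: "\<And>i. i < m \<Longrightarrow> (\<lambda>r. \<tau> r i) \<longlonglongrightarrow> 0"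
  shows "(\<lambda>r. measure (noise (n r)) {e \<in> space (noise (n r)). \<forall>i<m. ip (n r) (c r i) e \<le> \<tau> r i}) \<longlonglongrightarrow> (1 / 2) ^ m"
proof (rule LIMSEQ_I)
  fix \<delta> :: real assume \<delta>: "0 < \<delta>"
  \<comment> \<open>The final estimate has three parts, two of which are bounded by
    \<open>m * \<kappa>\<close>; each part is to stay below \<open>\<delta> / 3\<close>.\<close>
  define \<kappa> where "\<kappa> = min 1 (\<delta> / (3 * real (Suc m)))"
  have \<kappa>: "0 < \<kappa>" "\<kappa> \<le> 1" "real m * \<kappa> < \<delta> / 3"
  proof -
    show "0 < \<kappa>" "\<kappa> \<le> 1" using \<delta> by (auto simp: \<kappa>_def)
    have "real m * \<kappa> \<le> real m * (\<delta> / (3 * real (Suc m)))" by (rule mult_left_mono) (auto simp: \<kappa>_def)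
    also have "\<dots> < \<delta> / 3" using \<delta> by (simp add: field_simps)
    finally show "real m * \<kappa> < \<delta> / 3" .
  qed
  define L where "L = 2 - ln (\<kappa> / 16) + 1"
  have "ln (\<kappa> / 16) < 0" using \<kappa> by simp
  then have L: "1 \<le> L" unfolding L_def by linarith
  have expL: "4 * exp (2 - L) \<le> \<kappa> / 4"
  proof -
    have "exp (2 - L) \<le> exp (ln (\<kappa> / 16))" unfolding L_def by simp
    also have "\<dots> = \<kappa> / 16" using \<kappa> by simp
    finally show ?thesis by simp
  qed
  \<comment> \<open>Error budget for \<open>noise_step_approx\<close>: accuracy
    \<open>\<kappa> / 4\<close>, window \<open>8 * (\<kappa> / 16) = \<kappa> / 2\<close>, and tail
    at most \<open>\<kappa> / 4\<close> by the choice of \<open>L\<close>; the total is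
    \<open>\<kappa>\<close>.\<close>
  obtain f l where fl: "\<And>x. complex_of_real (f x) = trig_sum l x" and f1: "\<And>x. \<bar>f x\<bar> \<le> 1"
    and f0: "\<And>x. 0 \<le> x \<Longrightarrow> x \<le> L \<Longrightarrow> \<bar>f x\<bar> \<le> \<kappa> / 4"
    and fm: "\<And>x. - L \<le> x \<Longrightarrow> x \<le> - (\<kappa> / 16) \<Longrightarrow> \<bar>f x - 1\<bar> \<le> \<kappa> / 4"
    using trig_step_approx[of "\<kappa> / 16" L "\<kappa> / 4"] \<kappa> L by auto
  have fmeas [measurable]: "f \<in> borel_measurable borel"
  proof -
    have "f = (\<lambda>x. Re (trig_sum l x))" by (simp add: fl [symmetric])
    then show ?thesis unfolding trig_sum_nth by simp
  qed
  have step: "(\<integral>e. \<bar>of_bool (ip k d e \<le> t) - f (ip k d e)\<bar> \<partial>noise k) \<le> \<kappa>"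
    if "1 / 4 \<le> ip k d d" "ip k d d \<le> 4" "\<bar>t\<bar> \<le> \<kappa> / 16" for k d t
    using noise_step_approx[of f L "\<kappa> / 4" "\<kappa> / 16" k d t] f1 f0 fm \<kappa> that expL by simp
  define \<theta> where "\<theta> = (\<integral>e. f (ip 1 (\<lambda>_. 1) e) \<partial>noise 1)"
  have one: "ip 1 (\<lambda>_. 1) (\<lambda>_. 1) = 1" by (simp add: ip_def)
  have \<theta>_half: "\<bar>\<theta> - 1 / 2\<bar> \<le> \<kappa>"
  proof -
    interpret prob_space "noise 1" by (rule prob_space_noise)
    have i1: "integrable (noise 1) (\<lambda>e. f (ip 1 (\<lambda>_. 1) e))"
      by (rule integrable_const_bound[of _ 1]) (auto simp: f1)
    have i2: "integrable (noise 1) (\<lambda>e. of_bool (ip 1 (\<lambda>_. 1) e \<le> 0) :: real)"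
      by (rule integrable_const_bound[of _ 1]) auto
    have "1 / 2 = measure (noise 1) {e \<in> space (noise 1). ip 1 (\<lambda>_. 1) e \<le> 0}"
      using noise_half[OF one] by simp
    also have "\<dots> = (\<integral>e. indicator {e \<in> space (noise 1). ip 1 (\<lambda>_. 1) e \<le> 0} e \<partial>noise 1)"
      by (simp add: Int_absorb2)
    also have "\<dots> = (\<integral>e. of_bool (ip 1 (\<lambda>_. 1) e \<le> 0) \<partial>noise 1)"
      by (intro Bochner_Integration.integral_cong) (auto simp: indicator_def)
    finally have "1 / 2 - \<theta> = (\<integral>e. of_bool (ip 1 (\<lambda>_. 1) e \<le> 0) - f (ip 1 (\<lambda>_. 1) e) \<partial>noise 1)"
      unfolding \<theta>_def using i1 i2 by simp
    then have "\<bar>1 / 2 - \<theta>\<bar> \<le> (\<integral>e. \<bar>of_bool (ip 1 (\<lambda>_. 1) e \<le> 0) - f (ip 1 (\<lambda>_. 1) e)\<bar> \<partial>noise 1)"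
      by (simp add: integral_abs_bound)
    also have "\<dots> \<le> \<kappa>" using step[of 1 "\<lambda>_. 1" 0] \<kappa> by (simp add: one del: One_nat_def)
    finally show ?thesis by linarith
  qed
  have \<theta>_le: "\<bar>\<theta>\<bar> \<le> 1"
  proof -
    interpret prob_space "noise 1" by (rule prob_space_noise)
    have "\<bar>\<theta>\<bar> \<le> (\<integral>e. \<bar>f (ip 1 (\<lambda>_. 1) e)\<bar> \<partial>noise 1)"
      unfolding \<theta>_def by (rule integral_abs_bound)
    also have "\<dots> \<le> 1"
    proof (rule integral_le_const)
      show "integrable (noise 1) (\<lambda>e. \<bar>f (ip 1 (\<lambda>_. 1) e)\<bar>)"
        by (rule integrable_const_bound[of _ 1]) (auto simp: f1)
    qed (auto simp: f1)
    finally show ?thesis .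
  qed
  have \<theta>_trig: "complex_of_real \<theta> = (\<Sum>k<length l. fst (l ! k) * complex_of_real (exp (- (snd (l ! k))\<^sup>2 / 2)))"
    unfolding \<theta>_def noise_trig_1 [OF one, symmetric] fl [symmetric] by simp
  define E where "E r = (\<integral>e. (\<Prod>i<m. f (ip (n r) (c r i) e)) \<partial>noise (n r))" for r
  have "(\<lambda>r. complex_of_real (E r)) \<longlonglongrightarrow> complex_of_real (\<theta> ^ m)"
  proof -
    let ?P = "PiE {..<m} (\<lambda>_. {..<length l})"
    have "complex_of_real (E r) = (\<Sum>g\<in>?P. (\<Prod>i<m. fst (l ! g i)) *
      complex_of_real (exp (- (\<Sum>i<m. \<Sum>j<m. snd (l ! g i) * snd (l ! g j) * ip (n r) (c r i) (c r j)) / 2)))" for r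
      unfolding E_def noise_prod_trig [symmetric] fl [symmetric] of_real_prod [symmetric]
      by (simp del: of_real_prod)
    moreover have "(\<lambda>r. \<Sum>g\<in>?P. (\<Prod>i<m. fst (l ! g i)) *
      complex_of_real (exp (- (\<Sum>i<m. \<Sum>j<m. snd (l ! g i) * snd (l ! g j) * ip (n r) (c r i) (c r j)) / 2))) \<longlonglongrightarrow>
      (\<Sum>g\<in>?P. (\<Prod>i<m. fst (l ! g i)) *
      complex_of_real (exp (- (\<Sum>i<m. \<Sum>j<m. snd (l ! g i) * snd (l ! g j) * (if i = j then 1 else 0)) / 2)))"
      by (intro tendsto_intros gram) auto
    \<comment> \<open>For the identity Gram matrix the exponent is a sum over single indices, so the
      sum over choice functions factors back into \<open>m\<close> copies of
      \<open>\<theta>\<close>.\<close>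
    moreover have "(\<Sum>g\<in>?P. (\<Prod>i<m. fst (l ! g i)) *
      complex_of_real (exp (- (\<Sum>i<m. \<Sum>j<m. snd (l ! g i) * snd (l ! g j) * (if i = j then 1 else 0)) / 2))) =
      (\<Prod>i<m. complex_of_real \<theta>)"
      unfolding \<theta>_trig
      by (subst prod_sum_PiE)
        (auto simp: prod.distrib of_real_prod [symmetric] exp_sum [symmetric] sum_negf sum_divide_distrib
          if_distrib power2_eq_square cong: if_cong simp del: of_real_prod intro!: sum.cong)
    ultimately show ?thesis by simp
  qed
  then have "E \<longlonglongrightarrow> \<theta> ^ m" by (simp only: tendsto_of_real_iff)
  then have ev1: "\<forall>\<^sub>F r in sequentially. \<bar>E r - \<theta> ^ m\<bar> < \<delta> / 3"
    using \<delta> tendstoD[of E "\<theta> ^ m" sequentially "\<delta> / 3"] by (simp add: dist_real_def)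
  have ev2: "\<forall>\<^sub>F r in sequentially. \<forall>i\<in>{..<m}. 1 / 4 \<le> ip (n r) (c r i) (c r i) \<and> ip (n r) (c r i) (c r i) \<le> 4 \<and> \<bar>\<tau> r i\<bar> \<le> \<kappa> / 16"
  proof (rule eventually_ball_finite)
    show "\<forall>i\<in>{..<m}. \<forall>\<^sub>F r in sequentially. 1 / 4 \<le> ip (n r) (c r i) (c r i) \<and> ip (n r) (c r i) (c r i) \<le> 4 \<and> \<bar>\<tau> r i\<bar> \<le> \<kappa> / 16"
    proof
      fix i assume i: "i \<in> {..<m}"
      have "\<forall>\<^sub>F r in sequentially. \<bar>ip (n r) (c r i) (c r i) - 1\<bar> < 1 / 2"
        using tendstoD[OF gram[of i i], of "1 / 2"] i by (simp add: dist_real_def)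
      moreover have "\<forall>\<^sub>F r in sequentially. \<bar>\<tau> r i\<bar> < \<kappa> / 16"
        using tendstoD[OF \<tau>[of i], of "\<kappa> / 16"] i \<kappa> by (simp add: dist_real_def)
      ultimately show "\<forall>\<^sub>F r in sequentially. 1 / 4 \<le> ip (n r) (c r i) (c r i) \<and> ip (n r) (c r i) (c r i) \<le> 4 \<and> \<bar>\<tau> r i\<bar> \<le> \<kappa> / 16"
        by eventually_elim linarith
    qed
  qed simp
  have "\<forall>\<^sub>F r in sequentially. norm (measure (noise (n r)) {e \<in> space (noise (n r)). \<forall>i<m. ip (n r) (c r i) e \<le> \<tau> r i} - (1 / 2) ^ m) < \<delta>"
    using ev1 ev2
  proof eventually_elim
    case (elim r)
    interpret prob_space "noise (n r)" by (rule prob_space_noise)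
    let ?z = "\<lambda>i e. ip (n r) (c r i) e"
    let ?S = "{e \<in> space (noise (n r)). \<forall>i<m. ?z i e \<le> \<tau> r i}"
    have i1: "integrable (noise (n r)) (\<lambda>e. \<Prod>i<m. f (?z i e))"
      by (rule integrable_const_bound[of _ 1]) (auto simp: abs_prod intro!: prod_le_1 f1)
    have i2: "integrable (noise (n r)) (\<lambda>e. \<Prod>i<m. of_bool (?z i e \<le> \<tau> r i) :: real)"
      by (rule integrable_const_bound[of _ 1]) (auto simp: abs_prod intro!: prod_le_1)
    have i3: "integrable (noise (n r)) (\<lambda>e. \<bar>of_bool (?z i e \<le> \<tau> r i) - f (?z i e)\<bar>)" for i
    proof (rule integrable_const_bound[of _ 2])
      show "AE e in noise (n r). norm \<bar>of_bool (?z i e \<le> \<tau> r i) - f (?z i e)\<bar> \<le> 2"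
        by (rule AE_I2) (use f1 in \<open>simp add: of_bool_def abs_le_iff, smt (verit)\<close>)
    qed measurable
    have [measurable]: "?S \<in> sets (noise (n r))" by measurable
    have "measure (noise (n r)) ?S = (\<integral>e. indicator ?S e \<partial>noise (n r))"
      by (simp add: Int_absorb2)
    also have "\<dots> = (\<integral>e. (\<Prod>i<m. of_bool (?z i e \<le> \<tau> r i)) \<partial>noise (n r))"
      by (intro Bochner_Integration.integral_cong) (auto simp: indicator_def of_bool_def prod_zero_iff)
    finally have "\<bar>measure (noise (n r)) ?S - E r\<bar> = \<bar>\<integral>e. (\<Prod>i<m. of_bool (?z i e \<le> \<tau> r i)) - (\<Prod>i<m. f (?z i e)) \<partial>noise (n r)\<bar>"
      unfolding E_def using i1 i2 by simp
    also have "\<dots> \<le> (\<integral>e. \<bar>(\<Prod>i<m. of_bool (?z i e \<le> \<tau> r i)) - (\<Prod>i<m. f (?z i e))\<bar> \<partial>noise (n r))"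
      by (rule integral_abs_bound)
    also have "\<dots> \<le> (\<integral>e. (\<Sum>i<m. \<bar>of_bool (?z i e \<le> \<tau> r i) - f (?z i e)\<bar>) \<partial>noise (n r))"
    proof (rule integral_mono)
      show "integrable (noise (n r)) (\<lambda>e. \<bar>(\<Prod>i<m. of_bool (?z i e \<le> \<tau> r i)) - (\<Prod>i<m. f (?z i e))\<bar>)"
        using i1 i2 by (intro integrable_abs Bochner_Integration.integrable_diff)
      show "integrable (noise (n r)) (\<lambda>e. \<Sum>i<m. \<bar>of_bool (?z i e \<le> \<tau> r i) - f (?z i e)\<bar>)"
        using i3 by (intro Bochner_Integration.integrable_sum)
      show "\<bar>(\<Prod>i<m. of_bool (?z i e \<le> \<tau> r i)) - (\<Prod>i<m. f (?z i e))\<bar> \<le> (\<Sum>i<m. \<bar>of_bool (?z i e \<le> \<tau> r i) - f (?z i e)\<bar>)" for e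
        using norm_prod_diff[of "{..<m}" "\<lambda>i. of_bool (?z i e \<le> \<tau> r i) :: real" "\<lambda>i. f (?z i e)"] f1 by simp
    qed
    also have "\<dots> = (\<Sum>i<m. \<integral>e. \<bar>of_bool (?z i e \<le> \<tau> r i) - f (?z i e)\<bar> \<partial>noise (n r))"
      using i3 by (intro Bochner_Integration.integral_sum)
    also have "\<dots> \<le> (\<Sum>i<m. \<kappa>)" using elim(2) by (intro sum_mono step) auto
    finally have a: "\<bar>measure (noise (n r)) ?S - E r\<bar> \<le> real m * \<kappa>" by simp
    have "\<bar>\<theta> ^ m - (1 / 2) ^ m\<bar> \<le> (\<Sum>i<m. \<bar>\<theta> - 1 / 2\<bar>)"
      using norm_prod_diff[of "{..<m}" "\<lambda>i. \<theta>" "\<lambda>i. 1 / 2"] \<theta>_le by simp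
    also have "\<dots> \<le> real m * \<kappa>" using \<theta>_half by (simp add: mult_left_mono)
    finally have b: "\<bar>\<theta> ^ m - (1 / 2) ^ m\<bar> \<le> real m * \<kappa>" .
    have "\<bar>measure (noise (n r)) ?S - (1 / 2) ^ m\<bar> \<le>
        \<bar>measure (noise (n r)) ?S - E r\<bar> + \<bar>E r - \<theta> ^ m\<bar> + \<bar>\<theta> ^ m - (1 / 2) ^ m\<bar>"
      by linarith
    also have "\<dots> < \<delta>" using a b elim(1) \<kappa>(3) by linarith
    finally show ?case by (simp only: real_norm_def)
  qed
  then show "\<exists>no. \<forall>r\<ge>no. norm (measure (noise (n r)) {e \<in> space (noise (n r)). \<forall>i<m. ip (n r) (c r i) e \<le> \<tau> r i} - (1 / 2) ^ m) < \<delta>"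
    by (simp add: eventually_sequentially)
qed

text \<open>Uniform form of the orthant limit: \<open>\<delta>\<close> may not depend on the
  dimension, the vectors, the thresholds or the index set. The index set is an arbitrary finite set
  because it will be a signal support or the union of two supports.\<close>

definition orthant_close :: "nat \<Rightarrow> real \<Rightarrow> real \<Rightarrow> bool" where
  "orthant_close m \<epsilon> \<delta> \<longleftrightarrow> (\<forall>n S c \<tau>. finite S \<and> card S = m \<and>
      (\<forall>i\<in>S. \<forall>j\<in>S. \<bar>ip n (c i) (c j) - (if i = j then 1 else 0)\<bar> \<le> \<delta>) \<and>
      (\<forall>i\<in>S. \<bar>\<tau> i\<bar> \<le> \<delta>) \<longrightarrow>
      \<bar>measure (noise n) {e \<in> space (noise n). \<forall>i\<in>(S :: nat set). ip n (c i) e \<le> \<tau> i} - (1 / 2) ^ m\<bar> < \<epsilon>)"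

text \<open>Otherwise there is a counterexample for every \<open>\<delta> = 1 / (r + 1)\<close>, and
  these counterexamples form a sequence that contradicts
  \<open>noise_orthant_tendsto\<close>.\<close>

lemma ex_orthant_close:
  assumes "0 < \<epsilon>"
  shows "\<exists>\<delta>>0. orthant_close m \<epsilon> \<delta>"
proof -
  define bad where "bad \<delta> n S c \<tau> \<longleftrightarrow> finite S \<and> card S = m \<and>
      (\<forall>i\<in>S. \<forall>j\<in>S. \<bar>ip n (c i) (c j) - (if i = j then 1 else 0)\<bar> \<le> \<delta>) \<and>
      (\<forall>i\<in>S. \<bar>\<tau> i\<bar> \<le> \<delta>) \<and>
      \<not> \<bar>measure (noise n) {e \<in> space (noise n). \<forall>i\<in>S. ip n (c i) e \<le> \<tau> i} - (1 / 2) ^ m\<bar> < \<epsilon>"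
    for \<delta> n and S :: "nat set" and c \<tau>
  have "\<exists>\<delta>>0. \<forall>n S c \<tau>. \<not> bad \<delta> n S c \<tau>"
  proof (rule ccontr)
    assume "\<not> ?thesis"
    then have "\<forall>\<delta>>0. \<exists>n S c \<tau>. bad \<delta> n S c \<tau>" by blast
    moreover have "0 < inverse (real (Suc r))" for r by simp
    ultimately have "\<forall>r. \<exists>n S c \<tau>. bad (inverse (real (Suc r))) n S c \<tau>" by blast
    then obtain n S c \<tau> where *: "\<And>r. bad (inverse (real (Suc r))) (n r) (S r) (c r) (\<tau> r)" by metis
    note bad = * [unfolded bad_def]
    \<comment> \<open>The index sets of the counterexamples vary with \<open>r\<close>, whereas the
      limit lemma works on \<open>{..<m}\<close>.\<close>
    have "\<exists>h. bij_betw h {..<m} (S r)" for r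
      using bad[of r] ex_bij_betw_nat_finite[of "S r"] by (auto simp: lessThan_atLeast0)
    then obtain h where h: "\<And>r. bij_betw (h r) {..<m} (S r)" by metis
    have hS: "h r i \<in> S r" if "i < m" for r i using h[of r] that by (auto simp: bij_betw_def)
    have hinj: "h r i = h r j \<longleftrightarrow> i = j" if "i < m" "j < m" for r i j
      using h[of r] that by (auto simp: bij_betw_def inj_on_def)
    have "(\<lambda>r. measure (noise (n r)) {e \<in> space (noise (n r)). \<forall>i<m. ip (n r) (c r (h r i)) e \<le> \<tau> r (h r i)}) \<longlonglongrightarrow> (1 / 2) ^ m"
    proof (rule noise_orthant_tendsto)
      fix i j assume ij: "i < m" "j < m"
      have "norm (ip (n r) (c r (h r i)) (c r (h r j)) - (if i = j then 1 else 0)) \<le> inverse (real (Suc r))" for r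
      proof -
        have "\<bar>ip (n r) (c r (h r i)) (c r (h r j)) - (if h r i = h r j then 1 else 0)\<bar> \<le> inverse (real (Suc r))"
          using bad[of r] hS[OF ij(1)] hS[OF ij(2)] by blast
        then show ?thesis by (simp only: hinj[OF ij] real_norm_def)
      qed
      then have "(\<lambda>r. ip (n r) (c r (h r i)) (c r (h r j)) - (if i = j then 1 else 0)) \<longlonglongrightarrow> 0"
        by (intro Lim_null_comparison[OF _ LIMSEQ_inverse_real_of_nat] always_eventually allI)
      then show "(\<lambda>r. ip (n r) (c r (h r i)) (c r (h r j))) \<longlonglongrightarrow> (if i = j then 1 else 0)"
        by (simp only: Lim_null [symmetric])
    next
      fix i assume i: "i < m"
      have "norm (\<tau> r (h r i)) \<le> inverse (real (Suc r))" for r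
        using bad[of r] hS[OF i] by (simp only: real_norm_def)
      then show "(\<lambda>r. \<tau> r (h r i)) \<longlonglongrightarrow> 0"
        by (intro Lim_null_comparison[OF _ LIMSEQ_inverse_real_of_nat] always_eventually allI)
    qed
    from LIMSEQ_D [OF this assms] obtain r where
      r: "\<bar>measure (noise (n r)) {e \<in> space (noise (n r)). \<forall>i<m. ip (n r) (c r (h r i)) e \<le> \<tau> r (h r i)} - (1 / 2) ^ m\<bar> < \<epsilon>"
      unfolding real_norm_def by blast
    have "S r = h r ` {..<m}" using h[of r] by (simp add: bij_betw_def)
    then have "(\<forall>i<m. ip (n r) (c r (h r i)) e \<le> \<tau> r (h r i)) \<longleftrightarrow> (\<forall>i\<in>S r. ip (n r) (c r i) e \<le> \<tau> r i)" for e
      by (simp only: ball_simps lessThan_iff Ball_def imp_conjL) blast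
    with r show False using bad[of r] by (simp only: simp_thms)
  qed
  then obtain \<delta> where \<delta>: "0 < \<delta>" "\<And>n S c \<tau>. \<not> bad \<delta> n S c \<tau>" by blast
  have "orthant_close m \<epsilon> \<delta>"
    unfolding orthant_close_def
  proof (intro allI impI, elim conjE)
    fix n c \<tau> and S :: "nat set"
    assume hyps: "finite S" "card S = m"
      "\<forall>i\<in>S. \<forall>j\<in>S. \<bar>ip n (c i) (c j) - (if i = j then 1 else 0)\<bar> \<le> \<delta>" "\<forall>i\<in>S. \<bar>\<tau> i\<bar> \<le> \<delta>"
    show "\<bar>measure (noise n) {e \<in> space (noise n). \<forall>i\<in>S. ip n (c i) e \<le> \<tau> i} - (1 / 2) ^ m\<bar> < \<epsilon>"
    proof (rule ccontr)
      assume "\<not> ?thesis"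
      with hyps have "bad \<delta> n S c \<tau>" unfolding bad_def by (intro conjI)
      with \<delta>(2) show False by (rule notE)
    qed
  qed
  then show ?thesis using \<delta>(1) by (intro exI conjI)
qed

section \<open>The scan test for a fixed design\<close>

definition near_orth :: "nat \<Rightarrow> nat \<Rightarrow> real \<Rightarrow> (nat \<Rightarrow> nat \<Rightarrow> real) \<Rightarrow> bool" where
  "near_orth n p d v \<longleftrightarrow> (\<forall>j<p. \<forall>k<p. \<bar>ip n (v j) (v k) - (if j = k then 1 else 0)\<bar> \<le> d)"

lemma near_orthD: "near_orth n p d v \<Longrightarrow> j < p \<Longrightarrow> k < p \<Longrightarrow> \<bar>ip n (v j) (v k) - (if j = k then 1 else 0)\<bar> \<le> d"
  by (simp add: near_orth_def)

lemma near_orth_diag: "near_orth n p d v \<Longrightarrow> j < p \<Longrightarrow> \<bar>ip n (v j) (v j) - 1\<bar> \<le> d"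
  using near_orthD[of n p d v j j] by simp

text \<open>Union bound over the columns; the Chernoff parameter \<open>l = t\<close> is optimal for
  unit variance, and the excess variance \<open>d\<close> only costs \<open>d * t^2 / 2\<close> in
  the exponent.\<close>

lemma scan_null_bound:
  assumes v: "near_orth n p d v" and t: "0 \<le> t"
  shows "measure (noise n) {e \<in> space (noise n). \<exists>j<p. \<bar>ip n (v j) e\<bar> > t}
    \<le> 2 * real p * exp (d * t\<^sup>2 / 2 - t\<^sup>2 / 2)"
proof -
  interpret prob_space "noise n" by (rule prob_space_noise)
  have "measure (noise n) {e \<in> space (noise n). \<exists>j<p. \<bar>ip n (v j) e\<bar> > t}
      \<le> measure (noise n) (\<Union>j<p. {e \<in> space (noise n). \<bar>ip n (v j) e\<bar> \<ge> t})"
    by (rule finite_measure_mono) auto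
  also have "\<dots> \<le> (\<Sum>j<p. measure (noise n) {e \<in> space (noise n). \<bar>ip n (v j) e\<bar> \<ge> t})"
    by (rule finite_measure_subadditive_finite) auto
  also have "\<dots> \<le> (\<Sum>j<p. 2 * exp (d * t\<^sup>2 / 2 - t\<^sup>2 / 2))"
  proof (rule sum_mono)
    fix j assume "j \<in> {..<p}"
    then have "ip n (v j) (v j) \<le> 1 + d" using near_orth_diag[OF v, of j] by simp
    then have "t\<^sup>2 * ip n (v j) (v j) \<le> t\<^sup>2 * (1 + d)" by (rule mult_left_mono) simp
    then have "t\<^sup>2 * ip n (v j) (v j) / 2 - t * t \<le> d * t\<^sup>2 / 2 - t\<^sup>2 / 2"
      by (simp add: algebra_simps power2_eq_square)
    then have "2 * exp (t\<^sup>2 * ip n (v j) (v j) / 2 - t * t) \<le> 2 * exp (d * t\<^sup>2 / 2 - t\<^sup>2 / 2)" by simp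
    with noise_abs_tail[OF t, where n = n and c = "v j" and t = t]
    show "measure (noise n) {e \<in> space (noise n). \<bar>ip n (v j) e\<bar> \<ge> t} \<le> 2 * exp (d * t\<^sup>2 / 2 - t\<^sup>2 / 2)"
      by linarith
  qed
  also have "\<dots> = 2 * real p * exp (d * t\<^sup>2 / 2 - t\<^sup>2 / 2)" by simp
  finally show ?thesis .
qed

text \<open>At the index \<open>k\<close> of the largest signal the cross terms are at most a
  quarter of \<open>\<bar>b k\<bar>\<close>, so the mean there is at least \<open>3 a / 2\<close> in
  absolute value. The threshold is at most \<open>5 a / 4\<close>, hence a miss forces noise of size
  \<open>a / 4\<close>.\<close>

lemma scan_miss_large:
  assumes v: "near_orth n p d v" and S: "finite S" "S \<subseteq> {..<p}" "card S = s"
    and k: "k \<in> S" "\<bar>b k\<bar> \<ge> 2 * a" and max: "\<And>j. j \<in> S \<Longrightarrow> \<bar>b j\<bar> \<le> \<bar>b k\<bar>"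
    and a: "0 \<le> a" and d: "0 \<le> d" "d \<le> 1" "(real s + 1) * d \<le> 1 / 4" and t: "t \<le> a + a / 4"
  shows "measure (noise n) {e \<in> space (noise n). \<forall>j\<in>S. \<bar>(\<Sum>k\<in>S. b k * ip n (v j) (v k)) + ip n (v j) e\<bar> \<le> t}
    \<le> 2 * exp (1 - a / 4)"
proof -
  interpret prob_space "noise n" by (rule prob_space_noise)
  have kp: "k < p" using k S by auto
  have "\<bar>(\<Sum>j\<in>S. b j * ip n (v k) (v j)) - b k\<bar> \<le> real s * d * \<bar>b k\<bar>"
  proof -
    have "(\<Sum>j\<in>S. b j * ip n (v k) (v j)) - b k = (\<Sum>j\<in>S. b j * (ip n (v k) (v j) - (if k = j then 1 else 0)))"
    proof -
      have "(\<Sum>j\<in>S. b j * (if k = j then 1 else 0)) = b k"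
        using S k by (simp add: if_distrib cong: if_cong)
      then show ?thesis by (simp only: right_diff_distrib sum_subtractf)
    qed
    also have "\<bar>\<dots>\<bar> \<le> (\<Sum>j\<in>S. \<bar>b k\<bar> * d)"
    proof (rule order_trans[OF sum_abs sum_mono])
      fix j assume j: "j \<in> S"
      then show "\<bar>b j * (ip n (v k) (v j) - (if k = j then 1 else 0))\<bar> \<le> \<bar>b k\<bar> * d"
        unfolding abs_mult using S kp by (intro mult_mono max near_orthD[OF v]) auto
    qed
    finally show ?thesis using S by (simp add: mult_ac)
  qed
  moreover have "real s * d * \<bar>b k\<bar> \<le> 1 / 4 * \<bar>b k\<bar>"
    using d by (intro mult_right_mono) (simp_all add: algebra_simps)
  ultimately have "\<bar>(\<Sum>j\<in>S. b j * ip n (v k) (v j))\<bar> \<ge> 3 / 4 * (2 * a)"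
    using k by linarith
  then have "{e \<in> space (noise n). \<forall>j\<in>S. \<bar>(\<Sum>k\<in>S. b k * ip n (v j) (v k)) + ip n (v j) e\<bar> \<le> t} \<subseteq>
      {e \<in> space (noise n). \<bar>ip n (v k) e\<bar> \<ge> a / 4}"
    using k t by fastforce
  then have "measure (noise n) {e \<in> space (noise n). \<forall>j\<in>S. \<bar>(\<Sum>k\<in>S. b k * ip n (v j) (v k)) + ip n (v j) e\<bar> \<le> t}
      \<le> measure (noise n) {e \<in> space (noise n). \<bar>ip n (v k) e\<bar> \<ge> a / 4}"
    by (rule finite_measure_mono) auto
  also have "\<dots> \<le> 2 * exp (1\<^sup>2 * ip n (v k) (v k) / 2 - 1 * (a / 4))"
    by (rule noise_abs_tail) simp
  also have "\<dots> \<le> 2 * exp (1 - a / 4)"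
    using near_orth_diag[OF v kp] d by simp
  finally show ?thesis .
qed

text \<open>For sizes at most \<open>2 a\<close> the cross terms are at most \<open>2 s a d\<close>.
  After multiplying each coordinate by the sign of its signal, a miss forces every noise coordinate
  below the small level \<open>\<tau>\<close>, an orthant event. Sign changes preserve the closeness
  of the Gram matrix to the identity.\<close>

lemma scan_miss_moderate:
  assumes v: "near_orth n p d v" and S: "finite S" "S \<subseteq> {..<p}" "card S = s"
    and b: "\<And>j. j \<in> S \<Longrightarrow> a \<le> \<bar>b j\<bar> \<and> \<bar>b j\<bar> \<le> 2 * a"
    and a: "0 < a" and h: "0 \<le> h" and d: "0 \<le> d"
    and oc: "orthant_close s \<epsilon> \<delta>" and \<delta>: "d \<le> \<delta>" "h + 2 * real s * a * d \<le> \<delta>"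
  shows "measure (noise n) {e \<in> space (noise n). \<forall>j\<in>S. \<bar>(\<Sum>k\<in>S. b k * ip n (v j) (v k)) + ip n (v j) e\<bar> \<le> a + h}
    \<le> (1 / 2) ^ s + \<epsilon>"
proof -
  interpret prob_space "noise n" by (rule prob_space_noise)
  define c where "c j = (\<lambda>i. sgn (b j) * v j i)" for j
  define \<tau> where "\<tau> = h + 2 * real s * a * d"
  have b0: "b j \<noteq> 0" if "j \<in> S" for j using b[OF that] a by auto
  have sub: "{e \<in> space (noise n). \<forall>j\<in>S. \<bar>(\<Sum>k\<in>S. b k * ip n (v j) (v k)) + ip n (v j) e\<bar> \<le> a + h} \<subseteq>
      {e \<in> space (noise n). \<forall>j\<in>S. ip n (c j) e \<le> \<tau>}"
  proof safe
    fix e j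
    assume hyp: "\<forall>j\<in>S. \<bar>(\<Sum>k\<in>S. b k * ip n (v j) (v k)) + ip n (v j) e\<bar> \<le> a + h" and j: "j \<in> S"
    have "\<bar>(\<Sum>k\<in>S. b k * ip n (v j) (v k)) - b j\<bar> \<le> real s * (2 * a * d)"
    proof -
      have "(\<Sum>k\<in>S. b k * ip n (v j) (v k)) - b j = (\<Sum>k\<in>S. b k * (ip n (v j) (v k) - (if j = k then 1 else 0)))"
      proof -
        have "(\<Sum>k\<in>S. b k * (if j = k then 1 else 0)) = b j"
          using S j by (simp add: if_distrib cong: if_cong)
        then show ?thesis by (simp only: right_diff_distrib sum_subtractf)
      qed
      also have "\<bar>\<dots>\<bar> \<le> (\<Sum>k\<in>S. 2 * a * d)"
      proof (rule order_trans[OF sum_abs sum_mono])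
        fix k assume k: "k \<in> S"
        then show "\<bar>b k * (ip n (v j) (v k) - (if j = k then 1 else 0))\<bar> \<le> 2 * a * d"
          unfolding abs_mult using S j b[OF k] a by (intro mult_mono near_orthD[OF v]) auto
      qed
      finally show ?thesis using S by simp
    qed
    moreover have "\<bar>(\<Sum>k\<in>S. b k * ip n (v j) (v k)) + ip n (v j) e\<bar> \<le> a + h" using hyp j by blast
    moreover have "sgn (b j) * ip n (v j) e = (if b j > 0 then ip n (v j) e else - ip n (v j) e)"
      using b0[OF j] by (simp add: sgn_if)
    ultimately show "ip n (c j) e \<le> \<tau>"
      unfolding c_def ip_scale_left \<tau>_def using b[OF j] by (auto split: if_splits)
  qed
  have "\<bar>measure (noise n) {e \<in> space (noise n). \<forall>j\<in>S. ip n (c j) e \<le> \<tau>} - (1 / 2) ^ s\<bar> < \<epsilon>"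
  proof (rule oc[unfolded orthant_close_def, rule_format], intro conjI ballI)
    fix i j assume ij: "i \<in> S" "j \<in> S"
    have "ip n (c i) (c j) - (if i = j then 1 else 0) = (sgn (b i) * sgn (b j)) * (ip n (v i) (v j) - (if i = j then 1 else 0))"
      using b0[OF ij(1)] b0[OF ij(2)] unfolding c_def ip_scale_left ip_scale_right by (auto simp: sgn_if)
    also have "\<bar>\<dots>\<bar> = \<bar>ip n (v i) (v j) - (if i = j then 1 else 0)\<bar>"
      using b0[OF ij(1)] b0[OF ij(2)] by (simp add: abs_mult abs_sgn_eq)
    also have "\<dots> \<le> d" using ij S by (intro near_orthD[OF v]) auto
    also have "\<dots> \<le> \<delta>" by (rule \<delta>)
    finally show "\<bar>ip n (c i) (c j) - (if i = j then 1 else 0)\<bar> \<le> \<delta>" .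
  next
    have "0 \<le> \<tau>" unfolding \<tau>_def using h a d by simp
    then show "\<bar>\<tau>\<bar> \<le> \<delta>" using \<delta> by (simp add: \<tau>_def)
  qed (use S in auto)
  moreover have "measure (noise n) {e \<in> space (noise n). \<forall>j\<in>S. \<bar>(\<Sum>k\<in>S. b k * ip n (v j) (v k)) + ip n (v j) e\<bar> \<le> a + h}
      \<le> measure (noise n) {e \<in> space (noise n). \<forall>j\<in>S. ip n (c j) e \<le> \<tau>}"
    using S by (intro finite_measure_mono sub) auto
  ultimately show ?thesis by linarith
qed

text \<open>Cross terms scale with the signal and would not be small for unbounded signals, hence
  the split at \<open>2 a\<close>. In the large case the bound at a single index is already
  negligible.\<close>

lemma scan_miss_bound:
  assumes v: "near_orth n p d v" and S: "finite S" "S \<subseteq> {..<p}" "card S = s"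
    and b: "\<And>j. j \<in> S \<Longrightarrow> a \<le> \<bar>b j\<bar>"
    and a: "0 < a" and h: "0 \<le> h" "h \<le> a / 4" and d: "0 \<le> d" "d \<le> 1" "(real s + 1) * d \<le> 1 / 4"
    and oc: "orthant_close s \<epsilon> \<delta>" and \<delta>: "d \<le> \<delta>" "h + 2 * real s * a * d \<le> \<delta>"
    and big: "2 * exp (1 - a / 4) \<le> (1 / 2) ^ s + \<epsilon>"
  shows "measure (noise n) {e \<in> space (noise n). \<forall>j\<in>S. \<bar>(\<Sum>k\<in>S. b k * ip n (v j) (v k)) + ip n (v j) e\<bar> \<le> a + h}
    \<le> (1 / 2) ^ s + \<epsilon>"
proof (cases "\<forall>j\<in>S. \<bar>b j\<bar> \<le> 2 * a")
  case True
  then show ?thesis using scan_miss_moderate[OF v S _ a h(1) d(1) oc \<delta>, of b] b by auto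
next
  case False
  let ?B = "(\<lambda>j. \<bar>b j\<bar>) ` S"
  have "Max ?B \<in> ?B" using False S by (intro Max_in) auto
  then obtain k where k: "k \<in> S" "\<bar>b k\<bar> = Max ?B" by auto
  have max: "\<bar>b j\<bar> \<le> \<bar>b k\<bar>" if "j \<in> S" for j
    unfolding k(2) using S that by (intro Max_ge) auto
  obtain j where "j \<in> S" "2 * a < \<bar>b j\<bar>" using False by auto
  then have "2 * a \<le> \<bar>b k\<bar>" using max[of j] by linarith
  then have "measure (noise n) {e \<in> space (noise n). \<forall>j\<in>S. \<bar>(\<Sum>k\<in>S. b k * ip n (v j) (v k)) + ip n (v j) e\<bar> \<le> a + h}
      \<le> 2 * exp (1 - a / 4)"
    using a h by (intro scan_miss_large[OF v S k(1)] max d) auto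
  with big show ?thesis by linarith
qed

section \<open>The truncated likelihood ratio\<close>

definition mean_shift :: "real \<Rightarrow> (nat \<Rightarrow> nat \<Rightarrow> real) \<Rightarrow> nat set \<Rightarrow> nat \<Rightarrow> real" where
  "mean_shift a v S = (\<lambda>i. a * (\<Sum>j\<in>S. v j i))"

lemma ip_mean_shift: "ip n (mean_shift a v S) e = a * (\<Sum>j\<in>S. ip n (v j) e)"
  unfolding mean_shift_def ip_scale_left ip_sum_left ..

lemma ip_mean_shift_right: "ip n e (mean_shift a v S) = a * (\<Sum>j\<in>S. ip n e (v j))"
  unfolding mean_shift_def ip_scale_right ip_sum_right ..

text \<open>The error is of order \<open>a^2 d\<close>, and it will stand in an exponent; with
  \<open>a^2 = 2 log p\<close> this is where the requirement that \<open>d\<close> be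
  \<open>o(1 / log p)\<close> originates.\<close>

lemma ip_mean_shift_approx:
  assumes v: "near_orth n p d v" and S: "finite S" "S \<subseteq> {..<p}" and S': "finite S'" "S' \<subseteq> {..<p}"
  shows "\<bar>ip n (mean_shift a v S) (mean_shift a v S') - a\<^sup>2 * real (card (S \<inter> S'))\<bar>
    \<le> a\<^sup>2 * (real (card S) * real (card S') * d)"
proof -
  have "(\<Sum>j\<in>S. \<Sum>k\<in>S'. (if j = k then 1 else 0 :: real)) = real (card (S \<inter> S'))"
    using S S' by (simp add: sum.If_cases Int_def)
  then have "ip n (mean_shift a v S) (mean_shift a v S') - a\<^sup>2 * real (card (S \<inter> S')) =
      a\<^sup>2 * (\<Sum>j\<in>S. \<Sum>k\<in>S'. ip n (v j) (v k) - (if j = k then 1 else 0))"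
    unfolding ip_mean_shift ip_mean_shift_right sum_subtractf
    by (simp add: right_diff_distrib sum_distrib_left power2_eq_square mult.assoc) (rule sum.swap)
  moreover have "\<bar>\<Sum>j\<in>S. \<Sum>k\<in>S'. ip n (v j) (v k) - (if j = k then 1 else 0)\<bar> \<le> (\<Sum>j\<in>S. \<Sum>k\<in>S'. d)"
    using S S' by (intro order_trans[OF sum_abs sum_mono] near_orthD[OF v]) auto
  ultimately show ?thesis
    by (simp add: abs_mult mult_left_mono mult.assoc)
qed

text \<open>The likelihood ratio of the mean \<open>mean_shift a v S\<close> against \<open>0\<close>, truncated where
  one of its active coordinates exceeds \<open>t\<close>; without the truncation its variance explodes.\<close>

definition trunc_lr :: "nat \<Rightarrow> real \<Rightarrow> real \<Rightarrow> (nat \<Rightarrow> nat \<Rightarrow> real) \<Rightarrow> nat set \<Rightarrow> (nat \<Rightarrow> real) \<Rightarrow> real" where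
  "trunc_lr n a t v S e =
    exp (ip n (mean_shift a v S) e - ip n (mean_shift a v S) (mean_shift a v S) / 2) *
    of_bool (\<forall>j\<in>S. ip n (v j) e \<le> t)"

lemma measurable_trunc_lr [measurable]: "finite S \<Longrightarrow> trunc_lr n a t v S \<in> borel_measurable (vecM n)"
  unfolding trunc_lr_def [abs_def] by measurable

lemma trunc_lr_nonneg: "0 \<le> trunc_lr n a t v S e"
  by (simp add: trunc_lr_def)

text \<open>The truncation bounds every active coordinate and with it the exponent. Boundedness
  settles the integrability of the ratio and of its products.\<close>

lemma trunc_lr_le:
  assumes "0 \<le> a"
  shows "trunc_lr n a t v S e \<le> exp (a * (real (card S) * t))"
proof (cases "\<forall>j\<in>S. ip n (v j) e \<le> t")
  case True
  then have "(\<Sum>j\<in>S. ip n (v j) e) \<le> (\<Sum>j\<in>S. t)" by (intro sum_mono) auto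
  then have "ip n (mean_shift a v S) e \<le> a * (real (card S) * t)"
    unfolding ip_mean_shift using assms by (intro mult_left_mono) auto
  then show ?thesis
    using ip_nonneg[of n "mean_shift a v S"] by (simp add: trunc_lr_def)
next
  case False
  then have "trunc_lr n a t v S e = 0" by (simp add: trunc_lr_def)
  then show ?thesis by simp
qed

lemma integrable_bounded:
  fixes f :: "_ \<Rightarrow> real"
  assumes [measurable]: "f \<in> borel_measurable (vecM n)" and "\<And>e. \<bar>f e\<bar> \<le> B"
  shows "integrable (noise n) f"
proof -
  interpret prob_space "noise n" by (rule prob_space_noise)
  show ?thesis by (rule integrable_const_bound[of _ B]) (auto simp: assms)
qed

lemma integrable_trunc_lr:
  "0 \<le> a \<Longrightarrow> finite S \<Longrightarrow> integrable (noise n) (trunc_lr n a t v S)"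
  by (rule integrable_bounded[of _ _ "exp (a * (real (card S) * t))"])
    (auto simp: trunc_lr_nonneg trunc_lr_le)

lemma integrable_trunc_lr_mult:
  assumes "0 \<le> a" "finite S" "finite S'"
  shows "integrable (noise n) (\<lambda>e. trunc_lr n a t v S e * trunc_lr n a t v S' e)"
proof (rule integrable_bounded)
  show "\<bar>trunc_lr n a t v S e * trunc_lr n a t v S' e\<bar> \<le>
      exp (a * (real (card S) * t)) * exp (a * (real (card S') * t))" for e
    using assms by (auto simp: trunc_lr_nonneg intro!: mult_mono trunc_lr_le)
qed (use assms in measurable)

text \<open>Under the shifted law each active coordinate is centred near \<open>a\<close>, so the
  level \<open>a - h\<close> sits at a threshold of size at most \<open>h + a m d\<close> after
  centring. The set \<open>U\<close> is a support or the union of two disjoint ones.\<close>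

lemma mean_shift_orthant:
  assumes v: "near_orth n p d v" and U: "finite U" "U \<subseteq> {..<p}" "card U = m"
    and a: "0 \<le> a" and h: "0 \<le> h" and d: "0 \<le> d"
    and oc: "orthant_close m \<epsilon> \<delta>" and \<delta>: "d \<le> \<delta>" "h + a * (real m * d) \<le> \<delta>"
  shows "\<bar>(\<integral>e. of_bool (\<forall>j\<in>U. ip n (v j) (\<lambda>i\<in>{..<n}. mean_shift a v U i + e i) \<le> a - h) \<partial>noise n) - (1 / 2) ^ m\<bar> < \<epsilon>"
proof -
  define \<tau> where "\<tau> j = a - h - ip n (v j) (mean_shift a v U)" for j
  have "(\<integral>e. of_bool (\<forall>j\<in>U. ip n (v j) (\<lambda>i\<in>{..<n}. mean_shift a v U i + e i) \<le> a - h) \<partial>noise n) =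
      (\<integral>e. indicator {e \<in> space (noise n). \<forall>j\<in>U. ip n (v j) e \<le> \<tau> j} e \<partial>noise n)"
    by (intro Bochner_Integration.integral_cong) (auto simp: ip_add_right \<tau>_def algebra_simps indicator_def of_bool_def)
  also have "\<dots> = measure (noise n) {e \<in> space (noise n). \<forall>j\<in>U. ip n (v j) e \<le> \<tau> j}"
    by (simp add: Int_absorb2)
  finally have eq: "(\<integral>e. of_bool (\<forall>j\<in>U. ip n (v j) (\<lambda>i\<in>{..<n}. mean_shift a v U i + e i) \<le> a - h) \<partial>noise n) =
     measure (noise n) {e \<in> space (noise n). \<forall>j\<in>U. ip n (v j) e \<le> \<tau> j}" .
  show ?thesis unfolding eq
  proof (rule oc[unfolded orthant_close_def, rule_format], intro conjI ballI)
    fix i j assume "i \<in> U" "j \<in> U"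
    then have "\<bar>ip n (v i) (v j) - (if i = j then 1 else 0)\<bar> \<le> d"
      using U by (intro near_orthD[OF v]) auto
    then show "\<bar>ip n (v i) (v j) - (if i = j then 1 else 0)\<bar> \<le> \<delta>" using \<delta> by linarith
  next
    fix j assume j: "j \<in> U"
    have "(\<Sum>k\<in>U. (if j = k then 1 else 0 :: real)) = 1" using U j by simp
    then have "\<tau> j = - h - a * (\<Sum>k\<in>U. ip n (v j) (v k) - (if j = k then 1 else 0))"
      unfolding \<tau>_def ip_mean_shift_right sum_subtractf by (simp add: algebra_simps)
    moreover have "\<bar>\<Sum>k\<in>U. ip n (v j) (v k) - (if j = k then 1 else 0)\<bar> \<le> (\<Sum>k\<in>U. d)"
      using U j by (intro order_trans[OF sum_abs sum_mono] near_orthD[OF v]) auto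
    then have "a * \<bar>\<Sum>k\<in>U. ip n (v j) (v k) - (if j = k then 1 else 0)\<bar> \<le> a * (real m * d)"
      using a U(3) by (intro mult_left_mono) simp_all
    then have "\<bar>a * (\<Sum>k\<in>U. ip n (v j) (v k) - (if j = k then 1 else 0))\<bar> \<le> a * (real m * d)"
      using a by (simp only: abs_mult abs_of_nonneg)
    ultimately have "\<bar>\<tau> j\<bar> \<le> h + a * (real m * d)"
      using h by linarith
    then show "\<bar>\<tau> j\<bar> \<le> \<delta>" using \<delta> by linarith
  qed (use U in auto)
qed

lemma integral_trunc_lr:
  assumes "finite S"
  shows "(\<integral>e. trunc_lr n a t v S e \<partial>noise n) =
    (\<integral>e. of_bool (\<forall>j\<in>S. ip n (v j) (\<lambda>i\<in>{..<n}. mean_shift a v S i + e i) \<le> t) \<partial>noise n)"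
  unfolding trunc_lr_def
  by (rule integral_noise_shift[symmetric]) (use assms in measurable)

text \<open>Since the mean vectors add up, the product of the two ratios is the truncated ratio for
  the union times \<open>exp (ip n ?w ?w')\<close>. That factor is near 1 for disjoint supports, and
  a change of measure turns the rest into an orthant probability of dimension
  \<open>2 s\<close>.\<close>

lemma integral_trunc_lr_disjoint:
  assumes v: "near_orth n p d v" and S: "finite S" "S \<subseteq> {..<p}" "card S = s"
    and S': "finite S'" "S' \<subseteq> {..<p}" "card S' = s" and dis: "S \<inter> S' = {}"
    and a: "0 \<le> a" and h: "0 \<le> h" and d: "0 \<le> d"
    and oc: "orthant_close (2 * s) \<epsilon> \<delta>" and \<delta>: "d \<le> \<delta>" "h + a * (real (2 * s) * d) \<le> \<delta>"
  shows "(\<integral>e. trunc_lr n a (a - h) v S e * trunc_lr n a (a - h) v S' e \<partial>noise n)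
    \<le> exp (a\<^sup>2 * (real s * real s * d)) * ((1 / 2) ^ (2 * s) + \<epsilon>)"
proof -
  let ?U = "S \<union> S'" and ?w = "mean_shift a v S" and ?w' = "mean_shift a v S'" and ?u = "mean_shift a v (S \<union> S')"
  have U: "finite ?U" "?U \<subseteq> {..<p}" "card ?U = 2 * s"
    using S S' dis by (auto simp: card_Un_disjoint)
  have split: "ip n ?u e = ip n ?w e + ip n ?w' e" "ip n e ?u = ip n e ?w + ip n e ?w'" for e
    unfolding ip_mean_shift ip_mean_shift_right using S S' dis by (simp_all add: sum.union_disjoint distrib_left)
  have "trunc_lr n a (a - h) v S e * trunc_lr n a (a - h) v S' e =
      exp (ip n ?w ?w') * (exp (ip n ?u e - ip n ?u ?u / 2) * of_bool (\<forall>j\<in>?U. ip n (v j) e \<le> a - h))" for e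
    by (simp add: trunc_lr_def split ip_commute[of n ?w' ?w] ball_Un exp_add [symmetric] of_bool_def) (simp add: field_simps)
  then have "(\<integral>e. trunc_lr n a (a - h) v S e * trunc_lr n a (a - h) v S' e \<partial>noise n) =
      exp (ip n ?w ?w') * (\<integral>e. exp (ip n ?u e - ip n ?u ?u / 2) * of_bool (\<forall>j\<in>?U. ip n (v j) e \<le> a - h) \<partial>noise n)"
    by (simp only: integral_mult_right_zero)
  also have "(\<integral>e. exp (ip n ?u e - ip n ?u ?u / 2) * of_bool (\<forall>j\<in>?U. ip n (v j) e \<le> a - h) \<partial>noise n) =
      (\<integral>e. of_bool (\<forall>j\<in>?U. ip n (v j) (\<lambda>i\<in>{..<n}. ?u i + e i) \<le> a - h) \<partial>noise n)"
    by (rule integral_noise_shift[symmetric]) (use U in measurable)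
  also have "exp (ip n ?w ?w') * \<dots> \<le> exp (a\<^sup>2 * (real s * real s * d)) * ((1 / 2) ^ (2 * s) + \<epsilon>)"
  proof (rule mult_mono)
    show "exp (ip n ?w ?w') \<le> exp (a\<^sup>2 * (real s * real s * d))"
      using ip_mean_shift_approx[OF v S(1,2) S'(1,2), of a] S S' dis by simp
    show "(\<integral>e. of_bool (\<forall>j\<in>?U. ip n (v j) (\<lambda>i\<in>{..<n}. ?u i + e i) \<le> a - h) \<partial>noise n) \<le> (1 / 2) ^ (2 * s) + \<epsilon>"
      using mean_shift_orthant[OF v U a h d oc \<delta>] by linarith
  qed auto
  finally show ?thesis .
qed

text \<open>In the product each shared coordinate occurs twice. One copy is kept in the exponential
  of the union; the other is bounded through the truncation by \<open>a (a - h)\<close>. The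
  untruncated Gaussian moment of the union, whose size is \<open>2 s - k\<close>, then leaves
  \<open>a^2 / 2 - a h\<close> per shared coordinate; without truncation it would be
  \<open>a^2\<close>, that is a factor \<open>p^2\<close>.\<close>

lemma integral_trunc_lr_overlap:
  assumes v: "near_orth n p d v" and S: "finite S" "S \<subseteq> {..<p}" "card S = s"
    and S': "finite S'" "S' \<subseteq> {..<p}" "card S' = s" and k: "card (S \<inter> S') = k"
    and a: "0 \<le> a" and d: "0 \<le> d"
  shows "(\<integral>e. trunc_lr n a (a - h) v S e * trunc_lr n a (a - h) v S' e \<partial>noise n)
    \<le> exp (3 * a\<^sup>2 * (real s * real s * d)) * exp (a\<^sup>2 / 2 - a * h) ^ k"
proof -
  let ?U = "S \<union> S'" and ?w = "mean_shift a v S" and ?w' = "mean_shift a v S'" and ?u = "mean_shift a v (S \<union> S')"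
  define C where "C = real k * (a * (a - h)) - ip n ?w ?w / 2 - ip n ?w' ?w' / 2"
  have U: "finite ?U" "?U \<subseteq> {..<p}" using S S' by auto
  have cU: "card ?U + k = 2 * s" using card_Un_Int[OF S(1) S'(1)] S S' k by simp
  have split: "ip n ?w e + ip n ?w' e = ip n ?u e + a * (\<Sum>j\<in>S \<inter> S'. ip n (v j) e)" for e
    unfolding ip_mean_shift using sum.union_inter[OF S(1) S'(1), of "\<lambda>j. ip n (v j) e"]
    by (simp add: distrib_left [symmetric])
  have "trunc_lr n a (a - h) v S e * trunc_lr n a (a - h) v S' e \<le> exp (ip n ?u e) * exp C" for e
  proof (cases "(\<forall>j\<in>S. ip n (v j) e \<le> a - h) \<and> (\<forall>j\<in>S'. ip n (v j) e \<le> a - h)")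
    case True
    have "(\<Sum>j\<in>S \<inter> S'. ip n (v j) e) \<le> (\<Sum>j\<in>S \<inter> S'. a - h)" using True by (intro sum_mono) auto
    then have "a * (\<Sum>j\<in>S \<inter> S'. ip n (v j) e) \<le> a * (real k * (a - h))"
      using a k by (intro mult_left_mono) auto
    then have "ip n ?w e + ip n ?w' e \<le> ip n ?u e + real k * (a * (a - h))"
      using split[of e] by (simp add: mult_ac)
    then show ?thesis
      using True by (simp add: trunc_lr_def C_def exp_add [symmetric])
  qed (auto simp: trunc_lr_def)
  then have "(\<integral>e. trunc_lr n a (a - h) v S e * trunc_lr n a (a - h) v S' e \<partial>noise n) \<le>
      (\<integral>e. exp (ip n ?u e) * exp C \<partial>noise n)"
    using a S S' by (intro integral_mono integrable_trunc_lr_mult integrable_mult_left integrable_noise_exp) auto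
  also have "\<dots> = exp (ip n ?u ?u / 2 + C)"
    by (simp add: integral_noise_exp exp_add)
  \<comment> \<open>The 3 collects Gram errors in units of \<open>a^2 s^2 d\<close>: the union has
    at most \<open>2 s\<close> elements and contributes half of 4, and the two single norms
    contribute one half each.\<close>
  also have "\<dots> \<le> exp (3 * a\<^sup>2 * (real s * real s * d) + real k * (a\<^sup>2 / 2 - a * h))"
  proof -
    have u: "ip n ?u ?u \<le> a\<^sup>2 * real (card ?U) + a\<^sup>2 * (real (card ?U) * real (card ?U) * d)"
      using ip_mean_shift_approx[OF v U U, of a] by simp
    have w: "a\<^sup>2 * real s - a\<^sup>2 * (real s * real s * d) \<le> ip n ?w ?w"
      using ip_mean_shift_approx[OF v S(1,2) S(1,2), of a] S by simp
    have w': "a\<^sup>2 * real s - a\<^sup>2 * (real s * real s * d) \<le> ip n ?w' ?w'"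
      using ip_mean_shift_approx[OF v S'(1,2) S'(1,2), of a] S' by simp
    have cU': "real (card ?U) = 2 * real s - real k" using cU by linarith
    have "real (card ?U) * real (card ?U) * d \<le> (2 * real s) * (2 * real s) * d"
      using cU' d by (intro mult_right_mono mult_mono) auto
    then have "a\<^sup>2 * (real (card ?U) * real (card ?U) * d) \<le> a\<^sup>2 * ((2 * real s) * (2 * real s) * d)"
      by (rule mult_left_mono) simp
    then have "ip n ?u ?u \<le> a\<^sup>2 * (2 * real s - real k) + 4 * (a\<^sup>2 * (real s * real s * d))"
      using u unfolding cU' by simp
    then have "ip n ?u ?u / 2 + C \<le> 3 * (a\<^sup>2 * (real s * real s * d)) + (real k * (a * (a - h)) - a\<^sup>2 * real k / 2)"
      unfolding C_def using w w' by (simp add: right_diff_distrib)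
    also have "real k * (a * (a - h)) - a\<^sup>2 * real k / 2 = real k * (a\<^sup>2 / 2 - a * h)"
      by (simp add: algebra_simps power2_eq_square)
    finally show ?thesis by (simp add: mult.assoc)
  qed
  also have "\<dots> = exp (3 * a\<^sup>2 * (real s * real s * d)) * exp (a\<^sup>2 / 2 - a * h) ^ k"
    by (simp add: exp_add exp_of_nat_mult)
  finally show ?thesis .
qed

section \<open>The Bayes lower bound for a fixed design\<close>

text \<open>The right side is at least \<open>min 1 L\<close>. For \<open>L > 1\<close>, expanding
  \<open>(L - q - 1)^2 >= 0\<close> shows that the quadratic on the left is at most
  \<open>q + 1 / 2\<close>, hence at most 1. It is applied with \<open>q = (1 / 2)^s\<close>, which
  is at most \<open>1 / 2\<close> for \<open>s >= 1\<close>.\<close>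

lemma two_point_bound:
  fixes L q F :: real
  assumes "0 \<le> F" "F \<le> 1" "0 \<le> L" "q \<le> 1 / 2"
  shows "L - (L - q)\<^sup>2 / 2 \<le> F + L * (1 - F)"
proof (cases "L \<le> 1")
  case True
  then have "0 \<le> F * (1 - L)" using assms by simp
  then have "L \<le> F + L * (1 - F)" by (simp add: algebra_simps)
  then show ?thesis by (smt (verit) zero_le_power2 half_gt_zero_iff divide_nonneg_pos)
next
  case False
  then have "0 \<le> (L - 1) * (1 - F)" using assms by simp
  then have 1: "1 \<le> F + L * (1 - F)" by (simp add: algebra_simps)
  have "0 \<le> (L - q - 1)\<^sup>2" by simp
  then have "2 * (L - q) - 1 \<le> (L - q)\<^sup>2" by (simp add: power2_eq_square algebra_simps)
  moreover have "L - u / 2 \<le> F + L * (1 - F)" if "2 * (L - q) - 1 \<le> u" for u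
    using that 1 assms by argo
  ultimately show ?thesis by blast
qed

text \<open>Dropping the truncation only enlarges the integrand, and the full likelihood ratio is
  the density of the shifted noise.\<close>

lemma integral_shift_ge_trunc_lr:
  fixes F :: "(nat \<Rightarrow> real) \<Rightarrow> real"
  assumes F [measurable]: "F \<in> borel_measurable (vecM n)"
    and F01: "\<And>e. e \<in> space (vecM n) \<Longrightarrow> 0 \<le> F e \<and> F e \<le> 1"
    and S: "finite S" and a: "0 \<le> a"
  shows "integrable (noise n) (\<lambda>e. trunc_lr n a t v S e * F e)"
    and "(\<integral>e. trunc_lr n a t v S e * F e \<partial>noise n) \<le> (\<integral>e. F (\<lambda>i\<in>{..<n}. mean_shift a v S i + e i) \<partial>noise n)"
proof -
  let ?w = "mean_shift a v S"
  have i: "integrable (noise n) (\<lambda>e. exp (ip n ?w e - ip n ?w ?w / 2))"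
    unfolding exp_diff by (intro integrable_divide integrable_noise_exp)
  have i1: "integrable (noise n) (\<lambda>e. exp (ip n ?w e - ip n ?w ?w / 2) * F e)"
    by (rule Bochner_Integration.integrable_bound[OF i])
      (use F01 in \<open>auto intro!: AE_I2 mult_left_le simp: abs_mult abs_of_nonneg\<close>)
  have le: "trunc_lr n a t v S e * F e \<le> exp (ip n ?w e - ip n ?w ?w / 2) * F e"
    if "e \<in> space (noise n)" for e
    using F01[of e] that by (intro mult_right_mono) (auto simp: trunc_lr_def)
  show i2: "integrable (noise n) (\<lambda>e. trunc_lr n a t v S e * F e)"
    by (rule Bochner_Integration.integrable_bound[OF i1])
      (use S le F01 in \<open>auto intro!: AE_I2 simp: abs_mult trunc_lr_nonneg\<close>)
  show "(\<integral>e. trunc_lr n a t v S e * F e \<partial>noise n) \<le> (\<integral>e. F (\<lambda>i\<in>{..<n}. ?w i + e i) \<partial>noise n)"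
    unfolding integral_noise_shift[OF F] by (rule integral_mono[OF i2 i1 le])
qed

text \<open>With \<open>L\<close> the average of the truncated ratios over \<open>\<Phi>\<close>,
  the sum of the errors of the test \<open>F\<close> is at least the integral of
  \<open>F + L (1 - F)\<close>. Integrating \<open>two_point_bound\<close> bounds this below in
  terms of the first two moments of \<open>L\<close>.\<close>

lemma bayes_lower_bound:
  fixes F :: "(nat \<Rightarrow> real) \<Rightarrow> real" and S :: "'i \<Rightarrow> nat set"
  assumes F [measurable]: "F \<in> borel_measurable (vecM n)"
    and F01: "\<And>e. e \<in> space (vecM n) \<Longrightarrow> 0 \<le> F e \<and> F e \<le> 1"
    and \<Phi>: "finite \<Phi>" "\<Phi> \<noteq> {}" and S: "\<And>f. f \<in> \<Phi> \<Longrightarrow> finite (S f)" and a: "0 \<le> a"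
    and q: "0 \<le> q" "q \<le> 1 / 2" and \<epsilon>: "0 \<le> \<epsilon>"
    and m1: "\<And>f. f \<in> \<Phi> \<Longrightarrow> q - \<epsilon> \<le> (\<integral>e. trunc_lr n a t v (S f) e \<partial>noise n)"
    and m2: "(\<Sum>f\<in>\<Phi>. \<Sum>g\<in>\<Phi>. \<integral>e. trunc_lr n a t v (S f) e * trunc_lr n a t v (S g) e \<partial>noise n)
      \<le> (q\<^sup>2 + \<epsilon>') * (real (card \<Phi>))\<^sup>2"
  shows "q - 2 * \<epsilon> - \<epsilon>' / 2 \<le> (\<integral>e. F e \<partial>noise n) +
    (\<Sum>f\<in>\<Phi>. \<integral>e. 1 - F (\<lambda>i\<in>{..<n}. mean_shift a v (S f) i + e i) \<partial>noise n) / real (card \<Phi>)"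
proof -
  interpret prob_space "noise n" by (rule prob_space_noise)
  define N where "N = real (card \<Phi>)"
  have N: "0 < N" using \<Phi> by (simp add: N_def card_gt_0_iff)
  define L where "L e = (\<Sum>f\<in>\<Phi>. trunc_lr n a t v (S f) e) / N" for e
  have G: "(\<lambda>e. 1 - F e) \<in> borel_measurable (vecM n)" by measurable
  have G01: "\<And>e. e \<in> space (vecM n) \<Longrightarrow> 0 \<le> 1 - F e \<and> 1 - F e \<le> 1" using F01 by force
  have iF: "integrable (noise n) F"
    by (rule integrable_const_bound[of _ 1]) (auto intro!: AE_I2 simp: F01)
  have iL: "integrable (noise n) L"
    unfolding L_def [abs_def] using S a by (intro integrable_divide Bochner_Integration.integrable_sum integrable_trunc_lr)
  have iLF: "integrable (noise n) (\<lambda>e. L e * (1 - F e))"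
    unfolding L_def [abs_def] sum_distrib_right times_divide_eq_left
    using S by (intro integrable_divide Bochner_Integration.integrable_sum integral_shift_ge_trunc_lr(1)[OF G G01 _ a])
  have L2: "(L e)\<^sup>2 = (\<Sum>f\<in>\<Phi>. \<Sum>g\<in>\<Phi>. trunc_lr n a t v (S f) e * trunc_lr n a t v (S g) e) / N\<^sup>2" for e
    unfolding L_def power_divide by (simp add: power2_eq_square sum_product)
  have iL2: "integrable (noise n) (\<lambda>e. (L e)\<^sup>2)"
    unfolding L2 using S a
    by (intro integrable_divide Bochner_Integration.integrable_sum integrable_trunc_lr_mult)
  have EL: "q - \<epsilon> \<le> (\<integral>e. L e \<partial>noise n)"
  proof -
    have "N * (q - \<epsilon>) = (\<Sum>f\<in>\<Phi>. q - \<epsilon>)" by (simp add: N_def)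
    also have "\<dots> \<le> (\<Sum>f\<in>\<Phi>. \<integral>e. trunc_lr n a t v (S f) e \<partial>noise n)" by (intro sum_mono m1)
    also have "\<dots> = N * (\<integral>e. L e \<partial>noise n)"
      unfolding L_def using N S a by (subst Bochner_Integration.integral_sum [symmetric]) (auto intro!: integrable_trunc_lr)
    finally show ?thesis using N by simp
  qed
  have EL2: "(\<integral>e. (L e)\<^sup>2 \<partial>noise n) \<le> q\<^sup>2 + \<epsilon>'"
  proof -
    have "(\<integral>e. (L e)\<^sup>2 \<partial>noise n) = (\<Sum>f\<in>\<Phi>. \<Sum>g\<in>\<Phi>. \<integral>e. trunc_lr n a t v (S f) e * trunc_lr n a t v (S g) e \<partial>noise n) / N\<^sup>2"
      unfolding L2 using S a
      by (simp add: Bochner_Integration.integral_sum integrable_trunc_lr_mult Bochner_Integration.integrable_sum)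
    also have "\<dots> \<le> q\<^sup>2 + \<epsilon>'" using m2 N by (simp add: N_def [symmetric] divide_le_eq)
    finally show ?thesis .
  qed
  \<comment> \<open>The expansion of \<open>L - (L - q)^2 / 2\<close> is
    \<open>(1 + q) L - L^2 / 2 - q^2 / 2\<close>. Inserting the moment bounds leaves
    \<open>q - (1 + q) \<epsilon> - \<epsilon>' / 2\<close>, and \<open>1 + q\<close> is at most
    2.\<close>
  have "(1 + q) * (q - \<epsilon>) - (q\<^sup>2 + \<epsilon>') / 2 - q\<^sup>2 / 2 \<le>
      (1 + q) * (\<integral>e. L e \<partial>noise n) - (\<integral>e. (L e)\<^sup>2 \<partial>noise n) / 2 - q\<^sup>2 / 2"
    using EL2 mult_left_mono[OF EL, of "1 + q"] q by (intro diff_mono) auto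
  also have "\<dots> = (\<integral>e. (1 + q) * L e - (L e)\<^sup>2 / 2 - q\<^sup>2 / 2 \<partial>noise n)"
    using iL iL2 by (simp add: prob_space del: space_noise)
  also have "\<dots> \<le> (\<integral>e. F e + L e * (1 - F e) \<partial>noise n)"
  proof (rule integral_mono)
    fix e assume "e \<in> space (noise n)"
    then have "L e - (L e - q)\<^sup>2 / 2 \<le> F e + L e * (1 - F e)"
      using F01[of e] q N by (intro two_point_bound) (auto simp: L_def intro!: divide_nonneg_pos sum_nonneg trunc_lr_nonneg)
    then show "(1 + q) * L e - (L e)\<^sup>2 / 2 - q\<^sup>2 / 2 \<le> F e + L e * (1 - F e)"
      by (simp add: power2_eq_square field_simps)
  qed (use iL iL2 iF iLF in auto)
  also have "\<dots> = (\<integral>e. F e \<partial>noise n) + (\<Sum>f\<in>\<Phi>. \<integral>e. trunc_lr n a t v (S f) e * (1 - F e) \<partial>noise n) / N"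
  proof -
    have "(\<integral>e. L e * (1 - F e) \<partial>noise n) = (\<Sum>f\<in>\<Phi>. \<integral>e. trunc_lr n a t v (S f) e * (1 - F e) \<partial>noise n) / N"
      unfolding L_def times_divide_eq_left sum_distrib_right
      using S by (subst Bochner_Integration.integral_sum [symmetric])
        (auto intro!: integral_shift_ge_trunc_lr(1)[OF G G01 _ a])
    then show ?thesis using iF iLF by simp
  qed
  also have "\<dots> \<le> (\<integral>e. F e \<partial>noise n) +
    (\<Sum>f\<in>\<Phi>. \<integral>e. 1 - F (\<lambda>i\<in>{..<n}. mean_shift a v (S f) i + e i) \<partial>noise n) / N"
    using N S by (intro add_left_mono divide_right_mono sum_mono integral_shift_ge_trunc_lr(2)[OF G G01 _ a]) auto
  finally have "(1 + q) * (q - \<epsilon>) - (q\<^sup>2 + \<epsilon>') / 2 - q\<^sup>2 / 2 \<le> (\<integral>e. F e \<partial>noise n) +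
    (\<Sum>f\<in>\<Phi>. \<integral>e. 1 - F (\<lambda>i\<in>{..<n}. mean_shift a v (S f) i + e i) \<partial>noise n) / real (card \<Phi>)"
    unfolding N_def .
  moreover have "q - 2 * \<epsilon> - \<epsilon>' / 2 \<le> (1 + q) * (q - \<epsilon>) - (q\<^sup>2 + \<epsilon>') / 2 - q\<^sup>2 / 2"
    using mult_right_mono[of q 1 \<epsilon>] q \<epsilon> by (simp add: power2_eq_square algebra_simps add_divide_distrib)
  ultimately show ?thesis by linarith
qed

text \<open>An asymptotically least favourable prior: split the coordinates into \<open>s\<close> blocks of length \<open>m\<close>
  and choose one active coordinate in each, independently and uniformly.\<close>

definition block_choices :: "nat \<Rightarrow> nat \<Rightarrow> (nat \<Rightarrow> nat) set" where
  "block_choices s m = PiE {..<s} (\<lambda>_. {..<m})"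

definition block_support :: "nat \<Rightarrow> nat \<Rightarrow> (nat \<Rightarrow> nat) \<Rightarrow> nat set" where
  "block_support s m f = (\<lambda>i. i * m + f i) ` {..<s}"

lemma finite_block_choices: "finite (block_choices s m)"
  by (simp add: block_choices_def finite_PiE)

lemma card_block_choices: "card (block_choices s m) = m ^ s"
  by (simp add: block_choices_def card_PiE)

lemma block_index_eq_iff:
  assumes "l < m" "l' < m"
  shows "i * m + l = i' * m + l' \<longleftrightarrow> i = i' \<and> l = (l' :: nat)"
proof
  assume eq: "i * m + l = i' * m + l'"
  have "i = (i * m + l) div m" "i' = (i' * m + l') div m" using assms by simp_all
  then have "i = i'" using eq by simp
  with eq show "i = i' \<and> l = l'" by simp
qed simp

lemma block_support_props:
  assumes f: "f \<in> block_choices s m" and "s * m \<le> p"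
  shows "finite (block_support s m f)" "block_support s m f \<subseteq> {..<p}" "card (block_support s m f) = s"
proof -
  have fm: "f i < m" if "i < s" for i using f that by (auto simp: block_choices_def)
  show "finite (block_support s m f)" by (simp add: block_support_def)
  show "block_support s m f \<subseteq> {..<p}"
  proof
    fix j assume "j \<in> block_support s m f"
    then obtain i where i: "i < s" "j = i * m + f i" by (auto simp: block_support_def)
    have "j < Suc i * m" using fm[OF i(1)] i by simp
    also have "\<dots> \<le> s * m" using i by (intro mult_le_mono1) simp
    finally show "j \<in> {..<p}" using assms by simp
  qed
  have "inj_on (\<lambda>i. i * m + f i) {..<s}"
    by (rule inj_onI) (use fm block_index_eq_iff in auto)
  then show "card (block_support s m f) = s" by (simp add: block_support_def card_image)
qed

lemma card_block_support_Int:
  assumes f: "f \<in> block_choices s m" and g: "g \<in> block_choices s m"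
  shows "card (block_support s m f \<inter> block_support s m g) = card {i. i < s \<and> f i = g i}"
proof -
  have fm: "f i < m" "g i < m" if "i < s" for i using f g that by (auto simp: block_choices_def)
  have "block_support s m f \<inter> block_support s m g = (\<lambda>i. i * m + f i) ` {i. i < s \<and> f i = g i}"
  proof (intro equalityI subsetI)
    fix j assume "j \<in> block_support s m f \<inter> block_support s m g"
    then obtain i i' where i: "i < s" "i' < s" "j = i * m + f i" "j = i' * m + g i'"
      by (auto simp: block_support_def)
    with block_index_eq_iff[OF fm(1)[OF i(1)] fm(2)[OF i(2)], of i i'] have "i = i'" "f i = g i" by auto
    with i show "j \<in> (\<lambda>i. i * m + f i) ` {i. i < s \<and> f i = g i}" by (intro image_eqI[of _ _ i]) auto
  qed (force simp: block_support_def)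
  moreover have "inj_on (\<lambda>i. i * m + f i) {i. i < s \<and> f i = g i}"
    by (rule inj_onI) (use fm block_index_eq_iff in auto)
  ultimately show ?thesis by (simp only: card_image)
qed

text \<open>The power factorizes over the blocks, and in each block exactly one of the
  \<open>m\<close> choices agrees with \<open>f\<close>. This product form of the overlap generating
  function is the benefit of the block prior.\<close>

lemma sum_block_overlap:
  fixes x :: real
  assumes f: "f \<in> block_choices s m"
  shows "(\<Sum>g\<in>block_choices s m. x ^ card {i. i < s \<and> f i = g i}) = (real m - 1 + x) ^ s"
proof -
  have "x ^ card {i. i < s \<and> f i = g i} = (\<Prod>i<s. if f i = g i then x else 1)" for g
    by (simp add: prod.If_cases Int_def)
  then have "(\<Sum>g\<in>block_choices s m. x ^ card {i. i < s \<and> f i = g i}) =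
      (\<Prod>i<s. \<Sum>l<m. if f i = l then x else 1)"
    unfolding block_choices_def by (subst prod_sum_PiE) simp_all
  also have "\<dots> = (\<Prod>i<s. real m - 1 + x)"
  proof (rule prod.cong [OF refl])
    fix i assume "i \<in> {..<s}"
    then have fi: "f i \<in> {..<m}" using f by (auto simp: block_choices_def)
    have "(\<Sum>l<m. if f i = l then x else 1) = x + (\<Sum>l\<in>{..<m} - {f i}. if f i = l then x else 1)"
      using fi by (subst sum.remove[of _ "f i"]) auto
    also have "(\<Sum>l\<in>{..<m} - {f i}. if f i = l then x else 1) = (\<Sum>l\<in>{..<m} - {f i}. 1)"
      by (rule sum.cong) auto
    also have "\<dots> = real m - 1" using fi by (simp add: card_Diff_singleton of_nat_diff)
    finally show "(\<Sum>l<m. if f i = l then x else 1) = real m - 1 + x" by simp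
  qed
  finally show ?thesis by simp
qed

text \<open>Disjoint pairs contribute the orthant term, overlapping pairs the factor
  \<open>x\<close> per shared index. With each choice of probability \<open>1 / m\<close> in its
  block, the overlapping part is the overlap generating function at \<open>x\<close> minus its value
  at 0.\<close>

lemma second_moment_blocks:
  assumes v: "near_orth n p d v" and sm: "s * m \<le> p" "0 < m"
    and a: "0 \<le> a" and h: "0 \<le> h" and d: "0 \<le> d" and \<epsilon>: "0 \<le> \<epsilon>"
    and oc: "orthant_close (2 * s) \<epsilon> \<delta>" and \<delta>: "d \<le> \<delta>" "h + a * (real (2 * s) * d) \<le> \<delta>"
  defines "x \<equiv> exp (a\<^sup>2 / 2 - a * h)" and "\<Phi> \<equiv> block_choices s m" and "K \<equiv> a\<^sup>2 * (real s * real s * d)"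
  shows "(\<Sum>f\<in>\<Phi>. \<Sum>g\<in>\<Phi>. \<integral>e. trunc_lr n a (a - h) v (block_support s m f) e *
            trunc_lr n a (a - h) v (block_support s m g) e \<partial>noise n)
    \<le> (exp K * ((1 / 2) ^ (2 * s) + \<epsilon>) +
        exp (3 * K) * ((1 - 1 / real m + x / real m) ^ s - (1 - 1 / real m) ^ s)) * (real (card \<Phi>))\<^sup>2"
proof -
  define B1 where "B1 = exp K * ((1 / 2) ^ (2 * s) + \<epsilon>)"
  define B2 where "B2 = exp (3 * K)"
  have B: "0 \<le> B1" "0 \<le> B2" using \<epsilon> by (auto simp: B1_def B2_def)
  let ?k = "\<lambda>f g. card {i. i < s \<and> f i = g i}"
  \<comment> \<open>One formula covers both cases: \<open>0 ^ k\<close> is the indicator of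
    \<open>k = 0\<close>, because \<open>0 ^ 0 = 1\<close>. The bracket therefore vanishes for
    disjoint supports and equals \<open>x ^ k\<close> otherwise, and both powers can be summed by
    \<open>sum_block_overlap\<close>.\<close>
  have each: "(\<integral>e. trunc_lr n a (a - h) v (block_support s m f) e *
            trunc_lr n a (a - h) v (block_support s m g) e \<partial>noise n) \<le> B1 + B2 * (x ^ ?k f g - 0 ^ ?k f g)"
    if "f \<in> \<Phi>" "g \<in> \<Phi>" for f g
  proof -
    note f = block_support_props[OF that(1)[unfolded \<Phi>_def] sm(1)]
      and g = block_support_props[OF that(2)[unfolded \<Phi>_def] sm(1)]
      and fg = card_block_support_Int[OF that[unfolded \<Phi>_def]]
    show ?thesis
    proof (cases "?k f g = 0")
      case True
      then have "card (block_support s m f \<inter> block_support s m g) = 0" using fg by simp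
      then have "block_support s m f \<inter> block_support s m g = {}" using f(1) by (metis card_0_eq finite_Int)
      then show ?thesis
        using integral_trunc_lr_disjoint[OF v f g _ a h d oc \<delta>] by (simp only: True) (simp add: B1_def K_def)
    next
      case False
      then have "(0 :: real) ^ ?k f g = 0" by (simp only: power_0_left if_False)
      moreover have "(\<integral>e. trunc_lr n a (a - h) v (block_support s m f) e *
            trunc_lr n a (a - h) v (block_support s m g) e \<partial>noise n) \<le> B2 * x ^ ?k f g"
        using integral_trunc_lr_overlap[OF v f g fg a d, of h]
        by (simp only: B2_def K_def x_def mult.assoc)
      ultimately have "(\<integral>e. trunc_lr n a (a - h) v (block_support s m f) e *
            trunc_lr n a (a - h) v (block_support s m g) e \<partial>noise n) \<le> B2 * (x ^ ?k f g - 0 ^ ?k f g)"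
        by (simp only: diff_0_right)
      then show ?thesis using B by linarith
    qed
  qed
  have card: "real (card \<Phi>) = real m ^ s" by (simp add: \<Phi>_def card_block_choices)
  have inner: "(\<Sum>g\<in>\<Phi>. B1 + B2 * (x ^ ?k f g - 0 ^ ?k f g)) =
      (B1 + B2 * ((1 - 1 / real m + x / real m) ^ s - (1 - 1 / real m) ^ s)) * real m ^ s" if "f \<in> \<Phi>" for f
  proof -
    have "(1 - 1 / real m + x / real m) * real m = real m - 1 + x" "(1 - 1 / real m) * real m = real m - 1 + 0"
      using sm by (simp_all add: field_simps)
    then have 1: "(1 - 1 / real m + x / real m) ^ s * real m ^ s = (real m - 1 + x) ^ s"
      "(1 - 1 / real m) ^ s * real m ^ s = (real m - 1 + 0) ^ s"
      by (simp_all only: power_mult_distrib [symmetric])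
    have "(\<Sum>g\<in>\<Phi>. B1 + B2 * (x ^ ?k f g - 0 ^ ?k f g)) =
       real (card \<Phi>) * B1 + B2 * ((\<Sum>g\<in>\<Phi>. x ^ ?k f g) - (\<Sum>g\<in>\<Phi>. 0 ^ ?k f g))"
      by (simp add: sum.distrib sum_distrib_left [symmetric] sum_subtractf)
    also have "\<dots> = real m ^ s * B1 + B2 * ((real m - 1 + x) ^ s - (real m - 1 + 0) ^ s)"
      using sum_block_overlap[OF that[unfolded \<Phi>_def]] by (simp only: card) (simp only: \<Phi>_def)
    finally show ?thesis unfolding 1 [symmetric] by (simp add: algebra_simps)
  qed
  have "(\<Sum>f\<in>\<Phi>. \<Sum>g\<in>\<Phi>. \<integral>e. trunc_lr n a (a - h) v (block_support s m f) e *
            trunc_lr n a (a - h) v (block_support s m g) e \<partial>noise n) \<le>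
      (\<Sum>f\<in>\<Phi>. \<Sum>g\<in>\<Phi>. B1 + B2 * (x ^ ?k f g - 0 ^ ?k f g))"
    by (intro sum_mono each)
  also have "\<dots> = (\<Sum>f\<in>\<Phi>. (B1 + B2 * ((1 - 1 / real m + x / real m) ^ s - (1 - 1 / real m) ^ s)) * real m ^ s)"
    by (intro sum.cong refl inner)
  also have "\<dots> = (B1 + B2 * ((1 - 1 / real m + x / real m) ^ s - (1 - 1 / real m) ^ s)) * (real (card \<Phi>))\<^sup>2"
    by (simp add: card power2_eq_square)
  finally show ?thesis unfolding B1_def B2_def .
qed

lemma fixed_design_lower_bound:
  fixes F :: "(nat \<Rightarrow> real) \<Rightarrow> real"
  assumes F: "F \<in> borel_measurable (vecM n)"
    and F01: "\<And>e. e \<in> space (vecM n) \<Longrightarrow> 0 \<le> F e \<and> F e \<le> 1"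
    and v: "near_orth n p d v" and s: "1 \<le> s" and sm: "s * m \<le> p" "0 < m"
    and a: "0 \<le> a" and h: "0 \<le> h" and d: "0 \<le> d" and \<epsilon>: "0 \<le> \<epsilon>"
    and oc: "orthant_close s \<epsilon> \<delta>" "orthant_close (2 * s) \<epsilon> \<delta>"
    and \<delta>: "d \<le> \<delta>" "h + 2 * real s * a * d \<le> \<delta>"
    and asym: "exp (a\<^sup>2 * (real s * real s * d)) * ((1 / 2) ^ (2 * s) + \<epsilon>) +
        exp (3 * (a\<^sup>2 * (real s * real s * d))) *
          ((1 - 1 / real m + exp (a\<^sup>2 / 2 - a * h) / real m) ^ s - (1 - 1 / real m) ^ s)
        \<le> (1 / 2) ^ (2 * s) + \<epsilon>'"
  shows "(1 / 2) ^ s - 2 * \<epsilon> - \<epsilon>' / 2 \<le> (\<integral>e. F e \<partial>noise n) +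
    (\<Sum>f\<in>block_choices s m. \<integral>e. 1 - F (\<lambda>i\<in>{..<n}. mean_shift a v (block_support s m f) i + e i) \<partial>noise n) / real m ^ s"
proof -
  have q: "(1 / 2 :: real) ^ s \<le> 1 / 2" using s power_decreasing[of 1 s "1 / 2 :: real"] by simp
  have q2: "((1 / 2 :: real) ^ s)\<^sup>2 = (1 / 2) ^ (2 * s)" by (simp add: power_mult [symmetric] mult.commute)
  have card: "real (card (block_choices s m)) = real m ^ s" by (simp add: card_block_choices)
  have ne: "block_choices s m \<noteq> {}" using sm card_block_choices[of s m] by force
  have "(1 / 2) ^ s - 2 * \<epsilon> - \<epsilon>' / 2 \<le> (\<integral>e. F e \<partial>noise n) +
    (\<Sum>f\<in>block_choices s m. \<integral>e. 1 - F (\<lambda>i\<in>{..<n}. mean_shift a v (block_support s m f) i + e i) \<partial>noise n) / real (card (block_choices s m))"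
  proof (rule bayes_lower_bound[OF F F01 finite_block_choices ne _ a _ q \<epsilon>, where t = "a - h"])
    fix f assume f: "f \<in> block_choices s m"
    note S = block_support_props[OF f sm(1)]
    show "finite (block_support s m f)" by (rule S)
    have "a * (real s * d) \<le> 2 * real s * a * d" using a d by simp
    then have "h + a * (real s * d) \<le> \<delta>" using \<delta> by linarith
    from mean_shift_orthant[OF v S a h d oc(1) \<delta>(1) this]
    show "(1 / 2) ^ s - \<epsilon> \<le> (\<integral>e. trunc_lr n a (a - h) v (block_support s m f) e \<partial>noise n)"
      unfolding integral_trunc_lr[OF S(1)] by linarith
  next
    have "h + a * (real (2 * s) * d) \<le> \<delta>" using \<delta>(2) by (simp add: mult_ac)
    from second_moment_blocks[OF v sm a h d \<epsilon> oc(2) \<delta>(1) this]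
    show "(\<Sum>f\<in>block_choices s m. \<Sum>g\<in>block_choices s m. \<integral>e. trunc_lr n a (a - h) v (block_support s m f) e *
            trunc_lr n a (a - h) v (block_support s m g) e \<partial>noise n)
      \<le> (((1 / 2) ^ s)\<^sup>2 + \<epsilon>') * (real (card (block_choices s m)))\<^sup>2"
      unfolding q2 by (rule order_trans) (intro mult_right_mono asym, simp)
  qed auto
  then show ?thesis unfolding card .
qed

section \<open>Concentration of the Gram matrix\<close>

lemma abs_power_le_1_plus_power4:
  fixes x :: real
  assumes "k \<le> 4"
  shows "\<bar>x\<bar> ^ k \<le> 1 + x ^ 4"
proof (cases "\<bar>x\<bar> \<le> 1")
  case True
  then have "\<bar>x\<bar> ^ k \<le> 1" by (simp add: power_le_one)
  then show ?thesis by (smt (verit) zero_le_even_power even_numeral)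
next
  case False
  then have "\<bar>x\<bar> ^ k \<le> \<bar>x\<bar> ^ 4" using assms by (intro power_increasing) auto
  then show ?thesis by simp
qed

lemma (in prob_space) integrable_power_le_4:
  fixes f :: "'a \<Rightarrow> real"
  assumes [measurable]: "f \<in> borel_measurable M" and i: "integrable M (\<lambda>x. f x ^ 4)" and k: "k \<le> 4"
  shows "integrable M (\<lambda>x. f x ^ k)"
proof (rule Bochner_Integration.integrable_bound)
  show "integrable M (\<lambda>x. 1 + f x ^ 4)" using i by simp
  show "AE x in M. norm (f x ^ k) \<le> norm (1 + f x ^ 4)"
    using abs_power_le_1_plus_power4[OF k, of "f _"] by (auto simp: power_abs intro!: AE_I2)
qed measurable

lemma (in prob_space) expectation_square_le_power4:
  fixes f :: "'a \<Rightarrow> real"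
  assumes [measurable]: "f \<in> borel_measurable M" and i: "integrable M (\<lambda>x. f x ^ 4)"
  shows "expectation (\<lambda>x. (f x)\<^sup>2) \<le> 1 + expectation (\<lambda>x. f x ^ 4)"
proof -
  have "expectation (\<lambda>x. (f x)\<^sup>2) \<le> expectation (\<lambda>x. 1 + f x ^ 4)"
    using integrable_power_le_4[OF assms, of 2] i abs_power_le_1_plus_power4[of 2 "f _"]
    by (intro integral_mono) auto
  then show ?thesis using i by (simp add: prob_space)
qed

text \<open>Induction on the index set: by independence and centring all mixed terms of odd degree
  drop out, and only \<open>6 E Y^2 E S^2\<close> remains. This is why the mean and the second
  moment are carried along in the induction.\<close>

lemma (in prob_space) fourth_moment_sum_le:
  fixes Y :: "'i \<Rightarrow> 'a \<Rightarrow> real"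
  assumes "finite I" and "indep_vars (\<lambda>_. borel) Y I"
    and "\<And>i. i \<in> I \<Longrightarrow> integrable M (\<lambda>x. Y i x ^ 4)"
    and "\<And>i. i \<in> I \<Longrightarrow> expectation (Y i) = 0"
    and "\<And>i. i \<in> I \<Longrightarrow> expectation (\<lambda>x. Y i x ^ 4) \<le> C" and C: "0 \<le> C"
  shows "integrable M (\<lambda>x. (\<Sum>i\<in>I. Y i x) ^ 4) \<and> expectation (\<lambda>x. \<Sum>i\<in>I. Y i x) = 0 \<and>
    expectation (\<lambda>x. (\<Sum>i\<in>I. Y i x)\<^sup>2) \<le> real (card I) * (1 + C) \<and>
    expectation (\<lambda>x. (\<Sum>i\<in>I. Y i x) ^ 4) \<le> (real (card I))\<^sup>2 * (6 * (1 + C)\<^sup>2)"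
  using assms(1-5)
proof (induction I rule: finite_induct)
  case empty
  then show ?case by simp
next
  case (insert i I)
  define S where "S x = (\<Sum>i\<in>I. Y i x)" for x
  define N where "N = real (card I)"
  have ind: "indep_vars (\<lambda>_. borel) Y I" using insert.prems(1) by (rule indep_vars_subset) auto
  have Ym [measurable]: "Y j \<in> borel_measurable M" if "j \<in> insert i I" for j
    using insert.prems(1) that by (auto simp: indep_vars_def)
  have Sm [measurable]: "S \<in> borel_measurable M" unfolding S_def [abs_def] using Ym by measurable
  have IH: "integrable M (\<lambda>x. S x ^ 4)" "expectation S = 0" "expectation (\<lambda>x. (S x)\<^sup>2) \<le> N * (1 + C)"
    "expectation (\<lambda>x. S x ^ 4) \<le> N\<^sup>2 * (6 * (1 + C)\<^sup>2)"
    using insert.IH[OF ind insert.prems(2-4)] by (auto simp: S_def [abs_def] N_def)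
  have Y4: "integrable M (\<lambda>x. Y i x ^ 4)" "expectation (\<lambda>x. Y i x ^ 4) \<le> C" "expectation (Y i) = 0"
    using insert.prems by auto
  have Y2: "expectation (\<lambda>x. (Y i x)\<^sup>2) \<le> 1 + C"
    using expectation_square_le_power4[OF _ Y4(1)] Y4(2) by fastforce
  have YS: "indep_var borel (Y i) borel S"
    unfolding S_def [abs_def] by (rule indep_vars_sum[OF insert.hyps insert.prems(1)])
  have iY: "integrable M (\<lambda>x. Y i x ^ k)" if "k \<le> 4" for k
    using integrable_power_le_4[OF _ Y4(1) that] by simp
  have iS: "integrable M (\<lambda>x. S x ^ k)" if "k \<le> 4" for k
    using integrable_power_le_4[OF Sm IH(1) that] .
  have ind_pow: "indep_var borel (\<lambda>x. Y i x ^ k) borel (\<lambda>x. S x ^ l)" for k l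
    using indep_var_compose[OF YS, of "\<lambda>y. y ^ k" borel "\<lambda>y. y ^ l" borel] by (simp add: comp_def)
  have mix: "integrable M (\<lambda>x. Y i x ^ k * S x ^ l)"
    "expectation (\<lambda>x. Y i x ^ k * S x ^ l) = expectation (\<lambda>x. Y i x ^ k) * expectation (\<lambda>x. S x ^ l)"
    if "k \<le> 4" "l \<le> 4" for k l
    using indep_var_integrable[OF ind_pow iY[OF that(1)] iS[OF that(2)]]
      indep_var_lebesgue_integral[OF ind_pow iY[OF that(1)] iS[OF that(2)]] by auto
  have sum_eq: "(\<Sum>j\<in>insert i I. Y j x) = Y i x + S x" for x
    using insert.hyps by (simp add: S_def)
  have m: "integrable M (\<lambda>x. Y i x * S x)" "expectation (\<lambda>x. Y i x * S x) = 0"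
    "integrable M (\<lambda>x. Y i x ^ 3 * S x)" "expectation (\<lambda>x. Y i x ^ 3 * S x) = 0"
    "integrable M (\<lambda>x. Y i x * S x ^ 3)" "expectation (\<lambda>x. Y i x * S x ^ 3) = 0"
    using mix[of 1 1] mix[of 3 1] mix[of 1 3] IH(2) Y4(3) by simp_all
  have pow2: "(Y i x + S x)\<^sup>2 = (Y i x)\<^sup>2 + 2 * (Y i x * S x) + (S x)\<^sup>2" for x
    by (simp add: power2_eq_square algebra_simps)
  have pow4: "(Y i x + S x) ^ 4 = Y i x ^ 4 + 4 * (Y i x ^ 3 * S x) + 6 * ((Y i x)\<^sup>2 * (S x)\<^sup>2)
     + 4 * (Y i x * S x ^ 3) + S x ^ 4" for x
    by (simp add: power4_eq_xxxx power3_eq_cube power2_eq_square algebra_simps)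
  have E2: "expectation (\<lambda>x. (Y i x + S x)\<^sup>2) = expectation (\<lambda>x. (Y i x)\<^sup>2) + expectation (\<lambda>x. (S x)\<^sup>2)"
    unfolding pow2 by (simp add: m iY iS)
  have E4: "expectation (\<lambda>x. (Y i x + S x) ^ 4) = expectation (\<lambda>x. Y i x ^ 4) +
      6 * (expectation (\<lambda>x. (Y i x)\<^sup>2) * expectation (\<lambda>x. (S x)\<^sup>2)) + expectation (\<lambda>x. S x ^ 4)"
    unfolding pow4 by (simp add: m mix iY iS)
  have i4: "integrable M (\<lambda>x. (Y i x + S x) ^ 4)"
    unfolding pow4 by (intro Bochner_Integration.integrable_add integrable_mult_right mix m iY iS) auto
  have E1: "expectation (\<lambda>x. Y i x + S x) = 0"
    using iY[of 1] iS[of 1] IH(2) Y4(3) by simp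
  have cardI: "real (card (insert i I)) = N + 1" using insert.hyps by (simp add: N_def)
  have N: "0 \<le> N" by (simp add: N_def)
  have "expectation (\<lambda>x. (Y i x + S x) ^ 4) \<le> C + 6 * ((1 + C) * (N * (1 + C))) + N\<^sup>2 * (6 * (1 + C)\<^sup>2)"
    unfolding E4 using Y4 IH Y2 C N by (intro add_mono mult_left_mono mult_mono) auto
  also have "\<dots> \<le> (1 + C)\<^sup>2 + 6 * ((1 + C) * (N * (1 + C))) + N\<^sup>2 * (6 * (1 + C)\<^sup>2)"
    using C by (simp add: power2_eq_square algebra_simps)
  also have "\<dots> = (6 * N + 1 + 6 * N\<^sup>2) * (1 + C)\<^sup>2"
    by (simp add: power2_eq_square algebra_simps)
  \<comment> \<open>This inequality, \<open>6 N^2 + 6 N + 1 <= 6 (N + 1)^2\<close>, is what makes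
    the constant 6 reproduce itself.\<close>
  also have "\<dots> \<le> (6 * (N + 1)\<^sup>2) * (1 + C)\<^sup>2"
    using N by (intro mult_right_mono zero_le_power2) (simp add: power2_eq_square algebra_simps)
  finally have b4: "expectation (\<lambda>x. (Y i x + S x) ^ 4) \<le> (N + 1)\<^sup>2 * (6 * (1 + C)\<^sup>2)"
    by (simp add: mult_ac)
  have b2: "expectation (\<lambda>x. (Y i x + S x)\<^sup>2) \<le> (N + 1) * (1 + C)"
    unfolding E2 using IH(3) Y2 by (simp add: algebra_simps)
  show ?case unfolding sum_eq cardI using i4 E1 b2 b4 by blast
qed

lemma indep_vars_PiM_components:
  assumes \<nu>: "prob_space \<nu>" and n: "0 < (n :: nat)"
  shows "prob_space.indep_vars (PiM {..<n} (\<lambda>_. \<nu>)) (\<lambda>_. \<nu>) (\<lambda>i X. X i) {..<n}"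
proof -
  let ?M = "PiM {..<n} (\<lambda>_. \<nu>)"
  interpret prob_space ?M by (rule prob_space_PiM) (rule \<nu>)
  have "distr ?M ?M (\<lambda>x. \<lambda>i\<in>{..<n}. x i) = distr ?M ?M (\<lambda>x. x)"
    by (rule distr_cong) (auto simp: space_PiM PiE_restrict)
  also have "\<dots> = PiM {..<n} (\<lambda>i. distr ?M \<nu> (\<lambda>x. x i))"
  proof -
    have "PiM {..<n} (\<lambda>i. distr ?M \<nu> (\<lambda>x. x i)) = ?M"
      by (intro PiM_cong refl distr_PiM_component \<nu>)
    then show ?thesis by simp
  qed
  finally show ?thesis
    using n by (subst indep_vars_iff_distr_eq_PiM') auto
qed

text \<open>Markov's inequality for the fourth power. A variance bound would give only
  \<open>p^2 / (n d^2)\<close> after a union over pairs of columns, which need not vanish when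
  \<open>n\<close> barely exceeds \<open>p (log p)^2\<close>.\<close>

lemma iid_sum_deviation:
  fixes W :: "'a \<Rightarrow> real"
  assumes \<nu>: "prob_space \<nu>" and W [measurable]: "W \<in> borel_measurable \<nu>"
    and W4: "integrable \<nu> (\<lambda>x. W x ^ 4)" "(\<integral>x. W x ^ 4 \<partial>\<nu>) \<le> C" and W0: "(\<integral>x. W x \<partial>\<nu>) = 0"
    and n: "0 < n" and t: "0 < t"
  shows "measure (PiM {..<n} (\<lambda>_. \<nu>)) {X \<in> space (PiM {..<n} (\<lambda>_. \<nu>)). t \<le> \<bar>\<Sum>i<n. W (X i)\<bar>}
    \<le> (real n)\<^sup>2 * (6 * (1 + C)\<^sup>2) / t ^ 4"
proof -
  let ?M = "PiM {..<n} (\<lambda>_. \<nu>)"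
  interpret prob_space ?M by (rule prob_space_PiM) (rule \<nu>)
  have comp: "distr ?M \<nu> (\<lambda>X. X i) = \<nu>" if "i < n" for i
    using that \<nu> by (intro distr_PiM_component) auto
  have transfer: "(\<integral>X. f (X i) \<partial>?M) = (\<integral>x. f x \<partial>\<nu>)" "integrable ?M (\<lambda>X. f (X i)) \<longleftrightarrow> integrable \<nu> f"
    if "i < n" and [measurable]: "f \<in> borel_measurable \<nu>" for f :: "'a \<Rightarrow> real" and i
    using integral_distr[of "\<lambda>X. X i" ?M \<nu> f] integrable_distr_eq[of "\<lambda>X. X i" ?M \<nu> f] that comp[OF that(1)] by auto
  have ind: "indep_vars (\<lambda>_. borel) (\<lambda>i X. W (X i)) {..<n}"
    by (rule indep_vars_compose2[OF indep_vars_PiM_components[OF \<nu> n]]) (rule W)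
  have C: "0 \<le> C" using W4(2) by (rule order_trans[rotated]) simp
  have main: "integrable ?M (\<lambda>X. (\<Sum>i<n. W (X i)) ^ 4)"
    "expectation (\<lambda>X. (\<Sum>i<n. W (X i)) ^ 4) \<le> (real n)\<^sup>2 * (6 * (1 + C)\<^sup>2)"
    using fourth_moment_sum_le[OF _ ind _ _ _ C] W4 W0 transfer(1)[of _ "\<lambda>x. W x ^ 4"] transfer(2)[of _ "\<lambda>x. W x ^ 4"]
      transfer(1)[of _ W] by auto
  have "{X \<in> space ?M. t \<le> \<bar>\<Sum>i<n. W (X i)\<bar>} = {X \<in> space ?M. t ^ 4 \<le> (\<Sum>i<n. W (X i)) ^ 4}"
  proof (intro Collect_cong conj_cong refl)
    fix X :: "nat \<Rightarrow> 'a"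
    have "t ^ 4 \<le> \<bar>\<Sum>i<n. W (X i)\<bar> ^ 4 \<longleftrightarrow> t \<le> \<bar>\<Sum>i<n. W (X i)\<bar>"
      using t by (intro power_mono_iff) auto
    then show "t \<le> \<bar>\<Sum>i<n. W (X i)\<bar> \<longleftrightarrow> t ^ 4 \<le> (\<Sum>i<n. W (X i)) ^ 4" by simp
  qed
  then have "measure ?M {X \<in> space ?M. t \<le> \<bar>\<Sum>i<n. W (X i)\<bar>} \<le> expectation (\<lambda>X. (\<Sum>i<n. W (X i)) ^ 4) / t ^ 4"
    using t integral_Markov_inequality_measure[OF main(1), of "{}" "t ^ 4"] by simp
  also have "\<dots> \<le> (real n)\<^sup>2 * (6 * (1 + C)\<^sup>2) / t ^ 4"
    using main(2) t by (intro divide_right_mono) auto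
  finally show ?thesis .
qed

text \<open>Raise \<open>y <= exp y\<close> with \<open>y = \<bar>x\<bar> / 8\<close> to the eighth
  power. Fourth moments of products of two coordinates need eighth moments, which this reads off
  from the moment generating function at 1 and -1.\<close>

lemma power8_le_exp:
  fixes x :: real
  shows "x ^ 8 \<le> 8 ^ 8 * (exp x + exp (- x))"
proof -
  have "\<bar>x\<bar> / 8 \<le> exp (\<bar>x\<bar> / 8)" using exp_ge_add_one_self[of "\<bar>x\<bar> / 8"] by linarith
  then have "(\<bar>x\<bar> / 8) ^ 8 \<le> exp (\<bar>x\<bar> / 8) ^ 8" by (intro power_mono) auto
  also have "\<dots> = exp \<bar>x\<bar>" by (simp flip: exp_of_nat_mult)
  also have "\<dots> \<le> exp x + exp (- x)" by (cases "0 \<le> x") auto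
  finally show ?thesis by (simp add: power_divide field_simps)
qed

definition design_good :: "nat \<Rightarrow> nat \<Rightarrow> real \<Rightarrow> (nat \<Rightarrow> nat \<Rightarrow> real) \<Rightarrow> bool" where
  "design_good n p d X \<longleftrightarrow> (\<forall>j<p. \<forall>k<p. \<bar>gram n X j k / real n - (if j = k then 1 else 0)\<bar> \<le> d)"

lemma measurable_matM_component [measurable]:
  assumes "i < n" "j < p" shows "(\<lambda>X. X i j) \<in> borel_measurable (matM n p)"
proof -
  have "(\<lambda>X. X i) \<in> measurable (matM n p) (vecM p)"
    unfolding matM_def using assms by (intro measurable_component_singleton) auto
  from measurable_compose[OF this measurable_vecM_component[OF assms(2)]] show ?thesis .
qed

lemma measurable_gram [measurable]:
  "j < p \<Longrightarrow> k < p \<Longrightarrow> (\<lambda>X. gram n X j k) \<in> borel_measurable (matM n p)"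
  unfolding gram_def by measurable

lemma sets_design_good [measurable]: "{X \<in> space (matM n p). design_good n p d X} \<in> sets (matM n p)"
  unfolding design_good_def by measurable

lemma subG_design_basic:
  assumes "subG_design \<sigma> n p \<mu>"
  shows "prob_space \<mu>" "sets \<mu> = sets (matM n p)"
proof -
  from assms obtain \<nu> where \<nu>: "prob_space \<nu>" "sets \<nu> = sets (vecM p)" "\<mu> = PiM {..<n} (\<lambda>_. \<nu>)"
    unfolding subG_design_def by blast
  show "prob_space \<mu>" unfolding \<nu> by (rule prob_space_PiM) (rule \<nu>)
  show "sets \<mu> = sets (matM n p)" unfolding \<nu> matM_def by (intro sets_PiM_cong) (auto simp: \<nu>)
qed

text \<open>Each entry of the normalized Gram matrix minus the identity is an average of centred
  i.i.d. variables \<open>W\<close>, to which \<open>iid_sum_deviation\<close> applies, followed by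
  a union over the \<open>p^2\<close> entries. The constant \<open>C\<close> bounds the fourth
  moment of \<open>W\<close>: 8 from removing the centring, the rest from
  \<open>power8_le_exp\<close> with the sub-Gaussian bound at 1 and -1.\<close>

lemma subG_design_good:
  assumes design: "subG_design \<sigma> n p \<mu>" and n: "0 < n" and d: "0 < d"
  defines "C \<equiv> 8 * (2 * 8 ^ 8 * exp (\<sigma> / 2) + 1)"
  shows "1 - (real p)\<^sup>2 * (6 * (1 + C)\<^sup>2) / ((real n)\<^sup>2 * d ^ 4)
    \<le> measure \<mu> {X \<in> space \<mu>. design_good n p d X}"
proof -
  from design obtain \<nu> where \<nu>: "prob_space \<nu>" "sets \<nu> = sets (vecM p)" "\<mu> = PiM {..<n} (\<lambda>_. \<nu>)"
    and iso: "\<And>j k. j < p \<Longrightarrow> k < p \<Longrightarrow> integrable \<nu> (\<lambda>x. x j * x k) \<and> (\<integral>x. x j * x k \<partial>\<nu>) = (if j = k then 1 else 0)"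
    and sub: "\<And>u t. (\<Sum>j<p. (u j)\<^sup>2) = 1 \<Longrightarrow> integrable \<nu> (\<lambda>x. exp (t * (\<Sum>j<p. u j * x j))) \<and>
       ln (\<integral>x. exp (t * (\<Sum>j<p. u j * x j)) \<partial>\<nu>) \<le> \<sigma> * t\<^sup>2 / 2"
    unfolding subG_design_def by blast
  interpret \<nu>: prob_space \<nu> by (rule \<nu>)
  interpret \<mu>: prob_space \<mu> by (rule subG_design_basic[OF design])
  have sets_\<nu> [measurable_cong]: "sets \<nu> = sets (vecM p)" by (rule \<nu>)
  have sets_\<mu> [measurable_cong]: "sets \<mu> = sets (matM n p)" by (rule subG_design_basic[OF design])
  have space_\<mu>: "space \<mu> = space (matM n p)" by (rule sets_eq_imp_space_eq) (rule sets_\<mu>)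
  have mgf: "integrable \<nu> (\<lambda>x. exp (t * x j))" "(\<integral>x. exp (t * x j) \<partial>\<nu>) \<le> exp (\<sigma> * t\<^sup>2 / 2)" if "j < p" for j t
  proof -
    define u where "u i = (if i = j then 1 else 0 :: real)" for i
    have u: "(\<Sum>i<p. (u i)\<^sup>2) = 1" "(\<Sum>i<p. u i * x i) = x j" for x
      using that by (simp_all add: u_def if_distrib if_distribR cong: if_cong)
    from sub[OF u(1), of t] show "integrable \<nu> (\<lambda>x. exp (t * x j))" unfolding u by simp
    from sub[OF u(1), of t] have "ln (\<integral>x. exp (t * x j) \<partial>\<nu>) \<le> \<sigma> * t\<^sup>2 / 2" unfolding u by simp
    \<comment> \<open>The logarithmic hypothesis can be exponentiated only for a positive integral;
      for the value 0 the claimed bound is trivial.\<close>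
    moreover have "0 \<le> (\<integral>x. exp (t * x j) \<partial>\<nu>)" by simp
    ultimately show "(\<integral>x. exp (t * x j) \<partial>\<nu>) \<le> exp (\<sigma> * t\<^sup>2 / 2)"
      by (metis exp_ge_zero exp_le_cancel_iff exp_ln order_le_less)
  qed
  have cosh: "integrable \<nu> (\<lambda>x. 8 ^ 8 * (exp (x j) + exp (- x j)))"
    "(\<integral>x. 8 ^ 8 * (exp (x j) + exp (- x j)) \<partial>\<nu>) \<le> 2 * 8 ^ 8 * exp (\<sigma> / 2)" if "j < p" for j
    using mgf[OF that, of 1] mgf[OF that, of "-1"] by auto
  have dev: "measure \<mu> {X \<in> space \<mu>. real n * d \<le> \<bar>\<Sum>i<n. X i j * X i k - (if j = k then 1 else 0)\<bar>}
      \<le> (real n)\<^sup>2 * (6 * (1 + C)\<^sup>2) / (real n * d) ^ 4" if jk: "j < p" "k < p" for j k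
  proof -
    define W where "W x = x j * x k - (if j = k then 1 else 0 :: real)" for x :: "nat \<Rightarrow> real"
    have Wm [measurable]: "W \<in> borel_measurable \<nu>"
      unfolding W_def [abs_def] using jk by measurable
    have bnd: "W x ^ 4 \<le> 8 * ((8 ^ 8 * (exp (x j) + exp (- x j)) + 8 ^ 8 * (exp (x k) + exp (- x k))) / 2 + 1)" for x
    proof -
      \<comment> \<open>The inequality \<open>(u - c)^2 <= 2 (u^2 + c^2)\<close> is used twice, once
        more for squares; \<open>c\<close> is the diagonal or off-diagonal value of the identity
        matrix.\<close>
      have "(u - c) ^ 4 \<le> 8 * (u ^ 4 + 1)" if "c = 0 \<or> c = 1" for u c :: real
      proof -
        have "(u - c)\<^sup>2 \<le> 2 * (u\<^sup>2 + c\<^sup>2)"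
          using zero_le_power2[of "u + c"] by (simp add: power2_eq_square algebra_simps)
        then have "((u - c)\<^sup>2)\<^sup>2 \<le> (2 * (u\<^sup>2 + c\<^sup>2))\<^sup>2" by (intro power_mono) auto
        also have "\<dots> \<le> 8 * ((u\<^sup>2)\<^sup>2 + (c\<^sup>2)\<^sup>2)"
          using zero_le_power2[of "u\<^sup>2 - c\<^sup>2"] by (simp add: power2_eq_square algebra_simps)
        also have "\<dots> \<le> 8 * ((u\<^sup>2)\<^sup>2 + 1)" using that by auto
        finally show ?thesis by simp
      qed
      from this[of "if j = k then 1 else 0" "x j * x k"]
      have 1: "W x ^ 4 \<le> 8 * ((x j * x k) ^ 4 + 1)" by (simp add: W_def)
      have "2 * (x j ^ 4 * x k ^ 4) \<le> x j ^ 8 + x k ^ 8"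
        using zero_le_power2[of "x j ^ 4 - x k ^ 4"] by (simp add: power2_diff flip: power_mult)
      then have "(x j * x k) ^ 4 \<le> (x j ^ 8 + x k ^ 8) / 2" by (simp add: power_mult_distrib)
      with 1 power8_le_exp[of "x j"] power8_le_exp[of "x k"] show ?thesis by argo
    qed
    let ?b = "\<lambda>x. 8 * ((8 ^ 8 * (exp (x j) + exp (- x j)) + 8 ^ 8 * (exp (x k) + exp (- x k))) / 2 + (1 :: real))"
    have ib: "integrable \<nu> ?b"
      using mgf(1)[OF jk(1), of 1] mgf(1)[OF jk(1), of "-1"] mgf(1)[OF jk(2), of 1] mgf(1)[OF jk(2), of "-1"]
      by (intro integrable_mult_right Bochner_Integration.integrable_add integrable_divide \<nu>.integrable_const) auto
    have i4: "integrable \<nu> (\<lambda>x. W x ^ 4)"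
      by (rule Bochner_Integration.integrable_bound[OF ib]) (use bnd in \<open>auto intro!: AE_I2 intro: order_trans[OF _ abs_ge_self]\<close>)
    have "(\<integral>x. W x ^ 4 \<partial>\<nu>) \<le> (\<integral>x. ?b x \<partial>\<nu>)" by (rule integral_mono[OF i4 ib bnd])
    also have "\<dots> = 8 * (((\<integral>x. 8 ^ 8 * (exp (x j) + exp (- x j)) \<partial>\<nu>) + (\<integral>x. 8 ^ 8 * (exp (x k) + exp (- x k)) \<partial>\<nu>)) / 2 + 1)"
      using cosh(1)[OF jk(1)] cosh(1)[OF jk(2)]
      by (simp only: integral_mult_right_zero integral_divide_zero Bochner_Integration.integral_add
          integrable_divide Bochner_Integration.integrable_add \<nu>.integrable_const lebesgue_integral_const \<nu>.prob_space) simp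
    also have "\<dots> \<le> C" unfolding C_def using cosh(2)[OF jk(1)] cosh(2)[OF jk(2)] by simp
    finally have W4: "(\<integral>x. W x ^ 4 \<partial>\<nu>) \<le> C" .
    have W0: "(\<integral>x. W x \<partial>\<nu>) = 0"
      unfolding W_def using iso[OF jk] by (simp add: \<nu>.prob_space)
    from iid_sum_deviation[OF \<nu>(1) Wm i4 W4 W0 n, of "real n * d"] n d
    show ?thesis by (simp add: \<nu>(3) W_def)
  qed
  let ?B = "\<lambda>j k. {X \<in> space \<mu>. real n * d \<le> \<bar>\<Sum>i<n. X i j * X i k - (if j = k then 1 else 0)\<bar>}"
  have Bm: "?B j k \<in> sets \<mu>" if "j < p" "k < p" for j k using that by measurable
  have sub: "space \<mu> - {X \<in> space \<mu>. design_good n p d X} \<subseteq> (\<Union>(j, k)\<in>{..<p} \<times> {..<p}. ?B j k)"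
  proof
    fix X assume "X \<in> space \<mu> - {X \<in> space \<mu>. design_good n p d X}"
    then obtain j k where jk: "j < p" "k < p" "X \<in> space \<mu>" and
      "\<not> \<bar>gram n X j k / real n - (if j = k then 1 else 0)\<bar> \<le> d"
      by (auto simp: design_good_def)
    moreover have "(\<Sum>i<n. X i j * X i k - (if j = k then 1 else 0)) = real n * (gram n X j k / real n - (if j = k then 1 else 0))"
      using n by (simp add: gram_def sum_subtractf right_diff_distrib)
    ultimately have "X \<in> ?B j k" using n by (simp add: abs_mult)
    then have "X \<in> (case (j, k) of (j, k) \<Rightarrow> ?B j k)" by (simp only: prod.case)
    moreover have "(j, k) \<in> {..<p} \<times> {..<p}" using jk by simp
    ultimately show "X \<in> (\<Union>(j, k)\<in>{..<p} \<times> {..<p}. ?B j k)" by (rule UN_I[rotated])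
  qed
  have good: "{X \<in> space \<mu>. design_good n p d X} \<in> sets \<mu>"
    using sets_design_good[of n p d] by (simp add: space_\<mu> sets_\<mu>)
  have "measure \<mu> (space \<mu> - {X \<in> space \<mu>. design_good n p d X}) \<le> measure \<mu> (\<Union>(j, k)\<in>{..<p} \<times> {..<p}. ?B j k)"
    using Bm by (intro \<mu>.finite_measure_mono sub sets.finite_UN) auto
  also have "\<dots> \<le> (\<Sum>(j, k)\<in>{..<p} \<times> {..<p}. measure \<mu> (?B j k))"
    unfolding case_prod_beta
  proof (rule \<mu>.finite_measure_subadditive_finite)
    show "(\<lambda>x. ?B (fst x) (snd x)) ` ({..<p} \<times> {..<p}) \<subseteq> sets \<mu>"
      by (intro image_subsetI Bm) auto
  qed simp
  also have "\<dots> \<le> (\<Sum>(j, k)\<in>{..<p} \<times> {..<p}. (real n)\<^sup>2 * (6 * (1 + C)\<^sup>2) / (real n * d) ^ 4)"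
    by (rule sum_mono) (use dev in auto)
  also have "\<dots> = (real p)\<^sup>2 * (6 * (1 + C)\<^sup>2) / ((real n)\<^sup>2 * d ^ 4)"
    using n d by (simp add: power_mult_distrib power2_eq_square power4_eq_xxxx field_simps)
  finally show ?thesis using \<mu>.prob_compl[OF good] by linarith
qed

section \<open>Risk bounds for random designs\<close>

definition design_col :: "nat \<Rightarrow> (nat \<Rightarrow> nat \<Rightarrow> real) \<Rightarrow> nat \<Rightarrow> nat \<Rightarrow> real" where
  "design_col n X j i = X i j / sqrt (real n)"

lemma ip_design_col: "ip n (design_col n X j) (design_col n X k) = gram n X j k / real n"
  by (simp add: ip_def design_col_def gram_def sum_divide_distrib)

lemma near_orth_design_col_iff: "near_orth n p d (design_col n X) \<longleftrightarrow> design_good n p d X"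
  by (simp add: near_orth_def design_good_def ip_design_col)

definition response :: "nat \<Rightarrow> nat \<Rightarrow> (nat \<Rightarrow> nat \<Rightarrow> real) \<Rightarrow> (nat \<Rightarrow> real) \<Rightarrow> (nat \<Rightarrow> real) \<Rightarrow> nat \<Rightarrow> real" where
  "response n p X \<beta> e = (\<lambda>i\<in>{..<n}. (\<Sum>j<p. X i j * \<beta> j) + e i)"

lemma measurable_response:
  assumes [measurable_cong]: "sets \<mu> = sets (matM n p)"
  shows "(\<lambda>(X, e). (response n p X \<beta> e, X)) \<in> measurable (\<mu> \<Otimes>\<^sub>M noise n) (obsM n p)"
proof -
  have "(\<lambda>z. response n p (fst z) \<beta> (snd z)) \<in> measurable (\<mu> \<Otimes>\<^sub>M noise n) (vecM n)"
    unfolding response_def vecM_def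
  proof (rule measurable_restrict)
    fix i assume "i \<in> {..<n}"
    then have i: "i < n" by simp
    have "(\<lambda>z. fst z i j) \<in> borel_measurable (\<mu> \<Otimes>\<^sub>M noise n)" if "j < p" for j
      by (rule measurable_compose[OF _ measurable_matM_component[OF i that]]) measurable
    moreover have "(\<lambda>z. snd z i) \<in> borel_measurable (\<mu> \<Otimes>\<^sub>M noise n)"
      by (rule measurable_compose[OF _ measurable_vecM_component[OF i]]) measurable
    ultimately show "(\<lambda>z. (\<Sum>j<p. fst z i j * \<beta> j) + snd z i) \<in> borel_measurable (\<mu> \<Otimes>\<^sub>M noise n)"
      by (intro borel_measurable_add borel_measurable_sum borel_measurable_times) auto
  qed
  moreover have "fst \<in> measurable (\<mu> \<Otimes>\<^sub>M noise n) (matM n p)" by measurable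
  ultimately show ?thesis
    unfolding obsM_def by (simp add: case_prod_beta measurable_Pair)
qed

lemma law_eq: "law n p \<mu> \<beta> = distr (\<mu> \<Otimes>\<^sub>M noise n) (obsM n p) (\<lambda>(X, e). (response n p X \<beta> e, X))"
  by (simp add: law_def response_def)

lemma prob_space_law:
  assumes "prob_space \<mu>" "sets \<mu> = sets (matM n p)"
  shows "prob_space (law n p \<mu> \<beta>)"
  unfolding law_eq
  by (intro prob_space.prob_space_distr prob_space_pair assms prob_space_noise measurable_response)

lemma sets_law [measurable_cong, simp]: "sets (law n p \<mu> \<beta>) = sets (obsM n p)"
  by (simp add: law_def)

lemma space_law [simp]: "space (law n p \<mu> \<beta>) = space (obsM n p)"
  by (simp add: law_def)

lemma integrable_law_bounded:
  fixes f :: "_ \<Rightarrow> real"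
  assumes "prob_space \<mu>" "sets \<mu> = sets (matM n p)"
    and [measurable]: "f \<in> borel_measurable (obsM n p)" and f: "\<And>z. z \<in> space (obsM n p) \<Longrightarrow> \<bar>f z\<bar> \<le> B"
  shows "integrable (law n p \<mu> \<beta>) f"
proof -
  interpret prob_space "law n p \<mu> \<beta>" by (rule prob_space_law) fact+
  show ?thesis by (rule integrable_const_bound[of _ B]) (auto simp: f intro!: AE_I2)
qed

text \<open>Fubini for the independent pair of design and noise: every error probability is an
  average over designs of an integral for a fixed design.\<close>

lemma integral_law:
  fixes f :: "_ \<Rightarrow> real"
  assumes \<mu>: "prob_space \<mu>" "sets \<mu> = sets (matM n p)"
    and f [measurable]: "f \<in> borel_measurable (obsM n p)" and B: "\<And>z. z \<in> space (obsM n p) \<Longrightarrow> \<bar>f z\<bar> \<le> B"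
  shows "(\<integral>z. f z \<partial>law n p \<mu> \<beta>) = (\<integral>X. (\<integral>e. f (response n p X \<beta> e, X) \<partial>noise n) \<partial>\<mu>)"
    and "integrable \<mu> (\<lambda>X. \<integral>e. f (response n p X \<beta> e, X) \<partial>noise n)"
proof -
  interpret M: prob_space \<mu> by fact
  interpret N: prob_space "noise n" by (rule prob_space_noise)
  interpret P: pair_prob_space \<mu> "noise n" ..
  note meas [measurable] = measurable_response[OF \<mu>(2), of \<beta>]
  have fm: "(\<lambda>(X, e). f (response n p X \<beta> e, X)) \<in> borel_measurable (\<mu> \<Otimes>\<^sub>M noise n)"
    using measurable_compose[OF meas f] by (simp add: case_prod_beta)
  have int: "integrable (\<mu> \<Otimes>\<^sub>M noise n) (\<lambda>(X, e). f (response n p X \<beta> e, X))"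
  proof (rule P.integrable_const_bound[of _ B])
    show "AE z in \<mu> \<Otimes>\<^sub>M noise n. norm (case z of (X, e) \<Rightarrow> f (response n p X \<beta> e, X)) \<le> B"
      using measurable_space[OF meas] B by (intro AE_I2) (force simp: case_prod_beta)
  qed (rule fm)
  have "(\<integral>z. f z \<partial>law n p \<mu> \<beta>) = (\<integral>(X, e). f (response n p X \<beta> e, X) \<partial>(\<mu> \<Otimes>\<^sub>M noise n))"
    unfolding law_eq by (subst integral_distr[OF meas f], rule Bochner_Integration.integral_cong) auto
  also have "\<dots> = (\<integral>X. (\<integral>e. f (response n p X \<beta> e, X) \<partial>noise n) \<partial>\<mu>)"
    using P.integral_fst'[OF int] by simp
  finally show "(\<integral>z. f z \<partial>law n p \<mu> \<beta>) = (\<integral>X. (\<integral>e. f (response n p X \<beta> e, X) \<partial>noise n) \<partial>\<mu>)" .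
  show "integrable \<mu> (\<lambda>X. \<integral>e. f (response n p X \<beta> e, X) \<partial>noise n)"
    using P.integrable_fst'[OF int] by simp
qed

text \<open>Bad designs cost at most \<open>\<eta>\<close>. It is used for conditional error
  probabilities of the scan test, and in the lower bound for one minus a conditional Bayes
  risk.\<close>

lemma (in prob_space) integral_good_le:
  assumes g: "integrable M g" and G [measurable]: "{x \<in> space M. Q x} \<in> sets M" and pG: "1 - \<eta> \<le> prob {x \<in> space M. Q x}"
    and le: "\<And>x. x \<in> space M \<Longrightarrow> Q x \<Longrightarrow> g x \<le> B" and le1: "\<And>x. x \<in> space M \<Longrightarrow> g x \<le> 1" and B: "0 \<le> B"
  shows "(\<integral>x. g x \<partial>M) \<le> B + (\<eta> :: real)"
proof -
  let ?C = "space M - {x \<in> space M. Q x}"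
  have iC: "integrable M (indicator ?C :: _ \<Rightarrow> real)"
    by (rule integrable_real_indicator) (auto simp: less_top [symmetric])
  have "(\<integral>x. g x \<partial>M) \<le> (\<integral>x. B + indicator ?C x \<partial>M)"
  proof (rule integral_mono[OF g])
    from iC show "integrable M (\<lambda>x. B + indicator ?C x)" by simp
    show "g x \<le> B + indicator ?C x" if "x \<in> space M" for x
      using le[OF that] le1[OF that] B that by (cases "Q x") auto
  qed
  also have "\<dots> = B + prob ?C" using iC by (simp add: prob_space Int_absorb2)
  also have "\<dots> \<le> B + \<eta>" using pG prob_compl[OF G] by simp
  finally show ?thesis .
qed

section \<open>Error probabilities of the scan test under a random design\<close>

definition scan_test :: "nat \<Rightarrow> nat \<Rightarrow> real \<Rightarrow> (nat \<Rightarrow> real) \<times> (nat \<Rightarrow> nat \<Rightarrow> real) \<Rightarrow> real" where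
  "scan_test n p t = (\<lambda>(y, X). of_bool (\<exists>j<p. t < \<bar>ip n (design_col n X j) y\<bar>))"

lemma measurable_scan_test [measurable]: "scan_test n p t \<in> borel_measurable (obsM n p)"
proof -
  have "(\<lambda>z. ip n (design_col n (snd z) j) (fst z)) \<in> borel_measurable (obsM n p)" if j: "j < p" for j
    unfolding ip_def design_col_def
  proof (intro borel_measurable_sum borel_measurable_times borel_measurable_divide)
    fix i assume "i \<in> {..<n}"
    then have i: "i < n" by simp
    show "(\<lambda>z. snd z i j) \<in> borel_measurable (obsM n p)"
      unfolding obsM_def by (rule measurable_compose[OF measurable_snd measurable_matM_component[OF i j]])
    show "(\<lambda>z. fst z i) \<in> borel_measurable (obsM n p)"
      unfolding obsM_def by (rule measurable_compose[OF measurable_fst measurable_vecM_component[OF i]])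
  qed auto
  then have [measurable]: "Measurable.pred (obsM n p) (\<lambda>z. t < \<bar>ip n (design_col n (snd z) j) (fst z)\<bar>)" if "j < p" for j
    using that by measurable
  show ?thesis unfolding scan_test_def case_prod_beta by measurable
qed

lemma ip_design_col_response:
  assumes n: "0 < n" and S: "S \<subseteq> {..<p}" and \<beta>: "\<And>j. j < p \<Longrightarrow> j \<notin> S \<Longrightarrow> \<beta> j = 0"
  shows "ip n (design_col n X j) (response n p X \<beta> e) =
    (\<Sum>k\<in>S. (sqrt (real n) * \<beta> k) * ip n (design_col n X j) (design_col n X k)) + ip n (design_col n X j) e"
proof -
  have "ip n (design_col n X j) (response n p X \<beta> e) =
      ip n (design_col n X j) (\<lambda>i. (\<Sum>k<p. (sqrt (real n) * \<beta> k) * design_col n X k i) + e i)"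
    unfolding response_def ip_restrict using n by (simp add: design_col_def mult_ac)
  also have "\<dots> = (\<Sum>k<p. (sqrt (real n) * \<beta> k) * ip n (design_col n X j) (design_col n X k)) + ip n (design_col n X j) e"
    unfolding ip_add_right ip_sum_right ip_scale_right ..
  also have "(\<Sum>k<p. (sqrt (real n) * \<beta> k) * ip n (design_col n X j) (design_col n X k)) =
      (\<Sum>k\<in>S. (sqrt (real n) * \<beta> k) * ip n (design_col n X j) (design_col n X k))"
    using S \<beta> by (intro sum.mono_neutral_right) auto
  finally show ?thesis .
qed

lemma scan_risk_null:
  assumes \<mu>: "prob_space \<mu>" "sets \<mu> = sets (matM n p)" and n: "0 < n"
    and pG: "1 - \<eta> \<le> measure \<mu> {X \<in> space \<mu>. design_good n p d X}" and t: "0 \<le> t"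
  shows "(\<integral>z. scan_test n p t z \<partial>law n p \<mu> (\<lambda>_. 0)) \<le> 2 * real p * exp (d * t\<^sup>2 / 2 - t\<^sup>2 / 2) + \<eta>"
proof -
  interpret M: prob_space \<mu> by fact
  interpret N: prob_space "noise n" by (rule prob_space_noise)
  have space_\<mu>: "space \<mu> = space (matM n p)" by (rule sets_eq_imp_space_eq) fact
  have b: "\<bar>scan_test n p t z\<bar> \<le> 1" for z by (simp add: scan_test_def case_prod_beta)
  note I = integral_law[OF \<mu> measurable_scan_test b, where \<beta> = "\<lambda>_. 0"]
  have inner: "(\<integral>e. scan_test n p t (response n p X (\<lambda>_. 0) e, X) \<partial>noise n) =
      measure (noise n) {e \<in> space (noise n). \<exists>j<p. \<bar>ip n (design_col n X j) e\<bar> > t}" for X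
  proof -
    have "(\<integral>e. scan_test n p t (response n p X (\<lambda>_. 0) e, X) \<partial>noise n) =
      (\<integral>e. indicator {e \<in> space (noise n). \<exists>j<p. \<bar>ip n (design_col n X j) e\<bar> > t} e \<partial>noise n)"
      by (intro Bochner_Integration.integral_cong) (auto simp: scan_test_def response_def indicator_def)
    then show ?thesis by (simp add: Int_absorb2)
  qed
  show ?thesis unfolding I(1)
  proof (rule M.integral_good_le[OF I(2) _ pG])
    fix X assume "design_good n p d X"
    then show "(\<integral>e. scan_test n p t (response n p X (\<lambda>_. 0) e, X) \<partial>noise n) \<le> 2 * real p * exp (d * t\<^sup>2 / 2 - t\<^sup>2 / 2)"
      unfolding inner near_orth_design_col_iff[symmetric] by (rule scan_null_bound[OF _ t])
  qed (auto simp: inner space_\<mu> \<mu>(2))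
qed

lemma scan_risk_alternative:
  assumes \<mu>: "prob_space \<mu>" "sets \<mu> = sets (matM n p)" and n: "0 < n"
    and pG: "1 - \<eta> \<le> measure \<mu> {X \<in> space \<mu>. design_good n p d X}"
    and \<beta>: "\<beta> \<in> Xi p s (a / sqrt (real n))"
    and a: "0 < a" and h: "0 \<le> h" "h \<le> a / 4" and d: "0 \<le> d" "d \<le> 1" "(real s + 1) * d \<le> 1 / 4"
    and oc: "orthant_close s \<epsilon> \<delta>" and \<epsilon>: "0 \<le> \<epsilon>" and \<delta>: "d \<le> \<delta>" "h + 2 * real s * a * d \<le> \<delta>"
    and big: "2 * exp (1 - a / 4) \<le> (1 / 2) ^ s + \<epsilon>"
  shows "(\<integral>z. 1 - scan_test n p (a + h) z \<partial>law n p \<mu> \<beta>) \<le> (1 / 2) ^ s + \<epsilon> + \<eta>"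
proof -
  interpret M: prob_space \<mu> by fact
  interpret N: prob_space "noise n" by (rule prob_space_noise)
  have space_\<mu>: "space \<mu> = space (matM n p)" by (rule sets_eq_imp_space_eq) fact
  define S where "S = {j. j < p \<and> \<beta> j \<noteq> 0}"
  have S: "finite S" "S \<subseteq> {..<p}" "card S = s" using \<beta> by (auto simp: S_def Xi_def)
  define b where "b j = sqrt (real n) * \<beta> j" for j
  have b: "a \<le> \<bar>b j\<bar>" if "j \<in> S" for j
  proof -
    have "a / sqrt (real n) \<le> \<bar>\<beta> j\<bar>" using \<beta> that by (auto simp: S_def Xi_def)
    then show ?thesis using n by (simp add: b_def abs_mult divide_le_eq mult.commute)
  qed
  have m: "(\<lambda>z. 1 - scan_test n p (a + h) z) \<in> borel_measurable (obsM n p)" by measurable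
  have le1: "\<bar>1 - scan_test n p (a + h) z\<bar> \<le> 1" for z by (simp add: scan_test_def case_prod_beta)
  note I = integral_law[OF \<mu> m le1, where \<beta> = \<beta>]
  have inner: "(\<integral>e. 1 - scan_test n p (a + h) (response n p X \<beta> e, X) \<partial>noise n) \<le>
      measure (noise n) {e \<in> space (noise n). \<forall>j\<in>S. \<bar>(\<Sum>k\<in>S. b k * ip n (design_col n X j) (design_col n X k)) + ip n (design_col n X j) e\<bar> \<le> a + h}"
    (is "_ \<le> measure _ ?E") for X
  proof -
    have eq: "ip n (design_col n X j) (response n p X \<beta> e) =
      (\<Sum>k\<in>S. b k * ip n (design_col n X j) (design_col n X k)) + ip n (design_col n X j) e" for j e
      unfolding b_def by (rule ip_design_col_response[OF n S(2)]) (auto simp: S_def)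
    have "?E \<in> sets (noise n)" using S by measurable
    then have "(\<integral>e. indicator ?E e \<partial>noise n) = measure (noise n) ?E" by (simp add: Int_absorb2)
    moreover have "(\<integral>e. 1 - scan_test n p (a + h) (response n p X \<beta> e, X) \<partial>noise n) \<le> (\<integral>e. indicator ?E e \<partial>noise n)"
    proof (rule integral_mono)
      show "integrable (noise n) (\<lambda>e. 1 - scan_test n p (a + h) (response n p X \<beta> e, X))"
        unfolding scan_test_def prod.case eq by (rule N.integrable_const_bound[of _ 1]) auto
      show "integrable (noise n) (indicator ?E :: _ \<Rightarrow> real)"
        using \<open>?E \<in> sets (noise n)\<close> by (rule integrable_real_indicator) (simp add: less_top [symmetric])
      show "1 - scan_test n p (a + h) (response n p X \<beta> e, X) \<le> indicator ?E e" if e: "e \<in> space (noise n)" for e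
      proof (cases "e \<in> ?E")
        case False
        then obtain j where "j \<in> S" "a + h < \<bar>(\<Sum>k\<in>S. b k * ip n (design_col n X j) (design_col n X k)) + ip n (design_col n X j) e\<bar>"
          using e by auto
        then have "scan_test n p (a + h) (response n p X \<beta> e, X) = 1"
          using S(2) unfolding scan_test_def prod.case eq by auto
        then show ?thesis by simp
      qed (use le1 in \<open>simp add: abs_le_iff\<close>)
    qed
    ultimately show ?thesis by simp
  qed
  show ?thesis unfolding I(1)
  proof (rule M.integral_good_le[OF I(2) _ pG])
    fix X assume "design_good n p d X"
    then have "near_orth n p d (design_col n X)" by (simp only: near_orth_design_col_iff)
    then show "(\<integral>e. 1 - scan_test n p (a + h) (response n p X \<beta> e, X) \<partial>noise n) \<le> (1 / 2) ^ s + \<epsilon>"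
      by (intro order_trans[OF inner] scan_miss_bound[OF _ S _ a h d oc \<delta> big] b)
  next
    show "(\<integral>e. 1 - scan_test n p (a + h) (response n p X \<beta> e, X) \<partial>noise n) \<le> 1" for X
      by (rule order_trans[OF inner N.prob_le_1])
  qed (use \<epsilon> in \<open>auto simp: space_\<mu> \<mu>(2)\<close>)
qed

section \<open>From single tests to the minimax risk\<close>

lemma tests_bounds: "T \<in> tests n p \<Longrightarrow> z \<in> space (obsM n p) \<Longrightarrow> 0 \<le> T z \<and> T z \<le> 1"
  by (simp add: tests_def)

lemma integral_type_II_bounds:
  assumes \<mu>: "prob_space \<mu>" "sets \<mu> = sets (matM n p)" and T: "T \<in> tests n p"
  shows "0 \<le> (\<integral>z. 1 - T z \<partial>law n p \<mu> \<beta>)" "(\<integral>z. 1 - T z \<partial>law n p \<mu> \<beta>) \<le> 1"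
proof -
  interpret L: prob_space "law n p \<mu> \<beta>" by (rule prob_space_law[OF \<mu>])
  have i: "integrable (law n p \<mu> \<beta>) (\<lambda>z. 1 - T z)"
    by (rule integrable_law_bounded[OF \<mu>, of _ 1]) (use T in \<open>auto simp: tests_def\<close>)
  show "0 \<le> (\<integral>z. 1 - T z \<partial>law n p \<mu> \<beta>)"
    using tests_bounds[OF T] by (intro Bochner_Integration.integral_nonneg) simp
  show "(\<integral>z. 1 - T z \<partial>law n p \<mu> \<beta>) \<le> 1"
    using tests_bounds[OF T] by (intro L.integral_le_const[OF i]) (auto intro!: AE_I2)
qed

text \<open>Error probabilities are at most 1, so the real supremum in the risk is over a bounded
  set and dominates each of its members.\<close>

lemma risk_test_ge:
  assumes \<mu>: "prob_space \<mu>" "sets \<mu> = sets (matM n p)" and T: "T \<in> tests n p" and \<beta>: "\<beta> \<in> Xi p s A"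
  shows "(\<integral>z. T z \<partial>law n p \<mu> (\<lambda>_. 0)) + (\<integral>z. 1 - T z \<partial>law n p \<mu> \<beta>) \<le> risk_test n p \<mu> T s A"
  unfolding risk_test_def
  using integral_type_II_bounds(2)[OF \<mu> T] by (intro add_left_mono cSUP_upper \<beta> bdd_aboveI[of _ 1]) auto

text \<open>The risk of the scan test at threshold \<open>a + h\<close> bounds the infimum. Suprema
  and infima are taken in the reals, so the signal class has to be nonempty and the risks bounded
  below before the lattice rules apply.\<close>

lemma minimax_risk_upper:
  assumes \<mu>: "prob_space \<mu>" "sets \<mu> = sets (matM n p)" and n: "0 < n" and Xi: "Xi p s (a / sqrt (real n)) \<noteq> {}"
    and pG: "1 - \<eta> \<le> measure \<mu> {X \<in> space \<mu>. design_good n p d X}"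
    and a: "0 < a" and h: "0 \<le> h" "h \<le> a / 4" and d: "0 \<le> d" "d \<le> 1" "(real s + 1) * d \<le> 1 / 4"
    and oc: "orthant_close s \<epsilon> \<delta>" and \<epsilon>: "0 \<le> \<epsilon>" and \<delta>: "d \<le> \<delta>" "h + 2 * real s * a * d \<le> \<delta>"
    and big: "2 * exp (1 - a / 4) \<le> (1 / 2) ^ s + \<epsilon>"
    and null: "2 * real p * exp (d * (a + h)\<^sup>2 / 2 - (a + h)\<^sup>2 / 2) \<le> \<epsilon>"
  shows "minimax_risk n p \<mu> s (a / sqrt (real n)) \<le> (1 / 2) ^ s + 2 * \<epsilon> + 2 * \<eta>"
proof -
  have T: "scan_test n p (a + h) \<in> tests n p"
    by (simp add: tests_def measurable_scan_test) (simp add: scan_test_def case_prod_beta)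
  have bdd: "bdd_below ((\<lambda>T. risk_test n p \<mu> T s (a / sqrt (real n))) ` tests n p)"
  proof (rule bdd_belowI2[of _ 0])
    fix T assume T: "T \<in> tests n p"
    obtain \<beta> where \<beta>: "\<beta> \<in> Xi p s (a / sqrt (real n))" using Xi by blast
    have "0 \<le> (\<integral>z. T z \<partial>law n p \<mu> (\<lambda>_. 0))"
      using tests_bounds[OF T] by (intro Bochner_Integration.integral_nonneg) simp
    then show "0 \<le> risk_test n p \<mu> T s (a / sqrt (real n))"
      using risk_test_ge[OF \<mu> T \<beta>] integral_type_II_bounds(1)[OF \<mu> T, of \<beta>] by linarith
  qed
  have "minimax_risk n p \<mu> s (a / sqrt (real n)) \<le> risk_test n p \<mu> (scan_test n p (a + h)) s (a / sqrt (real n))"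
    unfolding minimax_risk_def by (rule cINF_lower[OF bdd T])
  also have "\<dots> \<le> (\<epsilon> + \<eta>) + ((1 / 2) ^ s + \<epsilon> + \<eta>)"
    unfolding risk_test_def
  proof (rule add_mono)
    show "(\<integral>z. scan_test n p (a + h) z \<partial>law n p \<mu> (\<lambda>_. 0)) \<le> \<epsilon> + \<eta>"
      using scan_risk_null[OF \<mu> n pG, of "a + h"] a h null by linarith
    show "(SUP \<beta>\<in>Xi p s (a / sqrt (real n)). \<integral>z. 1 - scan_test n p (a + h) z \<partial>law n p \<mu> \<beta>) \<le> (1 / 2) ^ s + \<epsilon> + \<eta>"
      by (rule cSUP_least[OF Xi]) (rule scan_risk_alternative[OF \<mu> n pG _ a h d oc \<epsilon> \<delta> big])
  qed
  finally show ?thesis by simp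
qed

definition block_signal :: "nat \<Rightarrow> nat \<Rightarrow> real \<Rightarrow> (nat \<Rightarrow> nat) \<Rightarrow> nat \<Rightarrow> real" where
  "block_signal s m A f j = (if j \<in> block_support s m f then A else 0)"

lemma block_signal_in_Xi:
  assumes f: "f \<in> block_choices s m" and sm: "s * m \<le> p" and A: "0 < A"
  shows "block_signal s m A f \<in> Xi p s A"
proof -
  note S = block_support_props[OF f sm]
  have "{j. j < p \<and> block_signal s m A f j \<noteq> 0} = block_support s m f"
    using S A by (auto simp: block_signal_def)
  then show ?thesis using S A by (auto simp: Xi_def block_signal_def)
qed

lemma response_block_signal:
  assumes f: "f \<in> block_choices s m" and sm: "s * m \<le> p"
  shows "response n p X (block_signal s m (a / sqrt (real n)) f) e =
    (\<lambda>i\<in>{..<n}. mean_shift a (design_col n X) (block_support s m f) i + e i)"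
proof -
  note S = block_support_props[OF f sm]
  have "(\<Sum>j<p. X i j * block_signal s m (a / sqrt (real n)) f j) = mean_shift a (design_col n X) (block_support s m f) i" for i
  proof -
    have "(\<Sum>j<p. X i j * block_signal s m (a / sqrt (real n)) f j) =
        (\<Sum>j\<in>block_support s m f. X i j * block_signal s m (a / sqrt (real n)) f j)"
      using S by (intro sum.mono_neutral_right) (auto simp: block_signal_def)
    also have "\<dots> = (\<Sum>j\<in>block_support s m f. a * design_col n X j i)"
      by (rule sum.cong) (auto simp: block_signal_def design_col_def)
    finally show ?thesis by (simp add: mean_shift_def sum_distrib_left)
  qed
  then show ?thesis by (simp add: response_def)
qed

text \<open>For fixed \<open>X\<close> the section of \<open>T\<close> at \<open>X\<close> is a test
  for a fixed design, to which \<open>fixed_design_lower_bound\<close> applies if the design is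
  good. Averaging over designs gives a bound for the prior average of the type II errors, and the
  worst case dominates this average.\<close>

lemma minimax_risk_lower:
  assumes \<mu>: "prob_space \<mu>" "sets \<mu> = sets (matM n p)" and n: "0 < n"
    and pG: "1 - \<eta> \<le> measure \<mu> {X \<in> space \<mu>. design_good n p d X}"
    and s: "1 \<le> s" and sm: "s * m \<le> p" "0 < m"
    and a: "0 < a" and h: "0 \<le> h" and d: "0 \<le> d" and \<epsilon>: "0 \<le> \<epsilon>" "0 \<le> \<epsilon>'"
    and oc: "orthant_close s \<epsilon> \<delta>" "orthant_close (2 * s) \<epsilon> \<delta>"
    and \<delta>: "d \<le> \<delta>" "h + 2 * real s * a * d \<le> \<delta>"
    and asym: "exp (a\<^sup>2 * (real s * real s * d)) * ((1 / 2) ^ (2 * s) + \<epsilon>) +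
        exp (3 * (a\<^sup>2 * (real s * real s * d))) *
          ((1 - 1 / real m + exp (a\<^sup>2 / 2 - a * h) / real m) ^ s - (1 - 1 / real m) ^ s)
        \<le> (1 / 2) ^ (2 * s) + \<epsilon>'"
  shows "(1 / 2) ^ s - 2 * \<epsilon> - \<epsilon>' / 2 - \<eta> \<le> minimax_risk n p \<mu> s (a / sqrt (real n))"
  unfolding minimax_risk_def
proof (rule cINF_greatest)
  have "(\<lambda>_. 0) \<in> tests n p" by (simp add: tests_def)
  then show "tests n p \<noteq> {}" by blast
next
  fix T assume T: "T \<in> tests n p"
  interpret M: prob_space \<mu> by fact
  have space_\<mu>: "space \<mu> = space (matM n p)" by (rule sets_eq_imp_space_eq) fact
  define A where "A = a / sqrt (real n)"
  define \<Phi> where "\<Phi> = block_choices s m"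
  define N where "N = real m ^ s"
  define b where "b = (1 / 2 :: real) ^ s - 2 * \<epsilon> - \<epsilon>' / 2"
  have A: "0 < A" using a n by (simp add: A_def)
  have N: "0 < N" using sm by (simp add: N_def)
  have card: "real (card \<Phi>) = N" by (simp add: \<Phi>_def N_def card_block_choices)
  have Tm [measurable]: "T \<in> borel_measurable (obsM n p)" using T by (simp add: tests_def)
  have b1: "\<bar>T z\<bar> \<le> 1" "\<bar>1 - T z\<bar> \<le> 1" if "z \<in> space (obsM n p)" for z
    using tests_bounds[OF T that] by auto
  have Tm': "(\<lambda>z. 1 - T z) \<in> borel_measurable (obsM n p)" by measurable
  define g0 where "g0 X = (\<integral>e. T (response n p X (\<lambda>_. 0) e, X) \<partial>noise n)" for X
  define g where "g f X = (\<integral>e. 1 - T (response n p X (block_signal s m A f) e, X) \<partial>noise n)" for f X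
  note I0 = integral_law[OF \<mu> Tm b1(1), where \<beta> = "\<lambda>_. 0", folded g0_def]
  have I: "(\<integral>z. 1 - T z \<partial>law n p \<mu> (block_signal s m A f)) = (\<integral>X. g f X \<partial>\<mu>)" "integrable \<mu> (g f)" for f
    unfolding g_def [abs_def] by (rule integral_law[OF \<mu> Tm' b1(2)]; assumption)+
  have pointwise: "b \<le> g0 X + (\<Sum>f\<in>\<Phi>. g f X) / N" if X: "X \<in> space (matM n p)" and good: "design_good n p d X" for X
  proof -
    have "near_orth n p d (design_col n X)" using good by (simp only: near_orth_design_col_iff)
    moreover have "(\<lambda>y. T (y, X)) \<in> borel_measurable (vecM n)"
      by (rule measurable_compose[OF measurable_Pair2'[OF X] Tm[unfolded obsM_def]])
    moreover have "0 \<le> T (y, X) \<and> T (y, X) \<le> 1" if "y \<in> space (vecM n)" for y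
      using tests_bounds[OF T, of "(y, X)"] X that by (simp add: obsM_def space_pair_measure)
    ultimately have "b \<le> (\<integral>e. T (e, X) \<partial>noise n) +
        (\<Sum>f\<in>\<Phi>. \<integral>e. 1 - T (\<lambda>i\<in>{..<n}. mean_shift a (design_col n X) (block_support s m f) i + e i, X) \<partial>noise n) / N"
      unfolding b_def N_def \<Phi>_def using a
      by (intro fixed_design_lower_bound[OF _ _ _ s sm _ h d \<epsilon>(1) oc \<delta> asym]) auto
    also have "(\<integral>e. T (e, X) \<partial>noise n) = g0 X"
      unfolding g0_def
    proof (rule Bochner_Integration.integral_cong [OF refl])
      fix e assume "e \<in> space (noise n)"
      then have "response n p X (\<lambda>_. 0) e = e"
        by (auto simp: response_def vecM_def space_PiM PiE_restrict)
      then show "T (e, X) = T (response n p X (\<lambda>_. 0) e, X)" by simp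
    qed
    also have "(\<Sum>f\<in>\<Phi>. \<integral>e. 1 - T (\<lambda>i\<in>{..<n}. mean_shift a (design_col n X) (block_support s m f) i + e i, X) \<partial>noise n) = (\<Sum>f\<in>\<Phi>. g f X)"
      unfolding g_def A_def \<Phi>_def
      by (rule sum.cong [OF refl]) (simp only: response_block_signal[OF _ sm(1)])
    finally show ?thesis .
  qed
  have g_nonneg: "0 \<le> g0 X" "0 \<le> g f X" if X: "X \<in> space (matM n p)" for f X
  proof -
    have sp: "(response n p X \<beta> e, X) \<in> space (obsM n p)" if "e \<in> space (noise n)" for \<beta> e
      using X by (auto simp: obsM_def space_pair_measure vecM_def space_PiM response_def)
    show "0 \<le> g0 X" unfolding g0_def
      by (rule Bochner_Integration.integral_nonneg) (use tests_bounds[OF T sp] in blast)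
    show "0 \<le> g f X" unfolding g_def
    proof (rule Bochner_Integration.integral_nonneg)
      fix e assume "e \<in> space (noise n)"
      from tests_bounds[OF T sp[OF this]]
      show "0 \<le> 1 - T (response n p X (block_signal s m A f) e, X)" by simp
    qed
  qed
  have iG: "integrable \<mu> (\<lambda>X. g0 X + (\<Sum>f\<in>\<Phi>. g f X) / N)"
    using I0(2) I(2) by (intro Bochner_Integration.integrable_add integrable_divide Bochner_Integration.integrable_sum) auto
  \<comment> \<open>\<open>integral_good_le\<close> gives upper bounds, so it is applied to one
    minus the conditional Bayes risk; nonnegativity of that risk gives the bound 1 on bad
    designs.\<close>
  have "(\<integral>X. 1 - (g0 X + (\<Sum>f\<in>\<Phi>. g f X) / N) \<partial>\<mu>) \<le> (1 - b) + \<eta>"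
  proof (rule M.integral_good_le[OF _ _ pG])
    show "integrable \<mu> (\<lambda>X. 1 - (g0 X + (\<Sum>f\<in>\<Phi>. g f X) / N))" using iG by simp
    show "{X \<in> space \<mu>. design_good n p d X} \<in> sets \<mu>" by (simp add: space_\<mu> \<mu>(2))
    show "1 - (g0 X + (\<Sum>f\<in>\<Phi>. g f X) / N) \<le> 1 - b" if "X \<in> space \<mu>" "design_good n p d X" for X
      using pointwise[OF that[unfolded space_\<mu>]] by linarith
    show "1 - (g0 X + (\<Sum>f\<in>\<Phi>. g f X) / N) \<le> 1" if "X \<in> space \<mu>" for X
    proof -
      have "0 \<le> (\<Sum>f\<in>\<Phi>. g f X) / N"
        using N by (intro divide_nonneg_pos sum_nonneg g_nonneg that[unfolded space_\<mu>])
      then show ?thesis using g_nonneg(1)[OF that[unfolded space_\<mu>]] by linarith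
    qed
    have "(1 / 2 :: real) ^ s \<le> 1" by (rule power_le_one) auto
    then show "0 \<le> 1 - b" using \<epsilon> by (simp add: b_def)
  qed
  also have "(\<integral>X. 1 - (g0 X + (\<Sum>f\<in>\<Phi>. g f X) / N) \<partial>\<mu>) = 1 - (\<integral>X. g0 X + (\<Sum>f\<in>\<Phi>. g f X) / N \<partial>\<mu>)"
    using iG by (simp add: M.prob_space)
  finally have "b - \<eta> \<le> (\<integral>X. g0 X + (\<Sum>f\<in>\<Phi>. g f X) / N \<partial>\<mu>)" by simp
  also have "\<dots> = (\<integral>z. T z \<partial>law n p \<mu> (\<lambda>_. 0)) + (\<Sum>f\<in>\<Phi>. \<integral>z. 1 - T z \<partial>law n p \<mu> (block_signal s m A f)) / N"
    using I0 I by (simp add: Bochner_Integration.integral_add Bochner_Integration.integral_sum)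
  also have "\<dots> \<le> risk_test n p \<mu> T s A"
  proof -
    have "(\<Sum>f\<in>\<Phi>. \<integral>z. 1 - T z \<partial>law n p \<mu> (block_signal s m A f)) \<le>
        (\<Sum>f\<in>\<Phi>. risk_test n p \<mu> T s A - (\<integral>z. T z \<partial>law n p \<mu> (\<lambda>_. 0)))"
    proof (rule sum_mono)
      fix f assume "f \<in> \<Phi>"
      then have "block_signal s m A f \<in> Xi p s A" unfolding \<Phi>_def by (rule block_signal_in_Xi[OF _ sm(1) A])
      from risk_test_ge[OF \<mu> T this]
      show "(\<integral>z. 1 - T z \<partial>law n p \<mu> (block_signal s m A f)) \<le> risk_test n p \<mu> T s A - (\<integral>z. T z \<partial>law n p \<mu> (\<lambda>_. 0))"
        by linarith
    qed
    also have "\<dots> = N * (risk_test n p \<mu> T s A - (\<integral>z. T z \<partial>law n p \<mu> (\<lambda>_. 0)))" by (simp add: card)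
    finally have "(\<Sum>f\<in>\<Phi>. \<integral>z. 1 - T z \<partial>law n p \<mu> (block_signal s m A f)) / N \<le>
        risk_test n p \<mu> T s A - (\<integral>z. T z \<partial>law n p \<mu> (\<lambda>_. 0))"
      using N by (simp add: divide_le_eq mult.commute)
    then show ?thesis by linarith
  qed
  finally show "(1 / 2) ^ s - 2 * \<epsilon> - \<epsilon>' / 2 - \<eta> \<le> risk_test n p \<mu> T s (a / sqrt (real n))"
    unfolding b_def A_def .
qed

section \<open>The limit of the minimax risk\<close>

lemma orthant_close_mono:
  assumes "orthant_close m \<epsilon> \<delta>'" "\<delta> \<le> \<delta>'"
  shows "orthant_close m \<epsilon> \<delta>"
  unfolding orthant_close_def
proof (intro allI impI)
  fix n c \<tau> and S :: "nat set"
  assume hyps: "finite S \<and> card S = m \<and>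
      (\<forall>i\<in>S. \<forall>j\<in>S. \<bar>ip n (c i) (c j) - (if i = j then 1 else 0)\<bar> \<le> \<delta>) \<and> (\<forall>i\<in>S. \<bar>\<tau> i\<bar> \<le> \<delta>)"
  show "\<bar>measure (noise n) {e \<in> space (noise n). \<forall>i\<in>S. ip n (c i) e \<le> \<tau> i} - (1 / 2) ^ m\<bar> < \<epsilon>"
    by (rule assms(1)[unfolded orthant_close_def, rule_format], intro conjI ballI)
      (use hyps in \<open>blast intro: order_trans[OF _ assms(2)]\<close>)+
qed

lemma tendsto_eventually_le:
  fixes f :: "'a \<Rightarrow> real"
  assumes "(f \<longlongrightarrow> l) F" "l < c"
  shows "\<forall>\<^sub>F x in F. f x \<le> c"
  using order_tendstoD(2)[OF assms] by (rule eventually_mono) simp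

text \<open>Since \<open>a h = sqrt a\<close>, the square \<open>(a + h)^2\<close> is at least
  \<open>a^2 + 2 sqrt a\<close>. The part \<open>a^2 / 2\<close> cancels the factor
  \<open>p\<close>, and \<open>sqrt a\<close> remains as the gain from the margin.\<close>

lemma null_bound_simplified:
  fixes a d :: real
  assumes a: "1 \<le> a" and d: "0 \<le> d" and p: "real p = exp (a\<^sup>2 / 2)"
  shows "2 * real p * exp (d * (a + 1 / sqrt a)\<^sup>2 / 2 - (a + 1 / sqrt a)\<^sup>2 / 2) \<le> 2 * exp (2 * (a\<^sup>2 * d) - sqrt a)"
proof -
  define h where "h = 1 / sqrt a"
  have sq: "1 \<le> sqrt a" using a by simp
  have "a * h = sqrt a" using a by (simp add: h_def real_div_sqrt)
  have "h \<le> 1" "0 \<le> h" using sq by (auto simp: h_def divide_le_eq)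
  then have h: "0 \<le> h" "h \<le> a" using a by auto
  have "(a + h)\<^sup>2 \<le> (2 * a)\<^sup>2" using h a by (intro power_mono) auto
  then have 1: "d * (a + h)\<^sup>2 \<le> d * (4 * a\<^sup>2)" using d by (intro mult_left_mono) (auto simp: power_mult_distrib)
  have "(a + h)\<^sup>2 = a\<^sup>2 + 2 * sqrt a + h\<^sup>2"
    using \<open>a * h = sqrt a\<close> by (simp add: power2_sum)
  then have 2: "a\<^sup>2 + 2 * sqrt a \<le> (a + h)\<^sup>2" by simp
  have "a\<^sup>2 / 2 + (d * (a + h)\<^sup>2 / 2 - (a + h)\<^sup>2 / 2) \<le> 2 * (a\<^sup>2 * d) - sqrt a"
    using 1 2 by (simp add: mult_ac)
  then show ?thesis
    unfolding p h_def[symmetric] by (simp add: mult.assoc flip: exp_add)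
qed

text \<open>Common core of the two design classes: all that is used of the design is that its
  normalized Gram matrix is within \<open>d p\<close> of the identity with probability tending to 1,
  where \<open>d p * ln p\<close> tends to 0.\<close>

lemma minimax_risk_tendsto:
  fixes n :: "nat \<Rightarrow> nat" and d :: "nat \<Rightarrow> real"
  assumes s: "1 \<le> s" and n: "filterlim n at_top sequentially"
    and \<mu>: "\<forall>\<^sub>F p in sequentially. prob_space (\<mu> p) \<and> sets (\<mu> p) = sets (matM (n p) p)"
    and d0: "\<forall>\<^sub>F p in sequentially. 0 \<le> d p" and dln: "(\<lambda>p. d p * ln (real p)) \<longlonglongrightarrow> 0"
    and good: "\<And>\<eta>. 0 < \<eta> \<Longrightarrow> \<forall>\<^sub>F p in sequentially.
      1 - \<eta> \<le> measure (\<mu> p) {X \<in> space (\<mu> p). design_good (n p) p (d p) X}"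
  shows "(\<lambda>p. minimax_risk (n p) p (\<mu> p) s (sqrt (2 * ln (real p) / real (n p)))) \<longlonglongrightarrow> (1 / 2) ^ s"
proof (rule LIMSEQ_I)
  fix r :: real assume r: "0 < r"
  \<comment> \<open>With \<open>\<eta> = \<epsilon>\<close> and
    \<open>\<epsilon>' = 2 * \<epsilon>\<close> both the upper and the lower bound deviate by at
    most \<open>4 * \<epsilon>\<close>, which is less than \<open>r\<close>.\<close>
  define \<epsilon> where "\<epsilon> = r / 5"
  have \<epsilon>: "0 < \<epsilon>" using r by (simp add: \<epsilon>_def)
  obtain \<delta>1 where \<delta>1: "0 < \<delta>1" "orthant_close s \<epsilon> \<delta>1" using ex_orthant_close[OF \<epsilon>] by blast
  obtain \<delta>2 where \<delta>2: "0 < \<delta>2" "orthant_close (2 * s) \<epsilon> \<delta>2" using ex_orthant_close[OF \<epsilon>] by blast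
  define \<delta> where "\<delta> = min \<delta>1 \<delta>2"
  have \<delta>: "0 < \<delta>" using \<delta>1 \<delta>2 by (simp add: \<delta>_def)
  have oc: "orthant_close s \<epsilon> \<delta>" "orthant_close (2 * s) \<epsilon> \<delta>"
    by (rule orthant_close_mono[OF \<delta>1(2)], simp add: \<delta>_def) (rule orthant_close_mono[OF \<delta>2(2)], simp add: \<delta>_def)
  define a where "a p = sqrt (2 * ln (real p))" for p :: nat
  \<comment> \<open>The margin has to vanish while \<open>a h\<close> diverges; with this choice
    \<open>a h = sqrt a\<close>.\<close>
  define h where "h p = 1 / sqrt (a p)" for p
  define m where "m p = p div s" for p :: nat

  have ln_top: "filterlim (\<lambda>p. ln (real p)) at_top sequentially"
    by (rule filterlim_compose[OF ln_at_top filterlim_real_sequentially])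
  have a_top: "filterlim a at_top sequentially"
    unfolding a_def [abs_def]
    by (rule filterlim_compose[OF sqrt_at_top filterlim_tendsto_pos_mult_at_top[OF tendsto_const _ ln_top]]) simp
  have sqrt_a_top: "filterlim (\<lambda>p. sqrt (a p)) at_top sequentially"
    by (rule filterlim_compose[OF sqrt_at_top a_top])
  have h_lim: "h \<longlonglongrightarrow> 0"
    unfolding h_def [abs_def] by (rule tendsto_divide_0[OF tendsto_const filterlim_at_top_imp_at_infinity[OF sqrt_a_top]])
  have p1: "\<forall>\<^sub>F p :: nat in sequentially. 1 \<le> p" by (rule eventually_ge_at_top)
  have a2: "(a p)\<^sup>2 = 2 * ln (real p)" if "1 \<le> p" for p
    using that by (simp add: a_def)
  have "(\<lambda>p. 2 * (d p * ln (real p))) \<longlonglongrightarrow> 2 * 0" by (intro tendsto_intros dln)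
  moreover have "\<forall>\<^sub>F p in sequentially. 2 * (d p * ln (real p)) = (a p)\<^sup>2 * d p"
    using p1 by eventually_elim (simp add: a2)
  ultimately have a2d_lim: "(\<lambda>p. (a p)\<^sup>2 * d p) \<longlonglongrightarrow> 0"
    using Lim_transform_eventually by fastforce
  have a1: "\<forall>\<^sub>F p in sequentially. 16 \<le> a p"
    using a_top by (simp add: filterlim_at_top)
  have d_lim: "d \<longlonglongrightarrow> 0"
  proof (rule tendsto_sandwich[OF _ _ tendsto_const a2d_lim])
    show "\<forall>\<^sub>F p in sequentially. d p \<le> (a p)\<^sup>2 * d p"
      using a1 d0
    proof eventually_elim
      case (elim p)
      then have "1 \<le> (a p)\<^sup>2" by (intro one_le_power) simp
      then show ?case using mult_right_mono[of 1 "(a p)\<^sup>2" "d p"] elim by simp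
    qed
  qed (rule d0)
  have ad_lim: "(\<lambda>p. a p * d p) \<longlonglongrightarrow> 0"
  proof (rule tendsto_sandwich[OF _ _ tendsto_const a2d_lim])
    show "\<forall>\<^sub>F p in sequentially. 0 \<le> a p * d p"
      using a1 d0 by eventually_elim simp
    show "\<forall>\<^sub>F p in sequentially. a p * d p \<le> (a p)\<^sup>2 * d p"
      using a1 d0
    proof eventually_elim
      case (elim p)
      then have "a p \<le> (a p)\<^sup>2" by (simp add: power2_eq_square)
      then show ?case using elim by (intro mult_right_mono)
    qed
  qed
  have exp_sqrt: "(\<lambda>p. exp (- sqrt (a p))) \<longlonglongrightarrow> 0"
    by (intro filterlim_compose[OF exp_at_bot] filterlim_compose[OF filterlim_uminus_at_bot_at_top] sqrt_a_top)

  have c_n: "\<forall>\<^sub>F p in sequentially. 0 < n p"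
    by (rule eventually_compose_filterlim[OF eventually_gt_at_top n])
  have c_d: "\<forall>\<^sub>F p in sequentially. d p \<le> min 1 \<delta>"
    using \<delta> by (intro tendsto_eventually_le[OF d_lim]) simp
  have "(\<lambda>p. (real s + 1) * d p) \<longlonglongrightarrow> (real s + 1) * 0" by (intro tendsto_intros d_lim)
  then have c_sd: "\<forall>\<^sub>F p in sequentially. (real s + 1) * d p \<le> 1 / 4"
    by (rule tendsto_eventually_le) simp
  have "(\<lambda>p. h p + 2 * real s * (a p * d p)) \<longlonglongrightarrow> 0 + 2 * real s * 0"
    by (intro tendsto_intros h_lim ad_lim)
  then have "\<forall>\<^sub>F p in sequentially. h p + 2 * real s * (a p * d p) \<le> \<delta>"
    by (rule tendsto_eventually_le) (use \<delta> in simp)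
  then have c_h: "\<forall>\<^sub>F p in sequentially. h p + 2 * real s * a p * d p \<le> \<delta>"
    by (simp only: mult.assoc)
  have "(\<lambda>p. 2 * exp (1 - a p / 4)) \<longlonglongrightarrow> 2 * 0"
  proof (intro tendsto_mult tendsto_const filterlim_compose[OF exp_at_bot])
    have "filterlim (\<lambda>p. - 1 + 1 / 4 * a p) at_top sequentially"
      by (intro filterlim_tendsto_add_at_top[OF tendsto_const] filterlim_tendsto_pos_mult_at_top[OF tendsto_const _ a_top]) simp
    then have "filterlim (\<lambda>p. - (- 1 + 1 / 4 * a p)) at_bot sequentially"
      by (rule filterlim_compose[OF filterlim_uminus_at_bot_at_top])
    then show "filterlim (\<lambda>p. 1 - a p / 4) at_bot sequentially" by simp
  qed
  then have c_big: "\<forall>\<^sub>F p in sequentially. 2 * exp (1 - a p / 4) \<le> (1 / 2) ^ s + \<epsilon>"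
    by (rule tendsto_eventually_le) (use \<epsilon> in \<open>simp add: add_pos_pos\<close>)
  have "(\<lambda>p. 2 * (exp (2 * ((a p)\<^sup>2 * d p)) * exp (- sqrt (a p)))) \<longlonglongrightarrow> 2 * (exp (2 * 0) * 0)"
    by (intro tendsto_intros a2d_lim exp_sqrt)
  then have "\<forall>\<^sub>F p in sequentially. 2 * (exp (2 * ((a p)\<^sup>2 * d p)) * exp (- sqrt (a p))) \<le> \<epsilon>"
    by (rule tendsto_eventually_le) (use \<epsilon> in simp)
  then have c_null: "\<forall>\<^sub>F p in sequentially.
      2 * real p * exp (d p * (a p + h p)\<^sup>2 / 2 - (a p + h p)\<^sup>2 / 2) \<le> \<epsilon>"
    using a1 d0 p1
  proof eventually_elim
    case (elim p)
    have "real p = exp ((a p)\<^sup>2 / 2)" using elim a2[of p] by simp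
    then have "2 * real p * exp (d p * (a p + h p)\<^sup>2 / 2 - (a p + h p)\<^sup>2 / 2) \<le> 2 * exp (2 * ((a p)\<^sup>2 * d p) - sqrt (a p))"
      unfolding h_def using elim by (intro null_bound_simplified) auto
    also have "\<dots> \<le> \<epsilon>" using elim(1) by (simp add: exp_diff exp_minus divide_inverse)
    finally show ?case .
  qed
  have m_top: "filterlim m at_top sequentially"
    unfolding m_def [abs_def] using s by (intro filterlim_at_top_div_const_nat) simp
  have c_m: "\<forall>\<^sub>F p in sequentially. 0 < m p"
    by (rule eventually_compose_filterlim[OF eventually_gt_at_top m_top])
  have m_lim: "(\<lambda>p. 1 / real (m p)) \<longlonglongrightarrow> 0"
    by (rule tendsto_divide_0[OF tendsto_const filterlim_at_top_imp_at_infinity[OF filterlim_compose[OF filterlim_real_sequentially m_top]]])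
  \<comment> \<open>The exponential equals \<open>p * exp (- sqrt (a p))\<close>, and
    \<open>p / m p\<close> is at most \<open>2 s\<close> because the remainder of \<open>p\<close>
    modulo \<open>s\<close> is at most \<open>s * m p\<close>. So the overlap factor is small
    relative to the number of choices per block.\<close>
  have x_lim: "(\<lambda>p. exp ((a p)\<^sup>2 / 2 - a p * h p) / real (m p)) \<longlonglongrightarrow> 0"
  proof (rule tendsto_sandwich[OF _ _ tendsto_const])
    have "(\<lambda>p. 2 * real s * exp (- sqrt (a p))) \<longlonglongrightarrow> 2 * real s * 0" by (intro tendsto_intros exp_sqrt)
    then show "(\<lambda>p. 2 * real s * exp (- sqrt (a p))) \<longlonglongrightarrow> 0" by simp
    show "\<forall>\<^sub>F p in sequentially. 0 \<le> exp ((a p)\<^sup>2 / 2 - a p * h p) / real (m p)" by simp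
    show "\<forall>\<^sub>F p in sequentially. exp ((a p)\<^sup>2 / 2 - a p * h p) / real (m p) \<le> 2 * real s * exp (- sqrt (a p))"
      using a1 p1 c_m
    proof eventually_elim
      case (elim p)
      have "p = m p * s + p mod s" unfolding m_def by simp
      also have "\<dots> \<le> m p * s + m p * s"
      proof (rule add_left_mono)
        have "p mod s \<le> s" using s by simp
        also have "s \<le> m p * s" using elim(3) by simp
        finally show "p mod s \<le> m p * s" .
      qed
      finally have "real p \<le> real (m p * s + m p * s)" by (rule of_nat_mono)
      then have "real p \<le> 2 * real s * real (m p)" by simp
      then have "real p / real (m p) \<le> 2 * real s" using elim by (simp add: divide_le_eq)
      moreover have "exp ((a p)\<^sup>2 / 2 - a p * h p) = real p * exp (- sqrt (a p))"
      proof -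
        have "a p * h p = sqrt (a p)" using elim(1) by (simp add: h_def real_div_sqrt)
        moreover have "(a p)\<^sup>2 / 2 = ln (real p)" using a2[OF elim(2)] by simp
        ultimately have "exp ((a p)\<^sup>2 / 2 - a p * h p) = exp (ln (real p) + - sqrt (a p))" by simp
        also have "\<dots> = real p * exp (- sqrt (a p))" using elim(2) unfolding exp_add by simp
        finally show ?thesis .
      qed
      ultimately show ?case
        using mult_right_mono[of "real p / real (m p)" "2 * real s" "exp (- sqrt (a p))"] by simp
    qed
  qed
  \<comment> \<open>The limit is \<open>(1 / 2)^(2 s) + \<epsilon>\<close>, since the overlap
    bracket tends to \<open>1 - 1\<close>; this leaves a strict gap to
    \<open>(1 / 2)^(2 s) + 2 * \<epsilon>\<close>.\<close>
  have "(\<lambda>p. exp (real s * real s * ((a p)\<^sup>2 * d p)) * ((1 / 2) ^ (2 * s) + \<epsilon>) +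
        exp (3 * (real s * real s * ((a p)\<^sup>2 * d p))) *
          ((1 - 1 / real (m p) + exp ((a p)\<^sup>2 / 2 - a p * h p) / real (m p)) ^ s - (1 - 1 / real (m p)) ^ s)) \<longlonglongrightarrow>
     exp (real s * real s * 0) * ((1 / 2) ^ (2 * s) + \<epsilon>) + exp (3 * (real s * real s * 0)) * ((1 - 0 + 0) ^ s - (1 - 0) ^ s)"
    by (intro tendsto_intros a2d_lim m_lim x_lim)
  then have "\<forall>\<^sub>F p in sequentially. exp (real s * real s * ((a p)\<^sup>2 * d p)) * ((1 / 2) ^ (2 * s) + \<epsilon>) +
        exp (3 * (real s * real s * ((a p)\<^sup>2 * d p))) *
          ((1 - 1 / real (m p) + exp ((a p)\<^sup>2 / 2 - a p * h p) / real (m p)) ^ s - (1 - 1 / real (m p)) ^ s) \<le> (1 / 2) ^ (2 * s) + 2 * \<epsilon>"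
    by (rule tendsto_eventually_le) (use \<epsilon> in simp)
  then have c_asym: "\<forall>\<^sub>F p in sequentially. exp ((a p)\<^sup>2 * (real s * real s * d p)) * ((1 / 2) ^ (2 * s) + \<epsilon>) +
        exp (3 * ((a p)\<^sup>2 * (real s * real s * d p))) *
          ((1 - 1 / real (m p) + exp ((a p)\<^sup>2 / 2 - a p * h p) / real (m p)) ^ s - (1 - 1 / real (m p)) ^ s)
        \<le> (1 / 2) ^ (2 * s) + 2 * \<epsilon>"
    by (simp only: mult_ac)
  have "\<forall>\<^sub>F p in sequentially.
    norm (minimax_risk (n p) p (\<mu> p) s (sqrt (2 * ln (real p) / real (n p))) - (1 / 2) ^ s) < r"
    using \<mu> d0 good[OF \<epsilon>] a1 c_n c_d c_sd c_h c_big c_null c_m c_asym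
  proof eventually_elim
    case (elim p)
    have \<mu>p: "prob_space (\<mu> p)" "sets (\<mu> p) = sets (matM (n p) p)" using elim(1) by auto
    have sm: "s * m p \<le> p" by (simp add: m_def)
    have A: "sqrt (2 * ln (real p) / real (n p)) = a p / sqrt (real (n p))" by (simp add: a_def real_sqrt_divide)
    have a: "0 < a p" using elim(4) by simp
    have "1 \<le> sqrt (a p)" using elim(4) by simp
    then have "h p \<le> 1" "0 \<le> h p" using elim(4) by (auto simp: h_def divide_le_eq)
    then have h: "0 \<le> h p" "h p \<le> a p / 4" using elim(4) by auto
    have "(\<lambda>i\<in>{..<s}. 0) \<in> block_choices s (m p)" using elim(11) by (simp add: block_choices_def)
    then have Xi: "Xi p s (a p / sqrt (real (n p))) \<noteq> {}"
      using block_signal_in_Xi[OF _ sm, of _ "a p / sqrt (real (n p))"] a elim(5) by force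
    have d: "d p \<le> 1" "d p \<le> \<delta>" using elim(6) by auto
    have "minimax_risk (n p) p (\<mu> p) s (a p / sqrt (real (n p))) \<le> (1 / 2) ^ s + 2 * \<epsilon> + 2 * \<epsilon>"
      using \<epsilon> by (intro minimax_risk_upper[OF \<mu>p elim(5) Xi elim(3) a h elim(2) d(1) elim(7) oc(1) _ d(2) elim(8) elim(9) elim(10)]) simp
    moreover have "(1 / 2) ^ s - 2 * \<epsilon> - 2 * \<epsilon> / 2 - \<epsilon> \<le> minimax_risk (n p) p (\<mu> p) s (a p / sqrt (real (n p)))"
      using \<epsilon> by (intro minimax_risk_lower[OF \<mu>p elim(5) elim(3) s sm elim(11) a h(1) elim(2) _ _ oc d(2) elim(8) elim(12)]) simp_all
    ultimately show ?case unfolding A using r by (simp add: \<epsilon>_def abs_less_iff)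
  qed
  then show "\<exists>no. \<forall>p\<ge>no. norm (minimax_risk (n p) p (\<mu> p) s (sqrt (2 * ln (real p) / real (n p))) - (1 / 2) ^ s) < r"
    by (simp add: eventually_sequentially)
qed

lemma orth_design_good:
  assumes "orth_design n p \<mu>" and n: "0 < n"
  shows "measure \<mu> {X \<in> space \<mu>. design_good n p 0 X} = 1"
proof -
  have \<mu>: "prob_space \<mu>" "sets \<mu> = sets (matM n p)"
    and ae: "AE X in \<mu>. \<forall>j<p. \<forall>k<p. gram n X j k = (if j = k then real n else 0)"
    using assms(1) by (auto simp: orth_design_def)
  interpret prob_space \<mu> by fact
  have "space \<mu> = space (matM n p)" by (rule sets_eq_imp_space_eq) fact
  then have "{X \<in> space \<mu>. design_good n p 0 X} \<in> sets \<mu>" by (simp add: \<mu>(2))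
  moreover have "AE X in \<mu>. design_good n p 0 X"
    using ae by eventually_elim (use n in \<open>auto simp: design_good_def\<close>)
  ultimately show ?thesis by (simp add: prob_Collect_eq_1)
qed

lemma subG_deviation_scale:
  fixes n :: "nat \<Rightarrow> nat"
  assumes lim: "filterlim (\<lambda>p. real (n p) / (real p * (ln (real p))\<^sup>2)) at_top sequentially"
    and n: "filterlim n at_top sequentially"
    and design: "\<forall>\<^sub>F p in sequentially. subG_design \<sigma> (n p) p (\<mu> p)"
  obtains d :: "nat \<Rightarrow> real" where "\<forall>\<^sub>F p in sequentially. 0 \<le> d p" "(\<lambda>p. d p * ln (real p)) \<longlonglongrightarrow> 0"
    "\<And>\<eta>. 0 < \<eta> \<Longrightarrow> \<forall>\<^sub>F p in sequentially. 1 - \<eta> \<le> measure (\<mu> p) {X \<in> space (\<mu> p). design_good (n p) p (d p) X}"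
proof -
  define R where "R p = real (n p) / (real p * (ln (real p))\<^sup>2)" for p
  \<comment> \<open>With \<open>R = n / (p (log p)^2)\<close> this choice gives
    \<open>n^2 d^4 = p^2 R\<close>. The failure probability is then at most \<open>K / R\<close>,
    while \<open>d * log p\<close>, the inverse fourth root of \<open>R\<close>, still tends to
    0.\<close>
  define d where "d p = 1 / (ln (real p) * sqrt (sqrt (R p)))" for p
  define K where "K = 6 * (1 + 8 * (2 * 8 ^ 8 * exp (\<sigma> / 2) + 1))\<^sup>2"
  have R_top: "filterlim R at_top sequentially" using lim by (simp add: R_def [abs_def])
  have R1: "\<forall>\<^sub>F p in sequentially. 1 \<le> R p" using R_top by (simp add: filterlim_at_top)
  have p2: "\<forall>\<^sub>F p :: nat in sequentially. 2 \<le> p" by (rule eventually_ge_at_top)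
  have c_n: "\<forall>\<^sub>F p in sequentially. 0 < n p"
    by (rule eventually_compose_filterlim[OF eventually_gt_at_top n])
  have d_pos: "\<forall>\<^sub>F p in sequentially. 0 < d p"
    using R1 p2 by eventually_elim (simp add: d_def)
  have "(\<lambda>p. 1 / sqrt (sqrt (R p))) \<longlonglongrightarrow> 0"
    by (intro tendsto_divide_0[OF tendsto_const] filterlim_at_top_imp_at_infinity
        filterlim_compose[OF sqrt_at_top] R_top)
  moreover have "\<forall>\<^sub>F p in sequentially. 1 / sqrt (sqrt (R p)) = d p * ln (real p)"
    using p2 by eventually_elim (simp add: d_def)
  ultimately have dln: "(\<lambda>p. d p * ln (real p)) \<longlonglongrightarrow> 0"
    by (rule Lim_transform_eventually)
  have KR: "(\<lambda>p. K / R p) \<longlonglongrightarrow> 0"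
    by (rule tendsto_divide_0[OF tendsto_const filterlim_at_top_imp_at_infinity[OF R_top]])
  show thesis
  proof (rule that[OF _ dln])
    show "\<forall>\<^sub>F p in sequentially. 0 \<le> d p" using d_pos by eventually_elim simp
    fix \<eta> :: real assume "0 < \<eta>"
    then have "\<forall>\<^sub>F p in sequentially. K / R p < \<eta>" by (rule order_tendstoD(2)[OF KR])
    then show "\<forall>\<^sub>F p in sequentially. 1 - \<eta> \<le> measure (\<mu> p) {X \<in> space (\<mu> p). design_good (n p) p (d p) X}"
      using design R1 p2 c_n d_pos
    proof eventually_elim
      case (elim p)
      define l where "l = ln (real p)"
      have l: "0 < l" using elim by (simp add: l_def)
      have R: "real (n p) = R p * (real p * l\<^sup>2)" "0 < R p"
        using elim l by (simp_all add: R_def l_def)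
      have "(sqrt (sqrt (R p))) ^ 4 = ((sqrt (sqrt (R p)))\<^sup>2)\<^sup>2" by (simp flip: power_mult)
      then have "(sqrt (sqrt (R p))) ^ 4 = R p" using R(2) by simp
      then have "d p ^ 4 = 1 / (l ^ 4 * R p)" by (simp add: d_def l_def power_divide power_mult_distrib)
      moreover have "(real (n p))\<^sup>2 = (R p)\<^sup>2 * ((real p)\<^sup>2 * l ^ 4)"
        unfolding R(1) by (simp add: power_mult_distrib flip: power_mult)
      ultimately have "(real (n p))\<^sup>2 * d p ^ 4 = (real p)\<^sup>2 * R p"
        using l R(2) by (simp add: power2_eq_square)
      then have "(real p)\<^sup>2 * K / ((real (n p))\<^sup>2 * d p ^ 4) = K / R p" using elim by simp
      with subG_design_good[OF elim(2) elim(5) elim(6)] elim(1) show ?case by (simp add: K_def)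
    qed
  qed
qed

theorem mainTheorem7:
  fixes s :: nat and sigma2 :: real
    and n :: "nat \<Rightarrow> nat"
    and \<mu> :: "nat \<Rightarrow> (nat \<Rightarrow> nat \<Rightarrow> real) measure"
  assumes "s \<ge> 1"
    and "filterlim n at_top sequentially"
    and "((\<forall>\<^sub>F p in sequentially. subG_design sigma2 (n p) p (\<mu> p)) \<and>
           filterlim (\<lambda>p. real (n p) / (real p * (ln (real p))\<^sup>2)) at_top sequentially)
         \<or> (\<forall>\<^sub>F p in sequentially. orth_design (n p) p (\<mu> p) \<and> n p \<ge> p)"
  shows "(\<lambda>p. minimax_risk (n p) p (\<mu> p) s (sqrt (2 * ln (real p) / real (n p))))
           \<longlonglongrightarrow> (1/2) ^ s"
  using assms(3)
proof (elim disjE conjE)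
  assume design: "\<forall>\<^sub>F p in sequentially. subG_design sigma2 (n p) p (\<mu> p)"
    and lim: "filterlim (\<lambda>p. real (n p) / (real p * (ln (real p))\<^sup>2)) at_top sequentially"
  obtain d where d: "\<forall>\<^sub>F p in sequentially. 0 \<le> d p" "(\<lambda>p. d p * ln (real p)) \<longlonglongrightarrow> 0"
    "\<And>\<eta>. 0 < \<eta> \<Longrightarrow> \<forall>\<^sub>F p in sequentially. 1 - \<eta> \<le> measure (\<mu> p) {X \<in> space (\<mu> p). design_good (n p) p (d p) X}"
    using subG_deviation_scale[OF lim assms(2) design] by blast
  have "\<forall>\<^sub>F p in sequentially. prob_space (\<mu> p) \<and> sets (\<mu> p) = sets (matM (n p) p)"
    using design by eventually_elim (intro conjI subG_design_basic)
  then show ?thesis by (rule minimax_risk_tendsto[OF assms(1,2) _ d])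
next
  assume design: "\<forall>\<^sub>F p in sequentially. orth_design (n p) p (\<mu> p) \<and> n p \<ge> p"
  have pos: "\<forall>\<^sub>F p in sequentially. 0 < n p"
    by (rule eventually_compose_filterlim[OF eventually_gt_at_top assms(2)])
  show ?thesis
  \<comment> \<open>Exact orthogonality permits deviation 0, and the good event then has probability
    1.\<close>
  proof (rule minimax_risk_tendsto[OF assms(1,2), where d = "\<lambda>_. 0"])
    show "\<forall>\<^sub>F p in sequentially. prob_space (\<mu> p) \<and> sets (\<mu> p) = sets (matM (n p) p)"
      using design by eventually_elim (auto simp: orth_design_def)
    show "\<forall>\<^sub>F p in sequentially. 1 - \<eta> \<le> measure (\<mu> p) {X \<in> space (\<mu> p). design_good (n p) p 0 X}" if "0 < \<eta>" for \<eta>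
      using design pos by eventually_elim (use that in \<open>simp add: orth_design_good\<close>)
  qed auto
qed

end
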